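(* Let $J$ be an almost complex structure on $A$ and suppose that the right bimodule covariant derivative $(\Omega^1A,\square,\sigma^{-1})$ satisfies: a) $\wedge:\Omega^{1,0}A\otimes_A\Omega^{0,1}A\to\Omega^{1,1}A$ is an isomorphism with inverse $\phi$; b) $(J\otimes\mathrm{id})\square=\square\,J:\Omega^1A\to\Omega^1A\otimes_A\Omega^1A$; c) $\pi^{1,1}\mathrm{Tor}_R:\Omega^1A\to\Omega^{1,1}A$ vanishes, where $\mathrm{Tor}_R=\mathrm d+\wedge\,\square$; d) $\pi^{1,1}\wedge\sigma^{-1}=-\pi^{0,1}\wedge\pi^{1,0}-\pi^{1,0}\wedge\pi^{0,1}$ on $\Omega^1A\otimes_A\Omega^1A$. Define $\bar\partial_{\mathcal{HD}}:\mathrm{Vec}^{\otimes\le n,0}A\to\Omega^{0,1}A\otimes_A\mathrm{Vec}^{\otimes\le n,0}A$ recursively, beginning with $\bar\partial_{\mathcal{HD}}=\bar\partial:A\to\Omega^{0,1}A$ for $n=0$ and $\bar\partial_{\mathcal{HD}}=(\pi^{0,1}\otimes\mathrm{id})\square:\mathrm{Vec}^{1,0}A\to\Omega^{0,1}A\otimes_A\mathrm{Vec}^{1,0}A$, and, for $u\in\mathrm{Vec}^{1,0}A$ and $\underline v\in\mathrm{Vec}^{\otimes n,0}A$ with $\xi\otimes\underline w=\bar\partial_{\mathcal{HD}}(\underline v)$ (summation implicit), setting $$\bar\partial_{\mathcal{HD}}(u\bullet\underline v)=\big((\pi^{0,1}\otimes\mathrm{id})\square u\big)\bullet\underline v-(\mathrm{ev}\otimes\mathrm{id})\big(u\otimes\phi(\pi^{0,1}\wedge\pi^{1,0})\square(\xi)\big)\otimes\underline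 w-\sum_i(\mathrm{ev}\otimes\mathrm{id})\big(u\otimes\phi(\xi\wedge\eta_i)\big)\otimes\eta^i\bullet\underline w,$$ where $\sum_i\eta_i\otimes\eta^i\in\Omega^{1,0}A\otimes_A\mathrm{Vec}^{1,0}A$ is a dual basis. Then for all $n$: i) $\bar\partial_{\mathcal{HD}}:\mathrm{Vec}^{\otimes\le n,0}A\to\Omega^{0,1}A\otimes_A\mathrm{Vec}^{\otimes\le n,0}A$ is well defined; ii) $\bar\partial_{\mathcal{HD}}:\mathrm{Vec}^{\otimes\le n,0}A\to\Omega^{0,1}A\otimes_A\mathrm{Vec}^{\otimes\le n,0}A$ is a left $\bar\partial$ covariant derivative, i.e. $\bar\partial_{\mathcal{HD}}(a.\underline v)=\bar\partial a\otimes\underline v+a.\bar\partial_{\mathcal{HD}}(\underline v)$ for all $a\in A$.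
   Context: $A$ is a unital $*$-algebra over $\mathbb C$ with a differential graded algebra $(\Omega A=\oplus_n\Omega^nA,\mathrm d,\wedge)$, $\Omega^0A=A$, $\mathrm d^2=0$, graded Leibniz rule, generated over $A$ by $\Omega^1A$, with $\Omega^1A=A.\mathrm dA$, such that $a.\mathrm db\mapsto\mathrm db^*.a^*$ is a well defined star operation on $\Omega^1A$ extending to all $\Omega^nA$. $\Omega^1A$ is finitely generated projective as a right $A$-module. An almost complex structure is an $A$-bimodule map $J:\Omega^1A\to\Omega^1A$ with $J(\xi^* )=J(\xi)^*$, $J^2=-\mathrm{id}$, such that $J\otimes\mathrm{id}^{\otimes n-1}+\dots+\mathrm{id}^{\otimes n-1}\otimes J$ descends via $\wedge$ to a well defined map $J:\Omega^nA\to\Omega^nA$ for each $n$. $\Omega^{p,q}A$ ($p,q\ge0$) is the $\mathrm i(p-q)$-eigenspace of $J$ in $\Omega^{p+q}A$, $\pi^{p,q}:\Omega^{p+q}A\to\Omega^{p,q}A$ the projection, $\partial=\pi^{p+1,q}\mathrm d$ and $\bar\partial=\pi^{p,q+1}\mathrm d$ on $\Omega^{p,q}A$; $\pi^{0,1}\wedge\pi^{1,0}=\wedge\circ(\pi^{0,1}\otimes\pi^{1,0})$, etc. For $\xi\in\Omega^{0,1}A$, $\eta\in\Omega^{1,0}A$ one has $\xi\wedge\eta\in\Omega^{1,1}A$. $\mathrm{Vec}A=\mathrm{Hom}_A(\Omega^1A,A)$ (right module maps), a bimodule by $(a.v)(\xi)=a\,v(\xi)$, $(v.a)(\xi)=v(a\xi)$;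 $J(v)=v\circ J$; $\mathrm{Vec}^{1,0}A$ is the $+\mathrm i$ eigenspace of $J$ on $\mathrm{Vec}A$ (the right dual of $\Omega^{1,0}A$). $\mathrm{Vec}^{\otimes n}A$ is the $n$-fold tensor power over $A$ ($A$ for $n=0$), $\mathrm{Vec}^{\otimes n,0}A=(\mathrm{Vec}^{1,0}A)^{\otimes_An}$, $\mathrm{Vec}^{\otimes\le n,0}A=\bigoplus_{0\le m\le n}\mathrm{Vec}^{\otimes m,0}A$. $\mathrm{ev}$ is evaluation and $\mathrm{coev}(1)=\sum_i\xi_i\otimes u_i\in\Omega^1A\otimes_A\mathrm{Vec}A$ the dual basis. Right bimodule covariant derivative: $\square:\Omega^1A\to\Omega^1A\otimes_A\Omega^1A$, $\square(\xi a)=\square(\xi)a+\xi\otimes\mathrm da$, $\square(a\xi)=a\square(\xi)+\sigma^{-1}(\mathrm da\otimes\xi)$, $\sigma^{-1}$ a bimodule map on $\Omega^1A\otimes_A\Omega^1A$ (not assumed invertible). The dual $\square:\mathrm{Vec}A\to\Omega^1A\otimes_A\mathrm{Vec}A$ is determined by $\mathrm d\circ\mathrm{ev}=(\mathrm{id}\otimes\mathrm{ev})(\square\otimes\mathrm{id})+(\mathrm{ev}\otimes\mathrm{id})(\mathrm{id}\otimes\square)$, with $\sigma=(\mathrm{ev}\otimes\mathrm{id}\otimes\mathrm{id})(\mathrm{id}\otimes\sigma^{-1}\otimes\mathrm{id})(\mathrm{id}\otimes\mathrm{id}\otimes\mathrm{coev}(1))$; it extends to $\square^{\langle n\rangle}:\mathrm{Vec}^{\otimes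 n}A\to\Omega^1A\otimes_A\mathrm{Vec}^{\otimes n}A$ by $\square^{\langle0\rangle}=\mathrm d$, $\square^{\langle n+1\rangle}=\square\otimes\mathrm{id}^{\otimes n}+(\sigma\otimes\mathrm{id}^{\otimes n})(\mathrm{id}\otimes\square^{\langle n\rangle})$. $\mathcal T\mathrm{Vec}A_\bullet=\bigoplus_{n\ge0}\mathrm{Vec}^{\otimes n}A$ with the associative unital product $\bullet$ determined by $a\bullet\underline w=a.\underline w$, $u\bullet\underline w=u\otimes\underline w+(\mathrm{ev}\otimes\mathrm{id}^{\otimes m})(u\otimes\square^{\langle m\rangle}\underline w)$ and $(u\otimes\underline v)\bullet\underline w=u\bullet(\underline v\bullet\underline w)-\big((\mathrm{ev}\otimes\mathrm{id}^{\otimes n})(u\otimes\square^{\langle n\rangle}\underline v)\big)\bullet\underline w$, for $a\in A$, $u\in\mathrm{Vec}A$, $\underline v\in\mathrm{Vec}^{\otimes n}A$, $\underline w\in\mathrm{Vec}^{\otimes m}A$. Under b), $\bigoplus_n\mathrm{Vec}^{\otimes n,0}A$ is a subalgebra. $(\omega\otimes\underline x)\bullet\underline v$ means $\omega\otimes(\underline x\bullet\underline v)$. Since $u\bullet\underline v=u\otimes\underline v+(\text{an element of }\mathrm{Vec}^{\otimes n,0}A)$ for $\underline v\in\mathrm{Vec}^{\otimes n,0}A$, the displayed formula prescribes $\bar\partial_{\mathcal{HD}}$ on $\mathrm{Vec}^{\otimes\le n+1,0}A$ from its values on $\mathrm{Vec}^{\otimes\le n,0}A$ ($n\ge1$). 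*)

theory Defs
  imports Complex_Main "HOL-Library.Multiset" "HOL-Library.FuncSet"
begin

section \<open>Differential graded star-algebras\<close>

text \<open>
  The type is the total algebra \<open>\<Omega>A = (\<Oplus>n. \<Omega>\<^sup>n A)\<close>; \<open>Om n\<close> is \<open>\<Omega>\<^sup>n A\<close>, and \<open>A\<close> itself is the subalgebra
  \<open>Om 0\<close>.  Multiplication is at once the product of \<open>A\<close>, the two actions of \<open>A\<close> on forms, and the
  wedge product.  The class \<open>ring_1\<close> is avoided because it excludes the zero algebra.

  The star is graded: \<open>star (x * y) = (-1)^(m*n) star y * star x\<close>.  This sign is forced by
  \<open>star (a * exd b) = exd (star b) * star a\<close> together with compatibility of the star with \<open>exd\<close>.
\<close>

class star_dga = ring + monoid_mult +
  fixes cscale :: "complex \<Rightarrow> 'a \<Rightarrow> 'a" (infixr "*\<^sub>C" 75)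
    and Om :: "nat \<Rightarrow> 'a set"
    and exd :: "'a \<Rightarrow> 'a"
    and star :: "'a \<Rightarrow> 'a"
  assumes cscale_add_right: "c *\<^sub>C (x + y) = c *\<^sub>C x + c *\<^sub>C y"
    and cscale_add_left: "(b + c) *\<^sub>C x = b *\<^sub>C x + c *\<^sub>C x"
    and cscale_cscale: "b *\<^sub>C (c *\<^sub>C x) = (b * c) *\<^sub>C x"
    and cscale_one: "1 *\<^sub>C x = x"
    and cscale_mult_left: "(c *\<^sub>C x) * y = c *\<^sub>C (x * y)"
    and cscale_mult_right: "x * (c *\<^sub>C y) = c *\<^sub>C (x * y)"
    and Om_zero: "0 \<in> Om n"
    and Om_add: "x \<in> Om n \<Longrightarrow> y \<in> Om n \<Longrightarrow> x + y \<in> Om n"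
    and Om_cscale: "x \<in> Om n \<Longrightarrow> c *\<^sub>C x \<in> Om n"
    and Om_one: "1 \<in> Om 0"
    and Om_mult: "x \<in> Om m \<Longrightarrow> y \<in> Om n \<Longrightarrow> x * y \<in> Om (m + n)"
    and Om_direct_sum:
      "\<exists>!f. (\<forall>n. f n \<in> Om n) \<and> finite {n. f n \<noteq> 0} \<and> x = (\<Sum>n | f n \<noteq> 0. f n)"
    and exd_add: "exd (x + y) = exd x + exd y"
    and exd_cscale: "exd (c *\<^sub>C x) = c *\<^sub>C exd x"
    and exd_Om: "x \<in> Om n \<Longrightarrow> exd x \<in> Om (Suc n)"
    and exd_exd: "exd (exd x) = 0"
    and exd_mult: "x \<in> Om n \<Longrightarrow> exd (x * y) = exd x * y + ((-1) ^ n) *\<^sub>C (x * exd y)"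
    and Om_generated: "x \<in> Om n \<Longrightarrow> n > 0 \<Longrightarrow>
      \<exists>ls. (\<forall>l\<in>set ls. length l = n \<and> set l \<subseteq> Om 1) \<and> x = (\<Sum>l\<leftarrow>ls. prod_list l)"
    and Om1_exact: "x \<in> Om 1 \<Longrightarrow>
      \<exists>ps. set ps \<subseteq> Om 0 \<times> Om 0 \<and> x = (\<Sum>(a, b)\<leftarrow>ps. a * exd b)"
    and star_add: "star (x + y) = star x + star y"
    and star_cscale: "star (c *\<^sub>C x) = cnj c *\<^sub>C star x"
    and star_star: "star (star x) = x"
    and star_Om: "x \<in> Om n \<Longrightarrow> star x \<in> Om n"
    and star_mult: "x \<in> Om m \<Longrightarrow> y \<in> Om n \<Longrightarrow>
      star (x * y) = ((-1) ^ (m * n)) *\<^sub>C (star y * star x)"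
    and star_exd: "a \<in> Om 0 \<Longrightarrow> star (exd a) = exd (star a)"

definition additive_on :: "'x::plus set \<Rightarrow> ('x \<Rightarrow> 'y::plus) \<Rightarrow> bool" where
  "additive_on M f \<longleftrightarrow> (\<forall>x\<in>M. \<forall>y\<in>M. f (x + y) = f x + f y)"

definition right_linear_on :: "'w::star_dga set \<Rightarrow> ('w \<Rightarrow> 'w) \<Rightarrow> bool" where
  "right_linear_on M f \<longleftrightarrow> additive_on M f \<and> (\<forall>x\<in>M. \<forall>a\<in>Om 0. f (x * a) = f x * a)"

text \<open>A right module is finitely generated projective if it is a retract of some \<open>A\<^sup>n\<close>.
  Here \<open>A\<^sup>n\<close> consists of the functions \<open>{..<n} \<rightarrow> A\<close>, extended by \<open>0\<close>.\<close>

definition free_mod :: "nat \<Rightarrow> (nat \<Rightarrow> 'w::star_dga) set" where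
  "free_mod n = {f. (\<forall>i<n. f i \<in> Om 0) \<and> (\<forall>i\<ge>n. f i = 0)}"

definition right_fgp :: "'w::star_dga set \<Rightarrow> bool" where
  "right_fgp M \<longleftrightarrow> (\<exists>n (inc :: 'w \<Rightarrow> nat \<Rightarrow> 'w) (pr :: (nat \<Rightarrow> 'w) \<Rightarrow> 'w).
     inc \<in> M \<rightarrow> free_mod n \<and> pr \<in> free_mod n \<rightarrow> M \<and>
     (\<forall>i. right_linear_on M (\<lambda>x. inc x i)) \<and>
     (\<forall>f\<in>free_mod n. \<forall>g\<in>free_mod n. pr (\<lambda>i. f i + g i) = pr f + pr g) \<and>
     (\<forall>f\<in>free_mod n. \<forall>a\<in>Om 0. pr (\<lambda>i. f i * a) = pr f * a) \<and>
     (\<forall>x\<in>M. pr (inc x) = x))"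

text \<open>\<open>Vec A = Hom\<^sub>A(\<Omega>\<^sup>1A, A)\<close>; its elements are made to vanish off \<open>\<Omega>\<^sup>1A\<close> so that equality of maps
  on \<open>\<Omega>\<^sup>1A\<close> is equality of functions.\<close>

definition Vec :: "('w::star_dga \<Rightarrow> 'w) set" where
  "Vec = {v. v \<in> Om 1 \<rightarrow> Om 0 \<and> right_linear_on (Om 1) v \<and> (\<forall>x. x \<notin> Om 1 \<longrightarrow> v x = 0)}"

definition vec_lact :: "'w::star_dga \<Rightarrow> ('w \<Rightarrow> 'w) \<Rightarrow> 'w \<Rightarrow> 'w" where
  "vec_lact a v = (\<lambda>\<xi>. if \<xi> \<in> Om 1 then a * v \<xi> else 0)"

definition vec_ract :: "('w::star_dga \<Rightarrow> 'w) \<Rightarrow> 'w \<Rightarrow> 'w \<Rightarrow> 'w" where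
  "vec_ract v a = (\<lambda>\<xi>. if \<xi> \<in> Om 1 then v (a * \<xi>) else 0)"


section \<open>Tensor products over A\<close>

text \<open>
  All tensor products over \<open>A\<close> below are iterated tensor products of copies of \<open>\<Omega>\<^sup>1A\<close> and \<open>Vec A\<close>, or of
  direct summands of these such as \<open>\<Omega>\<^bsup>1,0\<^esup>A\<close> and \<open>Vec\<^bsup>1,0\<^esup>A\<close>.  They are all submodules of one algebra,
  the tensor algebra of the \<open>A\<close>-bimodule \<open>\<Omega>\<^sup>1A \<oplus> Vec A\<close>, with \<open>A\<close> in degree \<open>0\<close>; it is graded by the
  words in \<open>\<Omega>\<^sup>1A\<close>, \<open>Vec A\<close>, each component being the corresponding iterated tensor product.  In this
  algebra \<open>x \<otimes>\<^sub>A y\<close> is the product \<open>x * y\<close>.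

  It consists of the formal sums (multisets) of words of elements of \<open>A\<close>, \<open>\<Omega>\<^sup>1A\<close> and \<open>Vec A\<close>, modulo
  additivity in each letter and contraction of a scalar letter with either neighbour by the
  module action; the latter contains the balancing relation \<open>x a \<otimes> y = x \<otimes> a y\<close>.  Letters not in
  \<open>A\<close>, \<open>\<Omega>\<^sup>1A\<close>, \<open>Vec A\<close> are set to \<open>0\<close>.
\<close>

datatype 'w letter = Scalar 'w | Form 'w | Vector "'w \<Rightarrow> 'w"

inductive tens_rel :: "'w::star_dga letter list \<Rightarrow> 'w letter list multiset \<Rightarrow> bool" where
  "a \<notin> Om 0 \<Longrightarrow> tens_rel [Scalar a] {#}"
| "\<xi> \<notin> Om 1 \<Longrightarrow> tens_rel [Form \<xi>] {#}"
| "v \<notin> Vec \<Longrightarrow> tens_rel [Vector v] {#}"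
| "tens_rel [Scalar 0] {#}"
| "tens_rel [Scalar 1] {#[]#}"
| "a \<in> Om 0 \<Longrightarrow> b \<in> Om 0 \<Longrightarrow> tens_rel [Scalar (a + b)] {#[Scalar a], [Scalar b]#}"
| "\<xi> \<in> Om 1 \<Longrightarrow> \<eta> \<in> Om 1 \<Longrightarrow> tens_rel [Form (\<xi> + \<eta>)] {#[Form \<xi>], [Form \<eta>]#}"
| "u \<in> Vec \<Longrightarrow> v \<in> Vec \<Longrightarrow> tens_rel [Vector (\<lambda>\<xi>. u \<xi> + v \<xi>)] {#[Vector u], [Vector v]#}"
| "a \<in> Om 0 \<Longrightarrow> b \<in> Om 0 \<Longrightarrow> tens_rel [Scalar a, Scalar b] {#[Scalar (a * b)]#}"
| "a \<in> Om 0 \<Longrightarrow> \<xi> \<in> Om 1 \<Longrightarrow> tens_rel [Scalar a, Form \<xi>] {#[Form (a * \<xi>)]#}"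
| "a \<in> Om 0 \<Longrightarrow> \<xi> \<in> Om 1 \<Longrightarrow> tens_rel [Form \<xi>, Scalar a] {#[Form (\<xi> * a)]#}"
| "a \<in> Om 0 \<Longrightarrow> v \<in> Vec \<Longrightarrow> tens_rel [Scalar a, Vector v] {#[Vector (vec_lact a v)]#}"
| "a \<in> Om 0 \<Longrightarrow> v \<in> Vec \<Longrightarrow> tens_rel [Vector v, Scalar a] {#[Vector (vec_ract v a)]#}"

inductive tens_step ::
  "'w::star_dga letter list multiset \<Rightarrow> 'w letter list multiset \<Rightarrow> bool" where
  "tens_rel l X \<Longrightarrow> tens_step (Z + {#p @ l @ q#}) (Z + {#p @ r @ q. r \<in># X#})"

definition tens_eq ::
  "'w::star_dga letter list multiset \<Rightarrow> 'w letter list multiset \<Rightarrow> bool" where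
  "tens_eq = equivclp tens_step"

quotient_type (overloaded) 'w tens = "'w::star_dga letter list multiset" / tens_eq
  unfolding tens_eq_def by (rule equivp_evquivclp)

definition word_mult ::
  "'w letter list multiset \<Rightarrow> 'w letter list multiset \<Rightarrow> 'w letter list multiset" where
  "word_mult X Y = (\<Sum>p\<in>#X. {#p @ q. q \<in># Y#})"

lemma tens_eq_refl: "tens_eq X X"
  by (simp add: tens_eq_def)

lemma tens_eq_sym: "tens_eq X Y \<Longrightarrow> tens_eq Y X"
  unfolding tens_eq_def by (rule equivclp_sym)

lemma tens_eq_trans: "tens_eq X Y \<Longrightarrow> tens_eq Y Z \<Longrightarrow> tens_eq X Z"
  unfolding tens_eq_def by (rule equivclp_trans)

lemma tens_eq_rel: "tens_rel l X \<Longrightarrow> tens_eq {#p @ l @ q#} {#p @ r @ q. r \<in># X#}"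
  unfolding tens_eq_def
  using tens_step.intros[of l X "{#}" p q] by (simp add: r_into_equivclp)

lemma tens_eq_map:
  assumes step: "\<And>X Y. tens_step X Y \<Longrightarrow> tens_eq (f X) (f Y)" and XY: "tens_eq X Y"
  shows "tens_eq (f X) (f Y)"
  using XY unfolding tens_eq_def
proof (induction rule: equivclp_induct)
  case base
  then show ?case by simp
next
  case (step Y Z)
  then have "tens_eq (f Y) (f Z)"
    using assms(1) tens_eq_sym by blast
  then show ?case
    using step.IH tens_eq_trans unfolding tens_eq_def by blast
qed

lemma tens_step_add: "tens_step X Y \<Longrightarrow> tens_step (X + W) (Y + W)"
proof (induction rule: tens_step.induct)
  case (1 l X Z p q)
  then show ?case
    using tens_step.intros[of l X "Z + W" p q] by (simp add: ac_simps)
qed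

lemma tens_eq_add1: "tens_eq X Y \<Longrightarrow> tens_eq (X + W) (Y + W)"
  by (rule tens_eq_map[where f = "\<lambda>X. X + W"])
    (auto simp: tens_eq_def intro: r_into_equivclp tens_step_add)

lemma tens_eq_add: "tens_eq X Y \<Longrightarrow> tens_eq V W \<Longrightarrow> tens_eq (X + V) (Y + W)"
  by (metis add.commute tens_eq_add1 tens_eq_trans)

lemma word_mult_empty [simp]: "word_mult {#} Y = {#}" "word_mult X {#} = {#}"
  by (auto simp: word_mult_def)

lemma word_mult_add_left: "word_mult (X + X') Y = word_mult X Y + word_mult X' Y"
  by (simp add: word_mult_def)

lemma word_mult_add_right: "word_mult X (Y + Y') = word_mult X Y + word_mult X Y'"
  by (simp add: word_mult_def sum_mset.distrib)

lemma word_mult_single: "word_mult {#p#} {#q#} = {#p @ q#}"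
  by (simp add: word_mult_def)

lemma word_mult_single_left: "word_mult {#p#} Y = {#p @ q. q \<in># Y#}"
  by (simp add: word_mult_def)

lemma word_mult_single_right: "word_mult X {#q#} = {#p @ q. p \<in># X#}"
  by (induction X) (auto simp: word_mult_def)

lemma tens_eq_word_mult_single:
  assumes "tens_eq X Y"
  shows "tens_eq (word_mult X {#w#}) (word_mult Y {#w#})"
    and "tens_eq (word_mult {#w#} X) (word_mult {#w#} Y)"
proof -
  have "tens_eq (word_mult X {#w#}) (word_mult Y {#w#}) \<and>
        tens_eq (word_mult {#w#} X) (word_mult {#w#} Y)" if "tens_step X Y" for X Y
    using that
  proof cases
    case (1 l U Z p q)
    have 2: "tens_eq {#p @ l @ q @ w#} {#p @ r @ q @ w. r \<in># U#}"
      using tens_eq_rel[OF 1(3), of p "q @ w"] by simp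
    have 3: "tens_eq {#w @ p @ l @ q#} {#w @ p @ r @ q. r \<in># U#}"
      using tens_eq_rel[OF 1(3), of "w @ p" q] by simp
    show ?thesis
      unfolding 1 word_mult_single_right word_mult_single_left image_mset_union
      using tens_eq_add[OF tens_eq_refl 2] tens_eq_add[OF tens_eq_refl 3]
      by (simp add: multiset.map_comp o_def)
  qed
  then show "tens_eq (word_mult X {#w#}) (word_mult Y {#w#})"
    "tens_eq (word_mult {#w#} X) (word_mult {#w#} Y)"
    using tens_eq_map[OF _ assms, of "\<lambda>X. word_mult X {#w#}"]
      tens_eq_map[OF _ assms, of "\<lambda>X. word_mult {#w#} X"] by blast+
qed

lemma tens_eq_word_mult_left: "tens_eq X Y \<Longrightarrow> tens_eq (word_mult X W) (word_mult Y W)"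
proof (induction W)
  case (add w W)
  then show ?case
    using word_mult_add_right[of _ "{#w#}" W]
    by (simp add: tens_eq_add tens_eq_word_mult_single)
qed (simp add: tens_eq_refl)

lemma tens_eq_word_mult_right: "tens_eq X Y \<Longrightarrow> tens_eq (word_mult W X) (word_mult W Y)"
proof (induction W)
  case (add w W)
  then show ?case
    using word_mult_add_left[of "{#w#}" W]
    by (simp add: tens_eq_add tens_eq_word_mult_single)
qed (simp add: tens_eq_refl)

lemma tens_eq_word_mult:
  "tens_eq X Y \<Longrightarrow> tens_eq V W \<Longrightarrow> tens_eq (word_mult X V) (word_mult Y W)"
  using tens_eq_trans tens_eq_word_mult_left tens_eq_word_mult_right by blast

lemma word_mult_assoc: "word_mult (word_mult X Y) Z = word_mult X (word_mult Y Z)"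
proof (induction X)
  case (add x X)
  have "word_mult (word_mult {#x#} Y) Z = word_mult {#x#} (word_mult Y Z)"
  proof (induction Y)
    case (add y Y)
    have "word_mult (word_mult {#x#} {#y#}) Z = word_mult {#x#} (word_mult {#y#} Z)"
      by (simp add: word_mult_single_left multiset.map_comp o_def)
    then show ?case
      using add word_mult_add_left[of "{#y#}" Y] word_mult_add_right[of "{#x#}" "{#y#}" Y]
      by (simp add: word_mult_add_left word_mult_add_right)
  qed simp
  then show ?case
    using add word_mult_add_left[of "{#x#}" X] by (simp add: word_mult_add_left)
qed simp

lemma minus_one_Om0: "- 1 \<in> (Om 0 :: 'w::star_dga set)"
proof -
  have "(- 1) *\<^sub>C (1 :: 'w) + 1 = ((- 1) + 1) *\<^sub>C 1"
    by (metis cscale_add_left cscale_one)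
  also have "\<dots> = 0"
    by (metis add_cancel_right_right cscale_add_left add.left_neutral add.left_inverse)
  finally have "(- 1) *\<^sub>C (1 :: 'w) = - 1"
    by (simp add: eq_neg_iff_add_eq_0)
  then show ?thesis
    by (metis Om_cscale Om_one)
qed

lemma tens_eq_inverse: "tens_eq (word_mult {#[Scalar (- 1)]#} X + X) {#}"
proof -
  have 1: "tens_eq {#[Scalar 1]#} {#[]#}"
    using tens_eq_rel[OF tens_rel.intros(5), of "[]" "[]"] by simp
  have 2: "tens_eq {#[Scalar (- 1 + 1)]#} ({#[Scalar (- 1)]#} + {#[Scalar 1]#})"
    using tens_eq_rel[OF tens_rel.intros(6)[OF minus_one_Om0 Om_one], of "[]" "[]"]
    by (simp add: add_mset_commute)
  have 3: "tens_eq {#[Scalar (- 1 + 1)]#} {#}"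
    using tens_eq_rel[OF tens_rel.intros(4), of "[]" "[]"] by simp
  have "tens_eq ({#[Scalar (- 1)]#} + {#[]#}) {#}"
    by (meson 1 2 3 tens_eq_add tens_eq_refl tens_eq_sym tens_eq_trans)
  then have "tens_eq (word_mult ({#[Scalar (- 1)]#} + {#[]#}) X) (word_mult {#} X)"
    by (rule tens_eq_word_mult_left)
  then show ?thesis
    unfolding word_mult_add_left word_mult_empty by (simp add: word_mult_single_left)
qed

instantiation tens :: (star_dga) "{ring, monoid_mult}"
begin

lift_definition zero_tens :: "'a tens" is "{#}" .
lift_definition one_tens :: "'a tens" is "{#[]#}" .
lift_definition plus_tens :: "'a tens \<Rightarrow> 'a tens \<Rightarrow> 'a tens" is "(+)" by (rule tens_eq_add)
lift_definition times_tens :: "'a tens \<Rightarrow> 'a tens \<Rightarrow> 'a tens" is word_mult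
  by (rule tens_eq_word_mult)
lift_definition uminus_tens :: "'a tens \<Rightarrow> 'a tens" is "word_mult {#[Scalar (- 1)]#}"
  by (rule tens_eq_word_mult_right)
definition minus_tens :: "'a tens \<Rightarrow> 'a tens \<Rightarrow> 'a tens" where "minus_tens x y = x + (- y)"

instance
proof
  fix x y z :: "'a tens"
  show "x * y * z = x * (y * z)"
    by transfer (simp add: word_mult_assoc tens_eq_refl)
  show "x + y + z = x + (y + z)"
    by transfer (simp add: add.assoc tens_eq_refl)
  show "x + y = y + x"
    by transfer (simp add: add.commute tens_eq_refl)
  show "0 + x = x"
    by transfer (simp add: tens_eq_refl)
  show "- x + x = 0"
    by transfer (rule tens_eq_inverse)
  show "x - y = x + - y"
    by (rule minus_tens_def)
  show "(x + y) * z = x * z + y * z"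
    by transfer (simp add: word_mult_add_left tens_eq_refl)
  show "x * (y + z) = x * y + x * z"
    by transfer (simp add: word_mult_add_right tens_eq_refl)
  show "1 * x = x"
    by transfer (simp add: word_mult_single_left tens_eq_refl)
  show "x * 1 = x"
    by transfer (simp add: word_mult_single_right tens_eq_refl)
qed

end

lift_definition scal :: "'w::star_dga \<Rightarrow> 'w tens" is "\<lambda>a. {#[Scalar a]#}" .
lift_definition form :: "'w::star_dga \<Rightarrow> 'w tens" is "\<lambda>\<xi>. {#[Form \<xi>]#}" .
lift_definition vect :: "('w::star_dga \<Rightarrow> 'w) \<Rightarrow> 'w tens" is "\<lambda>v. {#[Vector v]#}" .

text \<open>The submodule \<open>X \<otimes>\<^sub>A Y\<close>, and the powers \<open>V\<^bsup>\<otimes>n\<^esup>\<close> (\<open>A\<close> for \<open>n = 0\<close>) and \<open>V\<^bsup>\<otimes>\<le>n\<^esup>\<close>.\<close>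

definition tens_prod :: "'w::star_dga tens set \<Rightarrow> 'w tens set \<Rightarrow> 'w tens set"
    (infixr "\<otimes>\<^sub>A" 70) where
  "X \<otimes>\<^sub>A Y = {\<Sum>(x, y)\<leftarrow>ps. x * y | ps. set ps \<subseteq> X \<times> Y}"

primrec tens_pow :: "'w::star_dga tens set \<Rightarrow> nat \<Rightarrow> 'w tens set" where
  "tens_pow V 0 = scal ` Om 0"
| "tens_pow V (Suc n) = V \<otimes>\<^sub>A tens_pow V n"

definition tens_pow_le :: "'w::star_dga tens set \<Rightarrow> nat \<Rightarrow> 'w tens set" where
  "tens_pow_le V n = {\<Sum>m\<le>n. f m | f. \<forall>m\<le>n. f m \<in> tens_pow V m}"

definition TVec :: "'w::star_dga tens set" where
  "TVec = (\<Union>n. tens_pow_le (vect ` Vec) n)"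

text \<open>Component in \<open>Vec\<^bsup>\<otimes>m\<^esup>A\<close> of an element of \<open>TVec\<close>.\<close>

definition vcomp :: "nat \<Rightarrow> 'w::star_dga tens \<Rightarrow> 'w tens" where
  "vcomp m x = (THE y. \<exists>f. (\<forall>k. f k \<in> tens_pow (vect ` Vec) k) \<and> finite {k. f k \<noteq> 0} \<and>
     x = (\<Sum>k | f k \<noteq> 0. f k) \<and> y = f m)"

text \<open>
  The additive map determined by \<open>dec p \<mapsto> val p\<close> for \<open>p \<in> P\<close>, on the span of the \<open>dec p\<close>.  This is how
  maps are specified on decomposable tensors; it is meaningful when the result does not depend on
  the decomposition.
\<close>

definition lin_ext ::
  "'p set \<Rightarrow> ('p \<Rightarrow> 'x::monoid_add) \<Rightarrow> ('p \<Rightarrow> 'y::monoid_add) \<Rightarrow> 'x \<Rightarrow> 'y" where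
  "lin_ext P dec val x =
     (THE y. \<exists>ps. set ps \<subseteq> P \<and> x = (\<Sum>p\<leftarrow>ps. dec p) \<and> y = (\<Sum>p\<leftarrow>ps. val p))"

text \<open>\<open>map_fst f\<close> is \<open>f \<otimes> id\<close> on \<open>\<Omega>\<^sup>1A \<otimes> X\<close>; \<open>ev_id\<close> is \<open>ev \<otimes> id\<close> on \<open>Vec A \<otimes> \<Omega>\<^sup>1A \<otimes> X\<close>; \<open>id_ev\<close> is
  \<open>id \<otimes> ev\<close> on \<open>\<Omega>\<^sup>1A \<otimes> Vec A \<otimes> \<Omega>\<^sup>1A\<close>; \<open>wedge2 f g\<close> is \<open>\<and>(f \<otimes> g)\<close> on \<open>\<Omega>\<^sup>1A \<otimes> \<Omega>\<^sup>1A\<close>.\<close>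

definition map_fst :: "('w::star_dga \<Rightarrow> 'w) \<Rightarrow> 'w tens \<Rightarrow> 'w tens" where
  "map_fst f = lin_ext (Om 1 \<times> UNIV) (\<lambda>(\<xi>, x). form \<xi> * x) (\<lambda>(\<xi>, x). form (f \<xi>) * x)"

definition ev_id :: "'w::star_dga tens \<Rightarrow> 'w tens" where
  "ev_id = lin_ext (Vec \<times> Om 1 \<times> UNIV)
     (\<lambda>(v, \<xi>, x). vect v * form \<xi> * x) (\<lambda>(v, \<xi>, x). scal (v \<xi>) * x)"

definition id_ev :: "'w::star_dga tens \<Rightarrow> 'w tens" where
  "id_ev = lin_ext (Om 1 \<times> Vec \<times> Om 1)
     (\<lambda>(\<omega>, v, \<xi>). form \<omega> * vect v * form \<xi>) (\<lambda>(\<omega>, v, \<xi>). form \<omega> * scal (v \<xi>))"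

definition wedge2 :: "('w::star_dga \<Rightarrow> 'w) \<Rightarrow> ('w \<Rightarrow> 'w) \<Rightarrow> 'w tens \<Rightarrow> 'w" where
  "wedge2 f g = lin_ext (Om 1 \<times> Om 1) (\<lambda>(\<xi>, \<eta>). form \<xi> * form \<eta>) (\<lambda>(\<xi>, \<eta>). f \<xi> * g \<eta>)"

abbreviation wedge :: "'w::star_dga tens \<Rightarrow> 'w" where
  "wedge \<equiv> wedge2 id id"

text \<open>Dual bases \<open>\<Sum>\<^sub>i \<xi>\<^sub>i \<otimes> u\<^sub>i\<close> of \<open>M\<close>, with \<open>N\<close> the right dual of \<open>M\<close>, and \<open>coev(1)\<close>.\<close>

definition dual_basis ::
  "'w::star_dga set \<Rightarrow> ('w \<Rightarrow> 'w) set \<Rightarrow> ('w \<times> ('w \<Rightarrow> 'w)) list \<Rightarrow> bool" where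
  "dual_basis M N bs \<longleftrightarrow> set bs \<subseteq> M \<times> N \<and> (\<forall>\<omega>\<in>M. \<omega> = (\<Sum>(\<xi>, u)\<leftarrow>bs. \<xi> * u \<omega>))"

definition coev1 :: "'w::star_dga tens" where
  "coev1 = (THE c. \<exists>bs. dual_basis (Om 1) Vec bs \<and> c = (\<Sum>(\<xi>, u)\<leftarrow>bs. form \<xi> * vect u))"


section \<open>Almost complex structures\<close>

text \<open>\<open>wedge_J J\<close> sends \<open>(\<xi>\<^sub>1, \<dots>, \<xi>\<^sub>n)\<close> to \<open>(\<Sum>k. \<xi>\<^sub>1 \<and> \<dots> \<and> J \<xi>\<^sub>k \<and> \<dots> \<and> \<xi>\<^sub>n)\<close>.  The last clause of
  \<open>almost_complex\<close> says that this vanishes on the kernel of \<open>\<and>\<close>.  In degree \<open>0\<close> the sum is empty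
  and \<open>J = 0\<close> on \<open>A\<close>.\<close>

definition wedge_J :: "('w::star_dga \<Rightarrow> 'w) \<Rightarrow> 'w list \<Rightarrow> 'w" where
  "wedge_J J l = (\<Sum>k<length l. prod_list (l[k := J (l ! k)]))"

definition almost_complex :: "('w::star_dga \<Rightarrow> 'w) \<Rightarrow> bool" where
  "almost_complex J \<longleftrightarrow>
     J \<in> Om 1 \<rightarrow> Om 1 \<and> right_linear_on (Om 1) J \<and>
     (\<forall>a\<in>Om 0. \<forall>\<xi>\<in>Om 1. J (a * \<xi>) = a * J \<xi>) \<and>
     (\<forall>\<xi>\<in>Om 1. J (star \<xi>) = star (J \<xi>)) \<and>
     (\<forall>\<xi>\<in>Om 1. J (J \<xi>) = - \<xi>) \<and>
     (\<forall>n>0. \<forall>ls. (\<forall>l\<in>set ls. length l = n \<and> set l \<subseteq> Om 1) \<and> (\<Sum>l\<leftarrow>ls. prod_list l) = 0 \<longrightarrow>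
        (\<Sum>l\<leftarrow>ls. wedge_J J l) = 0)"

definition J_forms :: "('w::star_dga \<Rightarrow> 'w) \<Rightarrow> nat \<Rightarrow> 'w \<Rightarrow> 'w" where
  "J_forms J n x = (if n = 0 then 0
     else lin_ext {l. length l = n \<and> set l \<subseteq> Om 1} prod_list (wedge_J J) x)"

definition Ompq :: "('w::star_dga \<Rightarrow> 'w) \<Rightarrow> nat \<Rightarrow> nat \<Rightarrow> 'w set" where
  "Ompq J p q = {x \<in> Om (p + q). J_forms J (p + q) x = (\<i> * (of_nat p - of_nat q)) *\<^sub>C x}"

definition proj :: "('w::star_dga \<Rightarrow> 'w) \<Rightarrow> nat \<Rightarrow> nat \<Rightarrow> 'w \<Rightarrow> 'w" where
  "proj J p q x = (THE y. \<exists>f. (\<forall>k\<le>p + q. f k \<in> Ompq J k (p + q - k)) \<and>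
     x = (\<Sum>k\<le>p + q. f k) \<and> y = f p)"

text \<open>\<open>\<partial>\<^bsup>bar\<^esup> : \<Omega>\<^bsup>p,q\<^esup>A \<rightarrow> \<Omega>\<^bsup>p,q+1\<^esup>A\<close>\<close>

definition dbar :: "('w::star_dga \<Rightarrow> 'w) \<Rightarrow> nat \<Rightarrow> nat \<Rightarrow> 'w \<Rightarrow> 'w" where
  "dbar J p q x = proj J p (Suc q) (exd x)"

definition Vec10 :: "('w::star_dga \<Rightarrow> 'w) \<Rightarrow> ('w \<Rightarrow> 'w) set" where
  "Vec10 J = {v \<in> Vec. \<forall>\<xi>\<in>Om 1. v (J \<xi>) = \<i> *\<^sub>C v \<xi>}"

abbreviation Vecpow0 :: "('w::star_dga \<Rightarrow> 'w) \<Rightarrow> nat \<Rightarrow> 'w tens set" where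
  "Vecpow0 J n \<equiv> tens_pow (vect ` Vec10 J) n"

abbreviation Vecle0 :: "('w::star_dga \<Rightarrow> 'w) \<Rightarrow> nat \<Rightarrow> 'w tens set" where
  "Vecle0 J n \<equiv> tens_pow_le (vect ` Vec10 J) n"


section \<open>Covariant derivatives\<close>

definition right_bimod_conn ::
  "('w::star_dga \<Rightarrow> 'w tens) \<Rightarrow> ('w tens \<Rightarrow> 'w tens) \<Rightarrow> bool" where
  "right_bimod_conn sq sinv \<longleftrightarrow>
     (let \<Omega>\<Omega> = form ` Om 1 \<otimes>\<^sub>A form ` Om 1 in
       sinv \<in> \<Omega>\<Omega> \<rightarrow> \<Omega>\<Omega> \<and> additive_on \<Omega>\<Omega> sinv \<and>
       (\<forall>a\<in>Om 0. \<forall>t\<in>\<Omega>\<Omega>. sinv (scal a * t) = scal a * sinv t \<and> sinv (t * scal a) = sinv t * scal a) \<and>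
       sq \<in> Om 1 \<rightarrow> \<Omega>\<Omega> \<and> additive_on (Om 1) sq \<and>
       (\<forall>a\<in>Om 0. \<forall>\<xi>\<in>Om 1. sq (\<xi> * a) = sq \<xi> * scal a + form \<xi> * form (exd a)) \<and>
       (\<forall>a\<in>Om 0. \<forall>\<xi>\<in>Om 1. sq (a * \<xi>) = scal a * sq \<xi> + sinv (form (exd a) * form \<xi>)))"

text \<open>The dual covariant derivative on \<open>Vec A\<close>.\<close>

definition sq_vec :: "('w::star_dga \<Rightarrow> 'w tens) \<Rightarrow> ('w \<Rightarrow> 'w) \<Rightarrow> 'w tens" where
  "sq_vec sq v = (THE t. t \<in> form ` Om 1 \<otimes>\<^sub>A vect ` Vec \<and>
     (\<forall>\<xi>\<in>Om 1. form (exd (v \<xi>)) = id_ev (t * form \<xi>) + ev_id (vect v * sq \<xi>)))"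

text \<open>\<open>\<sigma> : Vec A \<otimes> \<Omega>\<^sup>1A \<rightarrow> \<Omega>\<^sup>1A \<otimes> Vec A\<close>; the inner \<open>lin_ext\<close> is \<open>id \<otimes> \<sigma>\<^bsup>-1\<^esup> \<otimes> id\<close>.\<close>

definition sigma :: "('w::star_dga tens \<Rightarrow> 'w tens) \<Rightarrow> 'w tens \<Rightarrow> 'w tens" where
  "sigma sinv t = ev_id (lin_ext (Vec \<times> (form ` Om 1 \<otimes>\<^sub>A form ` Om 1) \<times> Vec)
     (\<lambda>(v, s, u). vect v * s * vect u) (\<lambda>(v, s, u). vect v * sinv s * vect u) (t * coev1))"

definition sigma_id :: "('w::star_dga tens \<Rightarrow> 'w tens) \<Rightarrow> 'w tens \<Rightarrow> 'w tens" where
  "sigma_id sinv = lin_ext ((vect ` Vec \<otimes>\<^sub>A form ` Om 1) \<times> UNIV)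
     (\<lambda>(s, x). s * x) (\<lambda>(s, x). sigma sinv s * x)"

primrec sq_pow ::
  "('w::star_dga \<Rightarrow> 'w tens) \<Rightarrow> ('w tens \<Rightarrow> 'w tens) \<Rightarrow> nat \<Rightarrow> 'w tens \<Rightarrow> 'w tens" where
  "sq_pow sq sinv 0 = lin_ext (Om 0) scal (\<lambda>a. form (exd a))"
| "sq_pow sq sinv (Suc n) = lin_ext (Vec \<times> tens_pow (vect ` Vec) n)
     (\<lambda>(u, w). vect u * w)
     (\<lambda>(u, w). sq_vec sq u * w + sigma_id sinv (vect u * sq_pow sq sinv n w))"


section \<open>The product on TVec\<close>

text \<open>\<open>bullet_deg n x w\<close> is \<open>x \<bullet> w\<close> for \<open>x \<in> Vec\<^bsup>\<otimes>n\<^esup>A\<close>, \<open>w \<in> TVec\<close>.\<close>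

fun bullet_deg :: "('w::star_dga \<Rightarrow> 'w tens) \<Rightarrow> ('w tens \<Rightarrow> 'w tens) \<Rightarrow>
    nat \<Rightarrow> 'w tens \<Rightarrow> 'w tens \<Rightarrow> 'w tens" where
  "bullet_deg sq sinv 0 x w = x * w"
| "bullet_deg sq sinv (Suc 0) x w =
     x * w + (\<Sum>m | vcomp m w \<noteq> 0. ev_id (x * sq_pow sq sinv m (vcomp m w)))"
| "bullet_deg sq sinv (Suc (Suc n)) x w =
     lin_ext (Vec \<times> tens_pow (vect ` Vec) (Suc n))
       (\<lambda>(u, v). vect u * v)
       (\<lambda>(u, v). bullet_deg sq sinv (Suc 0) (vect u) (bullet_deg sq sinv (Suc n) v w)
          - bullet_deg sq sinv (Suc n) (ev_id (vect u * sq_pow sq sinv (Suc n) v)) w) x"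

definition bullet :: "('w::star_dga \<Rightarrow> 'w tens) \<Rightarrow> ('w tens \<Rightarrow> 'w tens) \<Rightarrow>
    'w tens \<Rightarrow> 'w tens \<Rightarrow> 'w tens" where
  "bullet sq sinv x w = (\<Sum>n | vcomp n x \<noteq> 0. bullet_deg sq sinv n (vcomp n x) w)"

text \<open>\<open>(\<omega> \<otimes> x) \<bullet> v = \<omega> \<otimes> (x \<bullet> v)\<close>\<close>

definition form_bullet :: "('w::star_dga \<Rightarrow> 'w tens) \<Rightarrow> ('w tens \<Rightarrow> 'w tens) \<Rightarrow>
    'w tens \<Rightarrow> 'w tens \<Rightarrow> 'w tens" where
  "form_bullet sq sinv t v = lin_ext (Om 1 \<times> TVec)
     (\<lambda>(\<omega>, x). form \<omega> * x) (\<lambda>(\<omega>, x). form \<omega> * bullet sq sinv x v) t"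


section \<open>The operator dbar on TVec\<close>

definition phi :: "('w::star_dga \<Rightarrow> 'w) \<Rightarrow> 'w \<Rightarrow> 'w tens" where
  "phi J = inv_into (form ` Ompq J 1 0 \<otimes>\<^sub>A form ` Ompq J 0 1) wedge"

text \<open>
  The right-hand side of the recursion: \<open>ps\<close> is a decomposition \<open>\<Sum> \<xi> \<otimes> w\<close> of the value at \<open>v\<close>, and \<open>bs\<close>
  a dual basis of \<open>\<Omega>\<^bsup>1,0\<^esup>A\<close>.  The last two sums are independent of the decomposition only jointly.
\<close>

definition HD_rhs :: "('w::star_dga \<Rightarrow> 'w) \<Rightarrow> ('w \<Rightarrow> 'w tens) \<Rightarrow> ('w tens \<Rightarrow> 'w tens) \<Rightarrow>
    ('w \<times> ('w \<Rightarrow> 'w)) list \<Rightarrow> ('w \<Rightarrow> 'w) \<Rightarrow> 'w tens \<Rightarrow> ('w \<times> 'w tens) list \<Rightarrow> 'w tens" where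
  "HD_rhs J sq sinv bs u v ps =
     form_bullet sq sinv (map_fst (proj J 0 1) (sq_vec sq u)) v
     - (\<Sum>(\<xi>, w)\<leftarrow>ps. ev_id (vect u * phi J (wedge2 (proj J 0 1) (proj J 1 0) (sq \<xi>))) * w)
     - (\<Sum>(\<xi>, w)\<leftarrow>ps. \<Sum>(\<eta>, \<eta>')\<leftarrow>bs.
          ev_id (vect u * phi J (\<xi> * \<eta>)) * bullet sq sinv (vect \<eta>') w)"

text \<open>
  \<open>is_dbar_HD J sq sinv n D\<close>: on \<open>Vec\<^bsup>\<otimes>\<le>n,0\<^esup>A\<close>, \<open>D\<close> is an additive map given by the recursion, for
  every choice of decompositions and dual bases.  The recursion is well defined up to level \<open>n\<close> iff
  there is exactly one such map.
\<close>

definition is_dbar_HD :: "('w::star_dga \<Rightarrow> 'w) \<Rightarrow> ('w \<Rightarrow> 'w tens) \<Rightarrow> ('w tens \<Rightarrow> 'w tens) \<Rightarrow>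
    nat \<Rightarrow> ('w tens \<Rightarrow> 'w tens) \<Rightarrow> bool" where
  "is_dbar_HD J sq sinv n D \<longleftrightarrow>
     (\<forall>m\<le>n. D \<in> Vecle0 J m \<rightarrow> form ` Ompq J 0 1 \<otimes>\<^sub>A Vecle0 J m) \<and>
     additive_on (Vecle0 J n) D \<and>
     (\<forall>a\<in>Om 0. D (scal a) = form (dbar J 0 0 a)) \<and>
     (n \<ge> 1 \<longrightarrow> (\<forall>u\<in>Vec10 J. D (vect u) = map_fst (proj J 0 1) (sq_vec sq u))) \<and>
     (\<forall>m. 1 \<le> m \<and> m < n \<longrightarrow>
       (\<forall>u\<in>Vec10 J. \<forall>v\<in>Vecpow0 J m. \<forall>ps bs.
          set ps \<subseteq> Ompq J 0 1 \<times> Vecle0 J m \<and> D v = (\<Sum>(\<xi>, w)\<leftarrow>ps. form \<xi> * w) \<and>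
          dual_basis (Ompq J 1 0) (Vec10 J) bs \<longrightarrow>
          D (bullet sq sinv (vect u) v) = HD_rhs J sq sinv bs u v ps))"

definition left_dbar_derivative ::
  "('w::star_dga \<Rightarrow> 'w) \<Rightarrow> 'w tens set \<Rightarrow> ('w tens \<Rightarrow> 'w tens) \<Rightarrow> bool" where
  "left_dbar_derivative J E D \<longleftrightarrow>
     D \<in> E \<rightarrow> form ` Ompq J 0 1 \<otimes>\<^sub>A E \<and> additive_on E D \<and>
     (\<forall>a\<in>Om 0. \<forall>x\<in>E. D (scal a * x) = form (dbar J 0 0 a) * x + scal a * D x)"

end

theory Submission
  imports Defs "HOL-Library.Product_Plus"
begin

text \<open>
  The product \<open>\<bullet>\<close> makes \<open>TVec\<close> the algebra generated by \<open>A\<close> and \<open>Vec\<close> subject to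
  \<open>u \<bullet> a = u a + u(da)\<close>.  So a module over it is an \<open>A\<close>-module with additive operators \<open>u \<triangleright>\<close> such that
  \<open>(a u) \<triangleright> m = a (u \<triangleright> m)\<close> and \<open>u \<triangleright> (a m) = (u a) \<triangleright> m + u(da) m\<close>.  The recursion for \<open>D\<close> says that
  \<open>(x, D x) = x \<triangleright> (1, 0)\<close> for such a structure on pairs \<open>(x, s)\<close>, where \<open>s\<close> is a \<open>(0,1)\<close>-form with
  values in tensors, \<open>a (x, s) = (a x, dbar a \<otimes> x + a s)\<close>, and \<open>u \<triangleright> (x, s)\<close> is read off the right-hand side.
  Well-definedness is then the last module identity.  Its part in \<open>s\<close> follows from (b) and (d);
  its part in \<open>x\<close> splits into an identity for \<open>\<box>(da)\<close>, which is (c), and one for \<open>\<sigma>(u \<otimes> da)\<close>, which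
  is (d) again.  The Leibniz rule for \<open>D\<close> is \<open>A\<close>-linearity of \<open>x \<mapsto> x \<triangleright> (1, 0)\<close>.
\<close>

text \<open>The obstacle is that the definitions speak of decompositions: tensors are words modulo
  relations, and most maps are descriptions over all ways of writing the argument. Two devices
  produce honest maps. The tensor algebra is \<open>T = A \<oplus> \<Omega>\<^sup>1A
  \<otimes>\<^sub>A T \<oplus> Vec A \<otimes>\<^sub>A T\<close>, so an additive map may be
  prescribed on scalars and, in balanced form, on words with a leading form or vector
  (\<open>tens_case\<close>); it need not be left linear, so derivatives are covered. Maps that are
  balanced only over a submodule of \<open>T\<close> are defined through a dual basis
  (\<open>bcase\<close>). The dual basis also shows that elements of
  \<open>\<Omega>\<^sup>1A \<otimes>\<^sub>A Vec A\<close> are determined by their values on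
  one-forms, and this is how coevaluation, \<sigma> and the dual derivative are handled. Condition
  (b) says that the left factor of \<box>\<xi> has the type of \<xi>. Since the left Leibniz rule
  expresses \<sigma>^-1 through \<box>, the same holds for \<sigma>^-1. So for \<xi> of pure type
  one of the two mixed components vanishes, and (d) computes the other one. The module scheme is
  used twice: with \<open>TVec\<close> itself it shows that \<bullet> is well defined, with pairs it
  gives the operator.\<close>

declare One_nat_def [simp del]

section \<open>Differential graded star-algebras\<close>

lemma cscale_zero_right [simp]: "c *\<^sub>C (0 :: 'w::star_dga) = 0"
  by (metis add_cancel_right_right cscale_add_right)

lemma cscale_zero_left [simp]: "0 *\<^sub>C (x :: 'w::star_dga) = 0"
  by (metis add_cancel_right_right cscale_add_left)

lemma cscale_minus_left: "(- c) *\<^sub>C (x :: 'w::star_dga) = - (c *\<^sub>C x)"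
  by (metis add.right_inverse cscale_add_left cscale_zero_left minus_unique)

lemma cscale_minus_right: "c *\<^sub>C (- x :: 'w::star_dga) = - (c *\<^sub>C x)"
  by (metis add.right_inverse cscale_add_right cscale_zero_right minus_unique)

lemma cscale_diff_right: "c *\<^sub>C (x - y :: 'w::star_dga) = c *\<^sub>C x - c *\<^sub>C y"
  by (metis cscale_add_right cscale_minus_right diff_conv_add_uminus)

lemma cscale_eq_0_iff: "c *\<^sub>C (x :: 'w::star_dga) = 0 \<longleftrightarrow> c = 0 \<or> x = 0"
  by (metis cscale_cscale cscale_one cscale_zero_left cscale_zero_right left_inverse)

lemma Om_uminus: "x \<in> Om n \<Longrightarrow> - x \<in> (Om n :: 'w::star_dga set)"
  by (metis Om_cscale cscale_minus_left cscale_one)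

lemma Om_diff: "x \<in> Om n \<Longrightarrow> y \<in> Om n \<Longrightarrow> x - y \<in> (Om n :: 'w::star_dga set)"
  by (metis Om_add Om_uminus diff_conv_add_uminus)

lemma Om_sum_list: "(\<And>p. p \<in> set ps \<Longrightarrow> f p \<in> Om n) \<Longrightarrow> (\<Sum>p\<leftarrow>ps. f p) \<in> (Om n :: 'w::star_dga set)"
  by (induction ps) (auto intro: Om_zero Om_add)

lemma Om_mult_00: "a \<in> Om 0 \<Longrightarrow> b \<in> Om 0 \<Longrightarrow> a * b \<in> (Om 0 :: 'w::star_dga set)"
  using Om_mult[of a 0 b 0] by simp

lemma Om_mult_01: "a \<in> Om 0 \<Longrightarrow> b \<in> Om n \<Longrightarrow> a * b \<in> (Om n :: 'w::star_dga set)"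
  using Om_mult[of a 0 b n] by simp

lemma Om_mult_10: "a \<in> Om n \<Longrightarrow> b \<in> Om 0 \<Longrightarrow> a * b \<in> (Om n :: 'w::star_dga set)"
  using Om_mult[of a n b 0] by simp

lemma Om_exd0: "a \<in> Om 0 \<Longrightarrow> exd a \<in> (Om 1 :: 'w::star_dga set)"
  using exd_Om[of a 0] by (simp add: One_nat_def)

lemma exd_zero [simp]: "exd (0 :: 'w::star_dga) = 0"
  by (metis add_cancel_right_right exd_add)

lemma exd_mult_0: "a \<in> Om 0 \<Longrightarrow> exd (a * x) = exd a * x + a * exd (x :: 'w::star_dga)"
  using exd_mult[of a 0 x] by (simp add: cscale_one)

lemma exd_one [simp]: "exd (1 :: 'w::star_dga) = 0"
  using exd_mult_0[OF Om_one, of 1] by simp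

lemmas Om_intros = Om_zero Om_one Om_add Om_uminus Om_diff Om_mult_00 Om_mult_01 Om_mult_10
  Om_exd0 Om_cscale

text \<open>Complex scalars become right multiplication by the element \<open>c *\<^sub>C 1\<close>
  of \<open>A\<close>, so complex linearity is a case of right linearity over \<open>A\<close>, and
  the Leibniz term disappears because d kills \<open>c *\<^sub>C 1\<close>.\<close>

lemma mult_cscale_1: "x * (c *\<^sub>C 1) = c *\<^sub>C (x :: 'w::star_dga)"
  by (simp add: cscale_mult_right)


section \<open>Vector fields\<close>

lemma VecI:
  assumes "\<And>\<xi>. \<xi> \<in> Om 1 \<Longrightarrow> v \<xi> \<in> Om 0"
    and "\<And>\<xi> \<eta>. \<xi> \<in> Om 1 \<Longrightarrow> \<eta> \<in> Om 1 \<Longrightarrow> v (\<xi> + \<eta>) = v \<xi> + v \<eta>"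
    and "\<And>\<xi> a. \<xi> \<in> Om 1 \<Longrightarrow> a \<in> Om 0 \<Longrightarrow> v (\<xi> * a) = v \<xi> * a"
    and "\<And>\<xi>. \<xi> \<notin> Om 1 \<Longrightarrow> v \<xi> = 0"
  shows "v \<in> Vec"
  using assms by (auto simp: Vec_def right_linear_on_def additive_on_def)

lemma Vec_in: "v \<in> Vec \<Longrightarrow> v \<xi> \<in> Om 0"
  by (cases "\<xi> \<in> Om 1") (auto simp: Vec_def Om_zero)

lemma Vec_add: "v \<in> Vec \<Longrightarrow> \<xi> \<in> Om 1 \<Longrightarrow> \<eta> \<in> Om 1 \<Longrightarrow> v (\<xi> + \<eta>) = v \<xi> + v \<eta>"
  by (auto simp: Vec_def right_linear_on_def additive_on_def)

lemma Vec_mult: "v \<in> Vec \<Longrightarrow> \<xi> \<in> Om 1 \<Longrightarrow> a \<in> Om 0 \<Longrightarrow> v (\<xi> * a) = v \<xi> * a"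
  by (auto simp: Vec_def right_linear_on_def)

lemma Vec_notin: "v \<in> Vec \<Longrightarrow> \<xi> \<notin> Om 1 \<Longrightarrow> v \<xi> = 0"
  by (auto simp: Vec_def)

lemma Vec_zero [simp]: "v \<in> Vec \<Longrightarrow> v 0 = 0"
  by (metis Vec_add Om_zero add_cancel_right_right)

lemma Vec_cscale: "v \<in> Vec \<Longrightarrow> \<xi> \<in> Om 1 \<Longrightarrow> v (c *\<^sub>C \<xi>) = c *\<^sub>C v \<xi>"
  by (metis Vec_mult Om_cscale Om_one mult_cscale_1)

lemma Vec_sum_list:
  "v \<in> Vec \<Longrightarrow> (\<And>p. p \<in> set ps \<Longrightarrow> f p \<in> Om 1) \<Longrightarrow> v (\<Sum>p\<leftarrow>ps. f p) = (\<Sum>p\<leftarrow>ps. v (f p))"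
  by (induction ps) (simp_all add: Vec_add Om_sum_list)

lemma zero_in_Vec: "(\<lambda>_. 0) \<in> Vec"
  by (rule VecI) (auto intro: Om_intros)

lemma vec_add_in: "u \<in> Vec \<Longrightarrow> v \<in> Vec \<Longrightarrow> (\<lambda>\<xi>. u \<xi> + v \<xi>) \<in> Vec"
  by (rule VecI) (auto simp: Vec_add Vec_mult Vec_notin distrib_right Vec_in intro!: Om_intros)

lemma vec_lact_in: "a \<in> Om 0 \<Longrightarrow> v \<in> Vec \<Longrightarrow> vec_lact a v \<in> Vec"
  by (rule VecI)
    (auto simp: vec_lact_def Vec_add Vec_mult Vec_notin distrib_left mult.assoc
      Vec_in intro!: Om_intros)

lemma vec_ract_in: "a \<in> Om 0 \<Longrightarrow> v \<in> Vec \<Longrightarrow> vec_ract v a \<in> Vec"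
  by (rule VecI)
    (auto simp: vec_ract_def Vec_add Vec_mult Vec_notin distrib_left mult.assoc[symmetric]
      Om_intros Vec_in)

lemma vec_lact_apply: "\<xi> \<in> Om 1 \<Longrightarrow> vec_lact a v \<xi> = a * v \<xi>"
  by (simp add: vec_lact_def)

lemma vec_ract_apply: "\<xi> \<in> Om 1 \<Longrightarrow> vec_ract v a \<xi> = v (a * \<xi>)"
  by (auto simp: vec_ract_def)

lemma vec_lact_one [simp]: "v \<in> Vec \<Longrightarrow> vec_lact 1 v = v"
  by (auto simp: vec_lact_def Vec_notin)

lemma vec_lact_add: "v \<in> Vec \<Longrightarrow> vec_lact (a + b) v = (\<lambda>\<xi>. vec_lact a v \<xi> + vec_lact b v \<xi>)"
  by (auto simp: vec_lact_def distrib_right)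

lemma vec_lact_lact: "v \<in> Vec \<Longrightarrow> vec_lact a (vec_lact b v) = vec_lact (a * b) v"
  by (auto simp: vec_lact_def mult.assoc)

lemma vec_lact_ract: "a \<in> Om 0 \<Longrightarrow> b \<in> Om 0 \<Longrightarrow> vec_lact a (vec_ract v b) = vec_ract (vec_lact a v) b"
  by (rule ext) (auto simp: vec_lact_def vec_ract_def Om_intros)

lemma vec_lact_plus: "vec_lact a (\<lambda>\<xi>. u \<xi> + v \<xi>) = (\<lambda>\<xi>. vec_lact a u \<xi> + vec_lact a v \<xi>)"
  by (auto simp: vec_lact_def distrib_left)

section \<open>The tensor algebra\<close>

lemma abs_tens_eq: "tens_eq X Y \<Longrightarrow> abs_tens X = abs_tens Y"
  by (simp add: tens.abs_eq_iff)

lemma abs_tens_rel: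
  assumes "tens_rel l X"
  shows "abs_tens {#p @ l @ q#} = (abs_tens {#p @ r @ q. r \<in># X#} :: 'w::star_dga tens)"
  by (rule abs_tens_eq[OF tens_eq_rel[OF assms]])

lemma scal_abs: "scal a = abs_tens {#[Scalar a]#}" by (simp add: scal_def)
lemma form_abs: "form a = abs_tens {#[Form a]#}" by (simp add: form_def)
lemma vect_abs: "vect a = abs_tens {#[Vector a]#}" by (simp add: vect_def)

lemma plus_abs: "abs_tens X + abs_tens Y = abs_tens (X + Y)"
  by (simp add: plus_tens.abs_eq)

lemma times_abs: "abs_tens X * abs_tens Y = abs_tens (word_mult X Y)"
  by (simp add: times_tens.abs_eq)

lemmas tens_abs = scal_abs form_abs vect_abs plus_abs times_abs zero_tens_def one_tens_def

lemma tens_eq_rel0: "tens_rel l X \<Longrightarrow> abs_tens {#l#} = (abs_tens X :: 'w::star_dga tens)"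
  using abs_tens_rel[of l X "[]" "[]"] by simp

lemma scal_notin: "a \<notin> Om 0 \<Longrightarrow> scal a = 0"
  and form_notin: "\<xi> \<notin> Om 1 \<Longrightarrow> form \<xi> = 0"
  and vect_notin: "v \<notin> Vec \<Longrightarrow> vect v = 0"
  and scal_zero [simp]: "scal 0 = 0"
  and scal_one [simp]: "scal 1 = 1"
  and scal_add: "a \<in> Om 0 \<Longrightarrow> b \<in> Om 0 \<Longrightarrow> scal (a + b) = scal a + scal b"
  and form_add: "\<xi> \<in> Om 1 \<Longrightarrow> \<eta> \<in> Om 1 \<Longrightarrow> form (\<xi> + \<eta>) = form \<xi> + form \<eta>"
  and vect_add: "u \<in> Vec \<Longrightarrow> v \<in> Vec \<Longrightarrow> vect (\<lambda>\<xi>. u \<xi> + v \<xi>) = vect u + vect v"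
  and scal_scal: "a \<in> Om 0 \<Longrightarrow> b \<in> Om 0 \<Longrightarrow> scal a * scal b = scal (a * b)"
  and scal_form: "a \<in> Om 0 \<Longrightarrow> \<xi> \<in> Om 1 \<Longrightarrow> scal a * form \<xi> = form (a * \<xi>)"
  and form_scal: "a \<in> Om 0 \<Longrightarrow> \<xi> \<in> Om 1 \<Longrightarrow> form \<xi> * scal a = form (\<xi> * a)"
  and scal_vect: "a \<in> Om 0 \<Longrightarrow> v \<in> Vec \<Longrightarrow> scal a * vect v = vect (vec_lact a v)"
  and vect_scal: "a \<in> Om 0 \<Longrightarrow> v \<in> Vec \<Longrightarrow> vect v * scal a = vect (vec_ract v a)"
  by (simp_all add: tens_abs word_mult_single tens_rel.intros[THEN tens_eq_rel0] add_mset_commute)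

lemma form_zero [simp]: "form 0 = 0"
  by (metis Om_zero add_cancel_right_right form_add)

lemma vect_zero [simp]: "vect (\<lambda>_. 0) = 0"
  using vect_add[OF zero_in_Vec zero_in_Vec] by simp

primrec tens_letter :: "'w::star_dga letter \<Rightarrow> 'w tens" where
  "tens_letter (Scalar a) = scal a"
| "tens_letter (Form \<xi>) = form \<xi>"
| "tens_letter (Vector v) = vect v"

definition tens_word :: "'w::star_dga letter list \<Rightarrow> 'w tens" where
  "tens_word w = prod_list (map tens_letter w)"

lemma tens_word_simps [simp]:
  "tens_word [] = 1" "tens_word (l # w) = tens_letter l * tens_word w"
  "tens_word (v @ w) = tens_word v * tens_word w"
  by (simp_all add: tens_word_def)

lemma abs_tens_word: "abs_tens {#w#} = tens_word w"
proof (induction w)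
  case Nil
  then show ?case by (simp add: one_tens_def)
next
  case (Cons l w)
  have "abs_tens {#l # w#} = abs_tens {#[l]#} * abs_tens {#w#}"
    by (simp add: times_abs word_mult_single)
  also have "abs_tens {#[l]#} = tens_letter l"
    by (cases l) (simp_all add: tens_abs)
  finally show ?case by (simp add: Cons)
qed

lemma abs_tens_sum: "abs_tens X = (\<Sum>w\<in>#X. tens_word w)"
proof (induction X)
  case empty
  then show ?case by (simp add: zero_tens_def)
next
  case (add w X)
  have "abs_tens (add_mset w X) = abs_tens {#w#} + abs_tens X"
    by (simp add: plus_abs)
  then show ?case by (simp add: add abs_tens_word)
qed

text \<open>Words are built from the left. A scalar letter is absorbed by the letter after it, so
  only pure scalars remain as base case; letters outside their domain are 0, which is the scalar
  \<open>scal 0\<close>.\<close>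

lemma tens_induct [case_names add scal form vect]:
  assumes add: "\<And>x y. P x \<Longrightarrow> P y \<Longrightarrow> P (x + y)"
    and scal: "\<And>a. a \<in> Om 0 \<Longrightarrow> P (scal a)"
    and form: "\<And>\<xi> x. \<xi> \<in> Om 1 \<Longrightarrow> P x \<Longrightarrow> P (form \<xi> * x)"
    and vect: "\<And>v x. v \<in> Vec \<Longrightarrow> P x \<Longrightarrow> P (vect v * x)"
  shows "P t"
proof -
  have P0: "P 0"
    using scal[OF Om_zero] by simp
  \<comment> \<open>The scalar in front is carried along because a leading \<open>Scalar\<close>
    letter has to be merged into whatever follows it.\<close>
  have w: "(\<forall>a\<in>Om 0. P (scal a * tens_word w)) \<and> P (tens_word w)" for w
  proof (induction w)
    case Nil
    then show ?case using scal Om_one scal_one by (metis mult.right_neutral tens_word_simps(1))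
  next
    case (Cons l w)
    show ?case
    proof (cases l)
      case (Scalar b)
      then show ?thesis
        using Cons P0 by (cases "b \<in> Om 0")
          (auto simp: scal_notin mult.assoc[symmetric] scal_scal Om_intros)
    next
      case (Form \<xi>)
      then show ?thesis
        using Cons P0 form by (cases "\<xi> \<in> Om 1")
          (auto simp: form_notin mult.assoc[symmetric] scal_form Om_intros)
    next
      case (Vector v)
      then show ?thesis
        using Cons P0 vect by (cases "v \<in> Vec")
          (auto simp: vect_notin mult.assoc[symmetric] scal_vect vec_lact_in)
    qed
  qed
  have "P (\<Sum>w\<in>#X. tens_word w)" for X
    by (induction X) (auto simp: P0 add w)
  then show ?thesis
    by (metis abs_tens_sum Quotient_tens Quotient_abs_rep)
qed

subsection \<open>The universal property\<close>

text \<open>These are the conditions for \<open>f\<close> to factor through the tensor product over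
  \<open>A\<close> of the one-forms with the whole tensor algebra; \<open>vbal\<close> is the
  analogue for vector fields.\<close>

definition fbal :: "('w::star_dga \<Rightarrow> 'w tens \<Rightarrow> 'y::ab_group_add) \<Rightarrow> bool" where
  "fbal f \<longleftrightarrow> (\<forall>\<xi>\<in>Om 1. additive (f \<xi>)) \<and>
     (\<forall>\<xi>\<in>Om 1. \<forall>\<eta>\<in>Om 1. \<forall>x. f (\<xi> + \<eta>) x = f \<xi> x + f \<eta> x) \<and>
     (\<forall>\<xi>\<in>Om 1. \<forall>a\<in>Om 0. \<forall>x. f (\<xi> * a) x = f \<xi> (scal a * x))"

definition vbal :: "(('w::star_dga \<Rightarrow> 'w) \<Rightarrow> 'w tens \<Rightarrow> 'y::ab_group_add) \<Rightarrow> bool" where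
  "vbal f \<longleftrightarrow> (\<forall>v\<in>Vec. additive (f v)) \<and>
     (\<forall>u\<in>Vec. \<forall>v\<in>Vec. \<forall>x. f (\<lambda>\<xi>. u \<xi> + v \<xi>) x = f u x + f v x) \<and>
     (\<forall>v\<in>Vec. \<forall>a\<in>Om 0. \<forall>x. f (vec_ract v a) x = f v (scal a * x))"

text \<open>The accumulator \<open>b\<close> is the product of the scalar letters read so far. At
  the first other letter it is absorbed by the left action, and the rest of the word is passed on as
  a tensor, so there is no further recursion.\<close>

fun word_case :: "('w::star_dga \<Rightarrow> 'y::ab_group_add) \<Rightarrow> ('w \<Rightarrow> 'w tens \<Rightarrow> 'y) \<Rightarrow>
    (('w \<Rightarrow> 'w) \<Rightarrow> 'w tens \<Rightarrow> 'y) \<Rightarrow> 'w \<Rightarrow> 'w letter list \<Rightarrow> 'y" where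
  "word_case g0 g1 g2 b [] = g0 b"
| "word_case g0 g1 g2 b (Scalar a # w) = (if a \<in> Om 0 then word_case g0 g1 g2 (b * a) w else 0)"
| "word_case g0 g1 g2 b (Form \<xi> # w) = (if \<xi> \<in> Om 1 then g1 (b * \<xi>) (tens_word w) else 0)"
| "word_case g0 g1 g2 b (Vector v # w) = (if v \<in> Vec then g2 (vec_lact b v) (tens_word w) else 0)"

text \<open>The universal property of the decomposition of the tensor algebra by its first letter.
  The representative is arbitrary; independence of it is \<open>tens_case_abs\<close>.\<close>

definition tens_case :: "('w::star_dga \<Rightarrow> 'y::ab_group_add) \<Rightarrow> ('w \<Rightarrow> 'w tens \<Rightarrow> 'y) \<Rightarrow>
    (('w \<Rightarrow> 'w) \<Rightarrow> 'w tens \<Rightarrow> 'y) \<Rightarrow> 'w tens \<Rightarrow> 'y" where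
  "tens_case g0 g1 g2 t = (\<Sum>w\<in>#rep_tens t. word_case g0 g1 g2 1 w)"

context
  fixes g0 :: "'w::star_dga \<Rightarrow> 'y::ab_group_add"
    and g1 :: "'w \<Rightarrow> 'w tens \<Rightarrow> 'y" and g2 :: "('w \<Rightarrow> 'w) \<Rightarrow> 'w tens \<Rightarrow> 'y"
  assumes g0: "additive_on (Om 0) g0" and g1: "fbal g1" and g2: "vbal g2"
begin

lemma word_case_add:
  "a \<in> Om 0 \<Longrightarrow> b \<in> Om 0 \<Longrightarrow> word_case g0 g1 g2 (a + b) w = word_case g0 g1 g2 a w + word_case g0 g1 g2 b w"
proof (induction w arbitrary: a b)
  case Nil
  then show ?case using g0 by (simp add: additive_on_def)
next
  case (Cons l w)
  then show ?case
    using g1 g2 by (cases l)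
      (auto simp: distrib_right Om_intros fbal_def vbal_def vec_lact_add vec_lact_in)
qed

lemma additive_sum_mset: "additive f \<Longrightarrow> f (\<Sum>x\<in>#X. h x) = (\<Sum>x\<in>#X. f (h x))"
  for f :: "'a::ab_group_add \<Rightarrow> 'b::ab_group_add"
  by (induction X) (simp_all add: additive.zero additive.add)

text \<open>Behind a form or a vector the relation is an equation between the remaining tensors, so
  additivity of \<open>g1\<close> and \<open>g2\<close> in the second argument suffices. Directly
  behind scalars, the relations that move a scalar out of the second place (the clauses 11 and 13)
  are the balancing conditions.\<close>

lemma word_case_rel:
  assumes "tens_rel l X"
  shows "b \<in> Om 0 \<Longrightarrow> word_case g0 g1 g2 b (p @ l @ q) = (\<Sum>r\<in>#X. word_case g0 g1 g2 b (p @ r @ q))"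
proof (induction p arbitrary: b)
  case Nil
  have z: "word_case g0 g1 g2 0 w = 0" for w
    using word_case_add[of 0 0 w] by (simp add: Om_zero)
  show ?case
    using assms Nil
  proof cases
    case (6 a b')
    then show ?thesis using Nil by (simp add: distrib_left word_case_add Om_intros)
  next
    case (7 \<xi> \<eta>)
    then show ?thesis using Nil g1 by (simp add: distrib_left fbal_def Om_intros)
  next
    case (8 u v)
    then show ?thesis using Nil g2
      by (simp add: vec_lact_plus vbal_def vec_lact_in vec_add_in)
  next
    case (11 a \<xi>)
    then show ?thesis using Nil g1 by (simp add: mult.assoc[symmetric] fbal_def Om_intros)
  next
    case (13 a v)
    then show ?thesis using Nil g2
      by (simp add: vbal_def vec_lact_in vec_ract_in vec_lact_ract)
  qed (use Nil z in \<open>simp_all add: Om_intros mult.assoc vec_lact_in vec_lact_lact\<close>)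
next
  case (Cons l' p)
  have w: "tens_word (p @ l @ q) = (\<Sum>r\<in>#X. tens_word (p @ r @ q))"
    using abs_tens_rel[OF assms, of p q] unfolding abs_tens_sum
    by (simp add: multiset.map_comp o_def)
  show ?case
  proof (cases l')
    case (Scalar a)
    then show ?thesis using Cons by (simp add: Om_intros)
  next
    case (Form \<xi>)
    then show ?thesis
      using Cons.prems g1 additive_sum_mset[of "g1 (b * \<xi>)", where X = X and h = "\<lambda>r. tens_word (p @ r @ q)"] w
      by (auto simp: fbal_def Om_intros)
  next
    case (Vector v)
    then show ?thesis
      using Cons.prems g2 additive_sum_mset[of "g2 (vec_lact b v)", where X = X and h = "\<lambda>r. tens_word (p @ r @ q)"] w
      by (auto simp: vbal_def vec_lact_in)
  qed
qed

lemma tens_case_abs: "tens_case g0 g1 g2 (abs_tens X) = (\<Sum>w\<in>#X. word_case g0 g1 g2 1 w)"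
proof -
  let ?S = "\<lambda>X. \<Sum>w\<in>#X. word_case g0 g1 g2 1 w"
  have step: "?S X = ?S Y" if "tens_step X Y" for X Y
    using that
  proof cases
    case (1 l X Z p q)
    then show ?thesis
      using word_case_rel[OF 1(3) Om_one, of p q] by (simp add: multiset.map_comp o_def)
  qed
  have "?S X = ?S Y" if "tens_eq X Y" for X Y
    using that unfolding tens_eq_def
  proof (induction rule: equivclp_induct)
    case (step Y Z)
    then show ?case using \<open>\<And>X Y. tens_step X Y \<Longrightarrow> ?S X = ?S Y\<close> by metis
  qed simp
  moreover have "tens_eq (rep_tens (abs_tens X)) X"
    by (rule Quotient_rep_abs[OF Quotient_tens tens_eq_refl])
  ultimately show ?thesis
    unfolding tens_case_def by blast
qed

lemma additive_tens_case: "additive (tens_case g0 g1 g2)"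
proof
  fix x y :: "'w tens"
  obtain X Y where "x = abs_tens X" "y = abs_tens Y"
    by (metis Quotient_tens Quotient_abs_rep)
  then show "tens_case g0 g1 g2 (x + y) = tens_case g0 g1 g2 x + tens_case g0 g1 g2 y"
    by (simp add: plus_abs tens_case_abs)
qed

lemma tens_case_word: "tens_case g0 g1 g2 (tens_word w) = word_case g0 g1 g2 1 w"
  using tens_case_abs[of "{#w#}"] by (simp add: abs_tens_word)

lemma tens_case_scal: "a \<in> Om 0 \<Longrightarrow> tens_case g0 g1 g2 (scal a) = g0 a"
  using tens_case_word[of "[Scalar a]"] by simp

lemma tens_case_form:
  assumes \<xi>: "\<xi> \<in> Om 1"
  shows "tens_case g0 g1 g2 (form \<xi> * x) = g1 \<xi> x"
proof -
  obtain X where X: "x = abs_tens X"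
    by (metis Quotient_tens Quotient_abs_rep)
  have "form \<xi> * x = abs_tens {#Form \<xi> # w. w \<in># X#}"
    by (simp add: X form_abs times_abs word_mult_single_left)
  then have "tens_case g0 g1 g2 (form \<xi> * x) = (\<Sum>w\<in>#X. g1 \<xi> (tens_word w))"
    using \<xi> by (simp add: tens_case_abs multiset.map_comp o_def)
  also have "\<dots> = g1 \<xi> x"
    using \<xi> g1 by (simp add: X abs_tens_sum additive_sum_mset[of "g1 \<xi>"] fbal_def)
  finally show ?thesis .
qed

lemma tens_case_vect:
  assumes v: "v \<in> Vec"
  shows "tens_case g0 g1 g2 (vect v * x) = g2 v x"
proof -
  obtain X where X: "x = abs_tens X"
    by (metis Quotient_tens Quotient_abs_rep)
  have "vect v * x = abs_tens {#Vector v # w. w \<in># X#}"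
    by (simp add: X vect_abs times_abs word_mult_single_left)
  then have "tens_case g0 g1 g2 (vect v * x) = (\<Sum>w\<in>#X. g2 v (tens_word w))"
    using v by (simp add: tens_case_abs multiset.map_comp o_def)
  also have "\<dots> = g2 v x"
    using v g2 by (simp add: X abs_tens_sum additive_sum_mset[of "g2 v"] vbal_def)
  finally show ?thesis .
qed

end

subsection \<open>Additive maps and sums\<close>

lemma additive_sum_list: "additive f \<Longrightarrow> f (\<Sum>x\<leftarrow>xs. h x) = (\<Sum>x\<leftarrow>xs. f (h x))"
  for f :: "'a::ab_group_add \<Rightarrow> 'b::ab_group_add"
  by (induction xs) (simp_all add: additive.zero additive.add)

lemma lin_ext_eq:
  assumes "set ps \<subseteq> P"
    and "\<And>qs. set qs \<subseteq> P \<Longrightarrow> (\<Sum>p\<leftarrow>qs. dec p) = (\<Sum>p\<leftarrow>ps. dec p) \<Longrightarrow> (\<Sum>p\<leftarrow>qs. val p) = (\<Sum>p\<leftarrow>ps. val p)"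
  shows "lin_ext P dec val (\<Sum>p\<leftarrow>ps. dec p) = (\<Sum>p\<leftarrow>ps. val p)"
  unfolding lin_ext_def by (rule the_equality) (use assms in metis)+

lemma sum_list_map_on:
  assumes "set ps \<subseteq> P" "\<And>p. p \<in> P \<Longrightarrow> dec p \<in> S \<and> G (dec p) = val p"
    and "0 \<in> S" "G 0 = 0" "\<And>x y. x \<in> S \<Longrightarrow> y \<in> S \<Longrightarrow> x + y \<in> S \<and> G (x + y) = G x + G y"
  shows "(\<Sum>p\<leftarrow>ps. dec p) \<in> S \<and> (\<Sum>p\<leftarrow>ps. val p) = G (\<Sum>p\<leftarrow>ps. dec p)"
  using assms(1) by (induction ps) (use assms in auto)

text \<open>A map \<open>G\<close> that is additive on \<open>S\<close> and has the prescribed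
  values forces every decomposition to give the same sum, so the description denotes
  \<open>G x\<close>. With \<open>S\<close> the whole type this is \<open>lin_ext_hom\<close>; a
  smaller \<open>S\<close> is needed for maps built by \<open>bcase\<close>.\<close>

lemma lin_ext_hom_on:
  assumes "set ps \<subseteq> P" "\<And>p. p \<in> P \<Longrightarrow> dec p \<in> S \<and> G (dec p) = val p"
    and "0 \<in> S" "G 0 = 0" "\<And>x y. x \<in> S \<Longrightarrow> y \<in> S \<Longrightarrow> x + y \<in> S \<and> G (x + y) = G x + G y"
    and x: "x = (\<Sum>p\<leftarrow>ps. dec p)"
  shows "lin_ext P dec val x = G x"
proof -
  have *: "(\<Sum>p\<leftarrow>qs. val p) = G (\<Sum>p\<leftarrow>qs. dec p)" if "set qs \<subseteq> P" for qs
    using sum_list_map_on[of qs P dec S G val, OF that] assms(2-5) by blast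
  show ?thesis
    unfolding x using lin_ext_eq[of ps P dec val] * assms(1) by metis
qed

lemma lin_ext_hom:
  fixes G :: "'x::ab_group_add \<Rightarrow> 'y::ab_group_add"
  assumes "additive G" "set ps \<subseteq> P" "\<And>p. p \<in> P \<Longrightarrow> G (dec p) = val p" "x = (\<Sum>p\<leftarrow>ps. dec p)"
  shows "lin_ext P dec val x = G x"
  by (rule lin_ext_hom_on[where S = UNIV and ps = ps])
    (use assms in \<open>auto simp: additive.zero additive.add\<close>)

lemma additive_zero_fun [simp]: "additive (\<lambda>_. 0 :: 'y::ab_group_add)"
  by standard simp

lemma additive_on_zero [simp]: "additive_on S (\<lambda>_. 0 :: 'y::ab_group_add)"
  by (simp add: additive_on_def)

lemma additive_mult_left: "additive f \<Longrightarrow> additive (\<lambda>x. c * f x :: 'y::ring)"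
  by (auto simp: additive_def distrib_left)

lemma fbal_zero [simp]: "fbal (\<lambda>_ _. 0)" and vbal_zero [simp]: "vbal (\<lambda>_ _. 0)"
  by (simp_all add: fbal_def vbal_def)

lemma scal_additive_on [simp]: "additive_on (Om 0) scal"
  by (simp add: additive_on_def scal_add)

subsection \<open>Products of submodules\<close>

lemma tens_prodI: "x \<in> X \<Longrightarrow> y \<in> Y \<Longrightarrow> x * y \<in> X \<otimes>\<^sub>A Y"
  unfolding tens_prod_def by (intro CollectI exI[of _ "[(x, y)]"]) simp

lemma tens_prod_zero: "0 \<in> X \<otimes>\<^sub>A Y"
  unfolding tens_prod_def by (intro CollectI exI[of _ "[]"]) simp

lemma tens_prod_add:
  assumes "s \<in> X \<otimes>\<^sub>A Y" "t \<in> X \<otimes>\<^sub>A Y"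
  shows "s + t \<in> X \<otimes>\<^sub>A Y"
proof -
  obtain ps qs where "s = (\<Sum>(x, y)\<leftarrow>ps. x * y)" "set ps \<subseteq> X \<times> Y"
    "t = (\<Sum>(x, y)\<leftarrow>qs. x * y)" "set qs \<subseteq> X \<times> Y"
    using assms by (auto simp: tens_prod_def)
  then show ?thesis
    unfolding tens_prod_def by (intro CollectI exI[of _ "ps @ qs"]) auto
qed

lemma tens_prod_induct [consumes 1, case_names zero add mult]:
  assumes "t \<in> X \<otimes>\<^sub>A Y" and "P 0" and "\<And>x y. P x \<Longrightarrow> P y \<Longrightarrow> P (x + y)"
    and "\<And>x y. x \<in> X \<Longrightarrow> y \<in> Y \<Longrightarrow> P (x * y)"
  shows "P t"
proof -
  obtain ps where "t = (\<Sum>(x, y)\<leftarrow>ps. x * y)" "set ps \<subseteq> X \<times> Y"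
    using assms(1) by (auto simp: tens_prod_def)
  then show ?thesis
    by (induction ps arbitrary: t) (use assms in auto)
qed

lemma tens_prod_mono: "X \<subseteq> X' \<Longrightarrow> Y \<subseteq> Y' \<Longrightarrow> X \<otimes>\<^sub>A Y \<subseteq> X' \<otimes>\<^sub>A Y'"
  unfolding tens_prod_def by blast

lemma tens_prod_sum_list:
  "(\<And>p. p \<in> set ps \<Longrightarrow> f p \<in> X \<otimes>\<^sub>A Y) \<Longrightarrow> (\<Sum>p\<leftarrow>ps. f p) \<in> X \<otimes>\<^sub>A Y"
  by (induction ps) (auto intro: tens_prod_zero tens_prod_add)

lemma tens_prod_left:
  assumes "t \<in> X \<otimes>\<^sub>A Y" and "\<And>x. x \<in> X \<Longrightarrow> c * x \<in> X"
  shows "c * t \<in> X \<otimes>\<^sub>A Y"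
  using assms(1)
  by (induction rule: tens_prod_induct)
    (auto simp: distrib_left mult.assoc[symmetric] tens_prod_zero intro: tens_prod_add tens_prodI assms(2))

lemma tens_prod_right:
  assumes "t \<in> X \<otimes>\<^sub>A Y" and "\<And>y. y \<in> Y \<Longrightarrow> y * c \<in> Z"
  shows "t * c \<in> X \<otimes>\<^sub>A Z"
  using assms(1)
  by (induction rule: tens_prod_induct)
    (auto simp: distrib_right mult.assoc tens_prod_zero intro: tens_prod_add tens_prodI assms(2))

lemma tens_prod_uminus:
  assumes "t \<in> X \<otimes>\<^sub>A Y" and "\<And>x. x \<in> X \<Longrightarrow> - x \<in> X"
  shows "- t \<in> X \<otimes>\<^sub>A Y"
  using assms(1)
proof (induction rule: tens_prod_induct)
  case (add x y)
  then show ?case using tens_prod_add by (metis minus_add_distrib)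
next
  case (mult x y)
  then show ?case using assms(2) tens_prodI by (metis minus_mult_left)
qed (simp add: tens_prod_zero)

lemma tens_prod_list:
  assumes "t \<in> f ` X \<otimes>\<^sub>A Y"
  obtains ps where "set ps \<subseteq> X \<times> Y" "t = (\<Sum>(x, y)\<leftarrow>ps. f x * y)"
proof -
  have "\<exists>ps. set ps \<subseteq> X \<times> Y \<and> t = (\<Sum>(x, y)\<leftarrow>ps. f x * y)"
    using assms
  proof (induction rule: tens_prod_induct)
    case zero
    show ?case by (rule exI[of _ "[]"]) simp
  next
    case (add x y)
    then obtain ps qs where "set ps \<subseteq> X \<times> Y" "x = (\<Sum>(x, y)\<leftarrow>ps. f x * y)"
      "set qs \<subseteq> X \<times> Y" "y = (\<Sum>(x, y)\<leftarrow>qs. f x * y)" by blast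
    then show ?case by (intro exI[of _ "ps @ qs"]) auto
  next
    case (mult x y)
    then obtain z where "z \<in> X" "x = f z" by blast
    with mult show ?case by (intro exI[of _ "[(z, y)]"]) auto
  qed
  then show ?thesis using that by blast
qed

lemma tens_prod_list2:
  assumes "t \<in> f ` X \<otimes>\<^sub>A g ` Y"
  obtains ps where "set ps \<subseteq> X \<times> Y" "t = (\<Sum>(x, y)\<leftarrow>ps. f x * g y)"
proof -
  obtain qs where "set qs \<subseteq> X \<times> g ` Y" "t = (\<Sum>(x, y)\<leftarrow>qs. f x * y)"
    using tens_prod_list[OF assms] .
  then have "\<exists>ps. set ps \<subseteq> X \<times> Y \<and> t = (\<Sum>(x, y)\<leftarrow>ps. f x * g y)"
  proof (induction qs arbitrary: t)
    case (Cons q qs)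
    obtain x y where "q = (x, g y)" "x \<in> X" "y \<in> Y" using Cons by auto
    moreover obtain ps where "set ps \<subseteq> X \<times> Y" "(\<Sum>(x, y)\<leftarrow>qs. f x * y) = (\<Sum>(x, y)\<leftarrow>ps. f x * g y)"
      using Cons by force
    ultimately show ?case using Cons by (intro exI[of _ "(x, y) # ps"]) auto
  qed (auto intro: exI[of _ "[]"])
  then show ?thesis using that by blast
qed

lemma tens_prod_list3:
  assumes "t \<in> f ` X \<otimes>\<^sub>A (g ` Y \<otimes>\<^sub>A h ` Z)"
  obtains ps where "set ps \<subseteq> X \<times> Y \<times> Z" "t = (\<Sum>(x, y, z)\<leftarrow>ps. f x * g y * h z)"
proof -
  have "\<exists>ps. set ps \<subseteq> X \<times> Y \<times> Z \<and> t = (\<Sum>(x, y, z)\<leftarrow>ps. f x * g y * h z)"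
    using assms
  proof (induction rule: tens_prod_induct)
    case zero
    show ?case by (rule exI[of _ "[]"]) simp
  next
    case (add s t)
    then obtain ps qs where "set ps \<subseteq> X \<times> Y \<times> Z" "s = (\<Sum>(x, y, z)\<leftarrow>ps. f x * g y * h z)"
      "set qs \<subseteq> X \<times> Y \<times> Z" "t = (\<Sum>(x, y, z)\<leftarrow>qs. f x * g y * h z)" by blast
    then show ?case by (intro exI[of _ "ps @ qs"]) auto
  next
    case (mult s t)
    then obtain x where x: "x \<in> X" "s = f x" by blast
    obtain ps where ps: "set ps \<subseteq> Y \<times> Z" "t = (\<Sum>(y, z)\<leftarrow>ps. g y * h z)"
      using tens_prod_list2[OF mult(2)] .
    show ?case
      by (rule exI[of _ "map (\<lambda>(y, z). (x, y, z)) ps"])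
        (use ps x in \<open>auto simp: o_def split_def sum_list_const_mult[symmetric] mult.assoc\<close>)
  qed
  then show ?thesis using that by blast
qed

lemma tens_prod_assoc: "(X \<otimes>\<^sub>A Y) \<otimes>\<^sub>A Z = X \<otimes>\<^sub>A (Y \<otimes>\<^sub>A Z)"
proof
  have 1: "x * z \<in> X \<otimes>\<^sub>A (Y \<otimes>\<^sub>A Z)" if "x \<in> X \<otimes>\<^sub>A Y" "z \<in> Z" for x z
    using that by (induction rule: tens_prod_induct)
      (auto simp: distrib_right mult.assoc tens_prod_zero intro: tens_prod_add tens_prodI)
  show "(X \<otimes>\<^sub>A Y) \<otimes>\<^sub>A Z \<subseteq> X \<otimes>\<^sub>A (Y \<otimes>\<^sub>A Z)"
  proof
    fix t assume "t \<in> (X \<otimes>\<^sub>A Y) \<otimes>\<^sub>A Z"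
    then show "t \<in> X \<otimes>\<^sub>A (Y \<otimes>\<^sub>A Z)"
      by (induction rule: tens_prod_induct) (auto simp: tens_prod_zero intro: tens_prod_add 1)
  qed
  have 2: "x * z \<in> (X \<otimes>\<^sub>A Y) \<otimes>\<^sub>A Z" if "z \<in> Y \<otimes>\<^sub>A Z" "x \<in> X" for x z
    using that by (induction rule: tens_prod_induct)
      (auto simp: distrib_left mult.assoc[symmetric] tens_prod_zero intro: tens_prod_add tens_prodI)
  show "X \<otimes>\<^sub>A (Y \<otimes>\<^sub>A Z) \<subseteq> (X \<otimes>\<^sub>A Y) \<otimes>\<^sub>A Z"
  proof
    fix t assume "t \<in> X \<otimes>\<^sub>A (Y \<otimes>\<^sub>A Z)"
    then show "t \<in> (X \<otimes>\<^sub>A Y) \<otimes>\<^sub>A Z"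
      by (induction rule: tens_prod_induct) (auto simp: tens_prod_zero intro: tens_prod_add 2)
  qed
qed

subsection \<open>Contraction with a vector field\<close>

text \<open>Evaluation against a fixed vector field, as a total map: it agrees with
  \<open>ev_id\<close> after \<open>vect v\<close> where that is meaningful, and is 0 on words that
  do not start with a form.\<close>

definition ctr :: "('w::star_dga \<Rightarrow> 'w) \<Rightarrow> 'w tens \<Rightarrow> 'w tens" where
  "ctr v = tens_case (\<lambda>_. 0) (\<lambda>\<xi> x. scal (v \<xi>) * x) (\<lambda>_ _. 0)"

lemma ctr_bal: "v \<in> Vec \<Longrightarrow> fbal (\<lambda>\<xi> x. scal (v \<xi>) * x)"
  by (auto simp: fbal_def additive_def distrib_left distrib_right Vec_add Vec_mult scal_add Vec_in
      scal_scal[symmetric] mult.assoc)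

lemma additive_ctr: "v \<in> Vec \<Longrightarrow> additive (ctr v)"
  unfolding ctr_def by (rule additive_tens_case) (simp_all add: ctr_bal)

lemma ctr_form: "v \<in> Vec \<Longrightarrow> \<xi> \<in> Om 1 \<Longrightarrow> ctr v (form \<xi> * x) = scal (v \<xi>) * x"
  unfolding ctr_def by (rule tens_case_form) (simp_all add: ctr_bal)

lemma ctr_form1: "v \<in> Vec \<Longrightarrow> \<xi> \<in> Om 1 \<Longrightarrow> ctr v (form \<xi>) = scal (v \<xi>)"
  using ctr_form[of v \<xi> 1] by simp

lemma ctr_of_vect: "v \<in> Vec \<Longrightarrow> u \<in> Vec \<Longrightarrow> ctr v (vect u * x) = 0"
  unfolding ctr_def by (rule tens_case_vect) (simp_all add: ctr_bal)

lemma ctr_scal: "v \<in> Vec \<Longrightarrow> a \<in> Om 0 \<Longrightarrow> ctr v (scal a) = 0"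
  unfolding ctr_def by (rule tens_case_scal) (simp_all add: ctr_bal)

lemmas ctr_add = additive.add[OF additive_ctr] and ctr_zero = additive.zero[OF additive_ctr]
  and ctr_diff = additive.diff[OF additive_ctr]

lemma ctr_plus: "u \<in> Vec \<Longrightarrow> v \<in> Vec \<Longrightarrow> ctr (\<lambda>\<xi>. u \<xi> + v \<xi>) t = ctr u t + ctr v t"
proof (induction t rule: tens_induct)
  case (form \<xi> x)
  then show ?case by (simp add: ctr_form vec_add_in scal_add Vec_in distrib_right)
qed (simp_all add: vec_add_in ctr_add ctr_of_vect ctr_scal)

lemma ctr_lact: "a \<in> Om 0 \<Longrightarrow> v \<in> Vec \<Longrightarrow> ctr (vec_lact a v) t = scal a * ctr v t"
proof (induction t rule: tens_induct)
  case (form \<xi> x)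
  then show ?case
    by (simp add: ctr_form vec_lact_in vec_lact_apply scal_scal[symmetric] Vec_in mult.assoc)
qed (simp_all add: vec_lact_in ctr_add ctr_of_vect ctr_scal distrib_left)

lemma scal_mult_form: "a \<in> Om 0 \<Longrightarrow> \<xi> \<in> Om 1 \<Longrightarrow> scal a * (form \<xi> * x) = form (a * \<xi>) * x"
  by (simp add: mult.assoc[symmetric] scal_form)

lemma scal_mult_vect: "a \<in> Om 0 \<Longrightarrow> v \<in> Vec \<Longrightarrow> scal a * (vect v * x) = vect (vec_lact a v) * x"
  by (simp add: mult.assoc[symmetric] scal_vect)

lemma form_mult_scal: "a \<in> Om 0 \<Longrightarrow> \<xi> \<in> Om 1 \<Longrightarrow> form \<xi> * (scal a * x) = form (\<xi> * a) * x"
  by (simp add: mult.assoc[symmetric] form_scal)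

lemma vect_mult_scal: "a \<in> Om 0 \<Longrightarrow> v \<in> Vec \<Longrightarrow> vect v * (scal a * x) = vect (vec_ract v a) * x"
  by (simp add: mult.assoc[symmetric] vect_scal)

lemma ctr_ract: "a \<in> Om 0 \<Longrightarrow> v \<in> Vec \<Longrightarrow> ctr (vec_ract v a) t = ctr v (scal a * t)"
proof (induction t rule: tens_induct)
  case (form \<xi> x)
  then show ?case
    by (simp add: ctr_form vec_ract_in vec_ract_apply scal_mult_form Om_intros)
qed (simp_all add: vec_ract_in ctr_add ctr_of_vect ctr_scal distrib_left scal_mult_vect vec_lact_in
    scal_scal Om_intros)

abbreviation Fm :: "'w::star_dga tens set" where "Fm \<equiv> form ` Om 1"
abbreviation FT :: "'w::star_dga tens set" where "FT \<equiv> form ` Om 1 \<otimes>\<^sub>A UNIV"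

lemma Fm_zero: "0 \<in> Fm" by (metis form_zero Om_zero image_eqI)
lemma Fm_add: "x \<in> Fm \<Longrightarrow> y \<in> Fm \<Longrightarrow> x + y \<in> Fm" by (auto simp: form_add[symmetric] Om_intros)
lemma Fm_scal: "x \<in> Fm \<Longrightarrow> a \<in> Om 0 \<Longrightarrow> scal a * x \<in> Fm" by (auto simp: scal_form Om_intros)
lemma form_uminus: "\<xi> \<in> Om 1 \<Longrightarrow> form (- \<xi>) = - form \<xi>"
  by (metis Om_uminus add.right_inverse form_add form_zero minus_unique)
lemma form_diff: "\<xi> \<in> Om 1 \<Longrightarrow> \<eta> \<in> Om 1 \<Longrightarrow> form (\<xi> - \<eta>) = form \<xi> - form \<eta>"
  by (metis Om_uminus add_uminus_conv_diff form_add form_uminus)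
lemma Fm_uminus: "x \<in> Fm \<Longrightarrow> - x \<in> Fm" by (auto simp: form_uminus[symmetric] Om_intros)
lemma Fm_diff: "x \<in> Fm \<Longrightarrow> y \<in> Fm \<Longrightarrow> x - y \<in> Fm" by (auto simp: form_diff[symmetric] Om_intros)

lemma scal_uminus: "a \<in> Om 0 \<Longrightarrow> scal (- a) = - scal a"
  by (metis Om_uminus add.right_inverse scal_add scal_zero minus_unique)

lemma ctr_mult: "y \<in> FT \<Longrightarrow> v \<in> Vec \<Longrightarrow> ctr v (y * z) = ctr v y * z"
proof (induction rule: tens_prod_induct)
  case zero
  then show ?case by (simp add: ctr_zero)
next
  case (add x y)
  then show ?case by (simp add: distrib_right ctr_add)
next
  case (mult x y)
  then show ?case by (auto simp: ctr_form mult.assoc)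
qed

lemma FT_prod: "X \<subseteq> Fm \<Longrightarrow> t \<in> X \<otimes>\<^sub>A Y \<Longrightarrow> t \<in> FT"
  using tens_prod_mono[of X Fm Y UNIV] by auto

text \<open>The total counterpart of \<open>ev_id\<close>: reads a leading vector, then lets
  \<open>ctr\<close> read the form behind it.\<close>

definition ctr_vect :: "'w::star_dga tens \<Rightarrow> 'w tens" where
  "ctr_vect = tens_case (\<lambda>_. 0) (\<lambda>_ _. 0) ctr"

lemma vbal_ctr: "vbal ctr"
  by (simp add: vbal_def additive_ctr ctr_plus ctr_ract)

lemma additive_ctr_vect: "additive ctr_vect"
  unfolding ctr_vect_def by (rule additive_tens_case) (simp_all add: vbal_ctr)

lemmas ctr_vect_add = additive.add[OF additive_ctr_vect] and ctr_vect_zero = additive.zero[OF additive_ctr_vect]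

lemma ctr_vect_vect: "v \<in> Vec \<Longrightarrow> ctr_vect (vect v * y) = ctr v y"
  unfolding ctr_vect_def by (rule tens_case_vect) (simp_all add: vbal_ctr)

lemma ctr_vect_scal_mult: "a \<in> Om 0 \<Longrightarrow> ctr_vect (scal a * t) = scal a * ctr_vect t"
proof (induction t rule: tens_induct)
  case (vect v x)
  then show ?case by (simp add: scal_mult_vect ctr_vect_vect vec_lact_in ctr_lact)
next
  case (scal b)
  then show ?case unfolding ctr_vect_def
    by (simp add: scal_scal tens_case_scal vbal_ctr Om_intros)
next
  case (form \<xi> x)
  then show ?case unfolding ctr_vect_def
    by (simp add: scal_mult_form tens_case_form vbal_ctr Om_intros)
qed (simp add: distrib_left ctr_vect_add)

lemma ev_id_eq: 
  assumes "t \<in> vect ` Vec \<otimes>\<^sub>A FT"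
  shows "ev_id t = ctr_vect t"
proof -
  have "t \<in> vect ` Vec \<otimes>\<^sub>A (form ` Om 1 \<otimes>\<^sub>A (\<lambda>x. x) ` UNIV)"
    using assms by simp
  then obtain ps where "set ps \<subseteq> Vec \<times> Om 1 \<times> UNIV" "t = (\<Sum>(v, \<xi>, x)\<leftarrow>ps. vect v * form \<xi> * x)"
    by (rule tens_prod_list3)
  moreover have "ctr_vect (case p of (v, \<xi>, x) \<Rightarrow> vect v * form \<xi> * x) = (case p of (v, \<xi>, x) \<Rightarrow> scal (v \<xi>) * x)"
    if "p \<in> Vec \<times> Om 1 \<times> UNIV" for p
    using that by (auto simp: ctr_vect_vect ctr_form mult.assoc)
  ultimately show ?thesis
    unfolding ev_id_def by (intro lin_ext_hom[where ps = ps, OF additive_ctr_vect])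
qed

lemma ev_id_vect: "v \<in> Vec \<Longrightarrow> y \<in> FT \<Longrightarrow> ev_id (vect v * y) = ctr v y"
  using ev_id_eq[of "vect v * y"] by (simp add: ctr_vect_vect tens_prodI)

subsection \<open>Maps on the first form\<close>

definition fmap :: "('w::star_dga \<Rightarrow> 'w) \<Rightarrow> 'w tens \<Rightarrow> 'w tens" where
  "fmap f = tens_case (\<lambda>_. 0) (\<lambda>\<xi> x. form (f \<xi>) * x) (\<lambda>_ _. 0)"

definition bimod_map :: "('w::star_dga \<Rightarrow> 'w) \<Rightarrow> bool" where
  "bimod_map f \<longleftrightarrow> f \<in> Om 1 \<rightarrow> Om 1 \<and> right_linear_on (Om 1) f \<and>
     (\<forall>a\<in>Om 0. \<forall>\<xi>\<in>Om 1. f (a * \<xi>) = a * f \<xi>)"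

lemma bimod_map_simps:
  assumes "bimod_map f" "\<xi> \<in> Om 1"
  shows "f \<xi> \<in> Om 1" "\<eta> \<in> Om 1 \<Longrightarrow> f (\<xi> + \<eta>) = f \<xi> + f \<eta>"
    "a \<in> Om 0 \<Longrightarrow> f (\<xi> * a) = f \<xi> * a" "a \<in> Om 0 \<Longrightarrow> f (a * \<xi>) = a * f \<xi>"
    "f (c *\<^sub>C \<xi>) = c *\<^sub>C f \<xi>"
proof -
  show r: "f (\<xi> * a) = f \<xi> * a" if "a \<in> Om 0" for a
    using assms that by (auto simp: bimod_map_def right_linear_on_def)
  show "f (c *\<^sub>C \<xi>) = c *\<^sub>C f \<xi>"
    using r[of "c *\<^sub>C 1"] by (simp add: Om_intros mult_cscale_1)
qed (use assms in \<open>auto simp: bimod_map_def right_linear_on_def additive_on_def\<close>)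

lemma bimod_map_zero: "bimod_map f \<Longrightarrow> f 0 = 0"
  by (metis Om_zero add_cancel_right_right bimod_map_simps(2))

context
  fixes f :: "'w::star_dga \<Rightarrow> 'w" assumes f: "bimod_map f"
begin

lemma fmap_bal: "fbal (\<lambda>\<xi> x. form (f \<xi>) * x)"
  by (auto simp: fbal_def additive_def distrib_left distrib_right bimod_map_simps[OF f] form_add
      form_mult_scal)

lemma additive_fmap: "additive (fmap f)"
  unfolding fmap_def by (rule additive_tens_case) (simp_all add: fmap_bal)

lemmas fmap_add = additive.add[OF additive_fmap] and fmap_zero = additive.zero[OF additive_fmap]

lemma fmap_form: "\<xi> \<in> Om 1 \<Longrightarrow> fmap f (form \<xi> * x) = form (f \<xi>) * x"
  unfolding fmap_def by (rule tens_case_form) (simp_all add: fmap_bal)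

lemma fmap_form1: "\<xi> \<in> Om 1 \<Longrightarrow> fmap f (form \<xi>) = form (f \<xi>)"
  using fmap_form[of \<xi> 1] by simp

lemma fmap_scal_mult: "t \<in> FT \<Longrightarrow> a \<in> Om 0 \<Longrightarrow> fmap f (scal a * t) = scal a * fmap f t"
  by (induction rule: tens_prod_induct)
    (auto simp: fmap_form scal_mult_form Om_intros bimod_map_simps[OF f] distrib_left fmap_zero
      fmap_add)

lemma fmap_mult: "t \<in> FT \<Longrightarrow> fmap f (t * z) = fmap f t * z"
  by (induction rule: tens_prod_induct)
    (auto simp: fmap_form mult.assoc distrib_right fmap_zero
      fmap_add)

lemma map_fst_eq: "t \<in> FT \<Longrightarrow> map_fst f t = fmap f t"
proof -
  assume "t \<in> FT"
  then obtain ps where "set ps \<subseteq> Om 1 \<times> UNIV" "t = (\<Sum>(x, y)\<leftarrow>ps. form x * y)"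
    by (rule tens_prod_list)
  then show ?thesis unfolding map_fst_def
    by (intro lin_ext_hom[where ps = ps]) (auto simp: additive_fmap fmap_form)
qed

end

lemma fmap_in: "bimod_map f \<Longrightarrow> (\<And>\<xi>. \<xi> \<in> Om 1 \<Longrightarrow> f \<xi> \<in> S) \<Longrightarrow> t \<in> Fm \<otimes>\<^sub>A Y \<Longrightarrow> fmap f t \<in> form ` S \<otimes>\<^sub>A Y"
proof -
  assume f: "bimod_map f" and S: "\<And>\<xi>. \<xi> \<in> Om 1 \<Longrightarrow> f \<xi> \<in> S"
  assume "t \<in> Fm \<otimes>\<^sub>A Y"
  then show ?thesis
    by (induction rule: tens_prod_induct)
      (auto simp: fmap_zero[OF f] fmap_add[OF f] fmap_form[OF f]
        tens_prod_zero S intro!: tens_prod_add tens_prodI)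
qed

subsection \<open>Dual bases\<close>

lemma Vec_vsum: "(\<And>p. p \<in> set ps \<Longrightarrow> f p \<in> Vec) \<Longrightarrow> (\<lambda>\<xi>. \<Sum>p\<leftarrow>ps. f p \<xi>) \<in> Vec"
  by (induction ps) (auto intro: zero_in_Vec vec_add_in)

lemma vect_vsum: "(\<And>p. p \<in> set ps \<Longrightarrow> f p \<in> Vec) \<Longrightarrow> vect (\<lambda>\<xi>. \<Sum>p\<leftarrow>ps. f p \<xi>) = (\<Sum>p\<leftarrow>ps. vect (f p))"
  by (induction ps) (simp_all add: vect_add Vec_vsum)

lemma form_sum_list: "(\<And>p. p \<in> set ps \<Longrightarrow> f p \<in> Om 1) \<Longrightarrow> form (\<Sum>p\<leftarrow>ps. f p) = (\<Sum>p\<leftarrow>ps. form (f p))"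
  by (induction ps) (simp_all add: form_add Om_sum_list)

lemma sum_list_cong: "(\<And>x. x \<in> set xs \<Longrightarrow> f x = g x) \<Longrightarrow> (\<Sum>x\<leftarrow>xs. f x) = (\<Sum>x\<leftarrow>xs. g x)"
  by (metis map_cong)

text \<open>The retraction of the free module gives the basis: its values on the unit vectors,
  paired with the coordinates of the inclusion.\<close>

lemma dual_basis_exists:
  assumes "right_fgp (Om 1 :: 'w::star_dga set)"
  shows "\<exists>bs. dual_basis (Om 1) (Vec :: ('w \<Rightarrow> 'w) set) bs"
proof -
  from assms obtain n and inc :: "'w \<Rightarrow> nat \<Rightarrow> 'w" and pr where *:
    "inc \<in> Om 1 \<rightarrow> free_mod n \<and> pr \<in> free_mod n \<rightarrow> Om 1 \<and>
     (\<forall>i. right_linear_on (Om 1) (\<lambda>x. inc x i)) \<and>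
     (\<forall>f\<in>free_mod n. \<forall>g\<in>free_mod n. pr (\<lambda>i. f i + g i) = pr f + pr g) \<and>
     (\<forall>f\<in>free_mod n. \<forall>a\<in>Om 0. pr (\<lambda>i. f i * a) = pr f * a) \<and>
     (\<forall>x\<in>Om 1. pr (inc x) = x)"
    unfolding right_fgp_def by (elim exE)
  have inc: "inc x \<in> free_mod n" if "x \<in> Om 1" for x using * that by blast
  have pr: "pr f \<in> Om 1" if "f \<in> free_mod n" for f using * that by blast
  have lin: "right_linear_on (Om 1) (\<lambda>x. inc x i)" for i using * by blast
  have pr_add: "pr (\<lambda>i. f i + g i) = pr f + pr g" if "f \<in> free_mod n" "g \<in> free_mod n" for f g
    using * that by blast
  have pr_mult: "pr (\<lambda>i. f i * a) = pr f * a" if "f \<in> free_mod n" "a \<in> Om 0" for f a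
    using * that by blast
  have pr_inc: "pr (inc x) = x" if "x \<in> Om 1" for x using * that by blast
  define \<delta> where "\<delta> i = (\<lambda>j. if j = i then 1 else 0 :: 'w)" for i :: nat
  define u where "u i = (\<lambda>\<xi>. if \<xi> \<in> Om 1 then inc \<xi> i else 0)" for i
  have \<delta>: "\<delta> i \<in> free_mod n" if "i < n" for i
    using that by (auto simp: \<delta>_def free_mod_def Om_intros)
  have z: "(\<lambda>_. 0) \<in> (free_mod n :: (nat \<Rightarrow> 'w) set)"
    by (simp add: free_mod_def Om_zero)
  \<comment> \<open>Expansion in unit vectors, by truncating to the first \<open>m\<close>
    coordinates: each step of the induction then uses additivity of \<open>pr\<close> for two
    summands only. The case \<open>m = n\<close> is the one needed.\<close>
  have expand: "pr (\<lambda>j. if j < m then f j else 0) = (\<Sum>i\<leftarrow>[0..<m]. pr (\<delta> i) * f i)"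
    if "f \<in> free_mod n" "m \<le> n" for f m
    using that(2)
  proof (induction m)
    case 0
    show ?case using pr_add[OF z z] by simp
  next
    case (Suc m)
    have fm: "f m \<in> Om 0" using that(1) Suc by (simp add: free_mod_def)
    have 1: "(\<lambda>j. if j < m then f j else 0) \<in> free_mod n"
      using that(1) Suc by (auto simp: free_mod_def Om_zero)
    have 2: "(\<lambda>j. \<delta> m j * f m) \<in> free_mod n"
      using \<delta>[of m] Suc fm by (auto simp: free_mod_def Om_intros)
    have "(\<lambda>j. if j < Suc m then f j else 0) = (\<lambda>j. (if j < m then f j else 0) + \<delta> m j * f m)"
      by (auto simp: \<delta>_def less_Suc_eq fun_eq_iff)
    then have "pr (\<lambda>j. if j < Suc m then f j else 0) = pr (\<lambda>j. if j < m then f j else 0) + pr (\<delta> m) * f m"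
      using pr_add[OF 1 2] pr_mult[OF \<delta> fm] Suc by simp
    then show ?case using Suc by simp
  qed
  have uV: "u i \<in> Vec" if "i < n" for i
  proof (rule VecI)
    show "u i \<xi> \<in> Om 0" if "\<xi> \<in> Om 1" for \<xi>
      using inc[OF that] \<open>i < n\<close> that by (simp add: u_def free_mod_def)
    show "u i (\<xi> + \<eta>) = u i \<xi> + u i \<eta>" if "\<xi> \<in> Om 1" "\<eta> \<in> Om 1" for \<xi> \<eta>
      using lin[of i] that by (auto simp: u_def right_linear_on_def additive_on_def Om_intros)
    show "u i (\<xi> * a) = u i \<xi> * a" if "\<xi> \<in> Om 1" "a \<in> Om 0" for \<xi> a
      using lin[of i] that by (auto simp: u_def right_linear_on_def Om_intros)
  qed (simp add: u_def)
  have "\<omega> = (\<Sum>(\<xi>, v)\<leftarrow>map (\<lambda>i. (pr (\<delta> i), u i)) [0..<n]. \<xi> * v \<omega>)" if \<omega>: "\<omega> \<in> Om 1" for \<omega>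
  proof -
    have f: "inc \<omega> \<in> free_mod n" using \<omega> by (rule inc)
    have "(\<lambda>j. if j < n then inc \<omega> j else 0) = inc \<omega>"
      using f by (auto simp: free_mod_def fun_eq_iff)
    then show ?thesis
      using expand[OF f order_refl] pr_inc[OF \<omega>] \<omega> by (simp add: o_def u_def)
  qed
  then have "dual_basis (Om 1) Vec (map (\<lambda>i. (pr (\<delta> i), u i)) [0..<n])"
    using uV \<delta> pr by (auto simp: dual_basis_def)
  then show ?thesis ..
qed

subsection \<open>Right contraction of vector-valued forms\<close>

text \<open>This is \<open>id \<otimes> ev\<close> with the last form fixed. Multiplying by
  \<open>form \<xi>\<close> first makes compatibility with the relations automatic.\<close>

definition rctr :: "'w::star_dga \<Rightarrow> 'w tens \<Rightarrow> 'w tens" where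
  "rctr \<xi> t = tens_case (\<lambda>_. 0) (\<lambda>\<omega> y. form \<omega> * ctr_vect y) (\<lambda>_ _. 0) (t * form \<xi>)"

lemma rctr_bal: "fbal (\<lambda>\<omega> y. form \<omega> * ctr_vect y)"
  by (auto simp: fbal_def additive_mult_left additive_ctr_vect form_add distrib_right
      ctr_vect_scal_mult form_mult_scal)

lemma additive_rctr: "additive (rctr \<xi>)"
  by standard (simp add: rctr_def distrib_right additive.add[OF additive_tens_case] rctr_bal)

lemma rctr_form_vect:
  "\<omega> \<in> Om 1 \<Longrightarrow> v \<in> Vec \<Longrightarrow> \<xi> \<in> Om 1 \<Longrightarrow> rctr \<xi> (form \<omega> * vect v) = form (\<omega> * v \<xi>)"
  by (simp add: rctr_def mult.assoc tens_case_form rctr_bal ctr_vect_vect ctr_form1 form_scal Vec_in)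

abbreviation FV :: "'w::star_dga tens set" where "FV \<equiv> form ` Om 1 \<otimes>\<^sub>A vect ` Vec"

lemmas rctr_simps = additive.add[OF additive_rctr] additive.zero[OF additive_rctr] rctr_form_vect

lemma rctr_add: "t \<in> FV \<Longrightarrow> \<xi> \<in> Om 1 \<Longrightarrow> \<eta> \<in> Om 1 \<Longrightarrow> rctr (\<xi> + \<eta>) t = rctr \<xi> t + rctr \<eta> t"
  by (induction rule: tens_prod_induct)
    (auto simp: rctr_simps Om_intros Vec_in Vec_add distrib_left form_add)

lemma rctr_scal: "t \<in> FV \<Longrightarrow> \<xi> \<in> Om 1 \<Longrightarrow> a \<in> Om 0 \<Longrightarrow> rctr \<xi> (scal a * t) = scal a * rctr \<xi> t"
  by (induction rule: tens_prod_induct)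
    (auto simp: rctr_simps Om_intros Vec_in distrib_left scal_form scal_mult_form mult.assoc)

lemma rctr_scal_right: "t \<in> FV \<Longrightarrow> \<xi> \<in> Om 1 \<Longrightarrow> a \<in> Om 0 \<Longrightarrow> rctr \<xi> (t * scal a) = rctr (a * \<xi>) t"
  by (induction rule: tens_prod_induct)
    (auto simp: rctr_simps Om_intros Vec_in distrib_right vect_scal vec_ract_in vec_ract_apply mult.assoc)

lemma FV_scal: "t \<in> FV \<Longrightarrow> a \<in> Om 0 \<Longrightarrow> scal a * t \<in> FV"
  by (rule tens_prod_left) (auto simp: Fm_scal)

lemma FV_scal_right: "t \<in> FV \<Longrightarrow> a \<in> Om 0 \<Longrightarrow> t * scal a \<in> FV"
  by (rule tens_prod_right) (auto simp: vect_scal vec_ract_in)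

lemma FV_uminus: "t \<in> FV \<Longrightarrow> - t \<in> FV"
  by (rule tens_prod_uminus) (auto simp: Fm_uminus)

lemma id_ev_eq:
  assumes "t \<in> FV" "\<xi> \<in> Om 1"
  shows "id_ev (t * form \<xi>) = rctr \<xi> t"
proof -
  have "t * form \<xi> \<in> form ` Om 1 \<otimes>\<^sub>A (vect ` Vec \<otimes>\<^sub>A form ` Om 1)"
    using tens_prodI[OF assms(1), of "form \<xi>" "form ` Om 1"] assms(2) by (simp add: tens_prod_assoc)
  then obtain ps where ps: "set ps \<subseteq> Om 1 \<times> Vec \<times> Om 1"
    "t * form \<xi> = (\<Sum>(\<omega>, v, \<xi>)\<leftarrow>ps. form \<omega> * vect v * form \<xi>)"
    by (rule tens_prod_list3)
  have "tens_case (\<lambda>_. 0) (\<lambda>\<omega> y. form \<omega> * ctr_vect y) (\<lambda>_ _. 0) (case p of (\<omega>, v, \<xi>) \<Rightarrow> form \<omega> * vect v * form \<xi>)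
      = (case p of (\<omega>, v, \<xi>) \<Rightarrow> form \<omega> * scal (v \<xi>))" if "p \<in> Om 1 \<times> Vec \<times> Om 1" for p
    using that by (auto simp: mult.assoc tens_case_form rctr_bal ctr_vect_vect ctr_form1)
  then show ?thesis
    unfolding id_ev_def rctr_def
    by (intro lin_ext_hom[where ps = ps, OF additive_tens_case]) (simp_all add: rctr_bal ps)
qed

text \<open>Serves two cases: dual bases of all one-forms, with \<open>\<zeta> = \<omega>\<close>,
  and dual bases of the (1,0)-forms, with \<zeta> the (1,0)-part of \<omega>, which (1,0)-vectors
  cannot tell from \<omega>.\<close>

lemma dual_basis_rctr:
  assumes bs: "dual_basis X Y bs" and X: "X \<subseteq> Om 1" and Y: "Y \<subseteq> Vec"
  shows "(\<Sum>(\<xi>, u)\<leftarrow>bs. form \<xi> * vect u) \<in> FV"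
    and "\<omega> \<in> Om 1 \<Longrightarrow> \<zeta> \<in> X \<Longrightarrow> (\<And>u. u \<in> Y \<Longrightarrow> u \<omega> = u \<zeta>) \<Longrightarrow>
      rctr \<omega> (\<Sum>(\<xi>, u)\<leftarrow>bs. form \<xi> * vect u) = form \<zeta>"
proof -
  have XY: "q \<in> X \<times> Y" if "q \<in> set bs" for q
    using bs that unfolding dual_basis_def by blast
  have mem: "fst q \<in> Om 1" "snd q \<in> Vec" "snd q \<in> Y" if "q \<in> set bs" for q
    using subsetD[OF X, of "fst q"] subsetD[OF Y, of "snd q"] XY[OF that]
    by (simp_all add: mem_Times_iff)
  show "(\<Sum>(\<xi>, u)\<leftarrow>bs. form \<xi> * vect u) \<in> FV"
    by (rule tens_prod_sum_list) (use mem in \<open>auto simp: split_def intro: tens_prodI\<close>)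
  assume \<omega>: "\<omega> \<in> Om 1" "\<zeta> \<in> X" "\<And>u. u \<in> Y \<Longrightarrow> u \<omega> = u \<zeta>"
  have "rctr \<omega> (\<Sum>q\<leftarrow>bs. form (fst q) * vect (snd q)) = (\<Sum>q\<leftarrow>bs. form (fst q * snd q \<zeta>))"
    unfolding additive_sum_list[OF additive_rctr]
    by (rule sum_list_cong) (simp add: rctr_form_vect mem \<omega>(1) \<omega>(3)[OF mem(3)])
  also have "\<dots> = form (\<Sum>q\<leftarrow>bs. fst q * snd q \<zeta>)"
    by (rule form_sum_list[symmetric]) (use mem in \<open>simp add: Om_mult_10 Vec_in\<close>)
  also have "(\<Sum>q\<leftarrow>bs. fst q * snd q \<zeta>) = \<zeta>"
    using bs \<omega> by (simp add: dual_basis_def split_def)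
  finally show "rctr \<omega> (\<Sum>(\<xi>, u)\<leftarrow>bs. form \<xi> * vect u) = form \<zeta>"
    by (simp add: split_def)
qed

text \<open>A dual basis reconstructs a vector-valued form from its values, as the sum of
  \<open>rctr \<xi> x * vect u\<close> over the basis. All identities between vector-valued forms
  below are checked by evaluating them.\<close>

lemma rctr_ext:
  assumes fgp: "right_fgp (Om 1 :: 'w::star_dga set)"
    and s: "s \<in> (FV :: 'w tens set)" and t: "t \<in> FV" and eq: "\<And>\<xi>. \<xi> \<in> Om 1 \<Longrightarrow> rctr \<xi> s = rctr \<xi> t"
  shows "s = t"
proof -
  obtain bs :: "('w \<times> ('w \<Rightarrow> 'w)) list" where bs: "dual_basis (Om 1) Vec bs"
    using dual_basis_exists[OF fgp] by blast
  have "x = (\<Sum>(\<xi>, u)\<leftarrow>bs. rctr \<xi> x * vect u)" if "x \<in> FV" for x :: "'w tens"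
    using that
  proof (induction rule: tens_prod_induct)
    case zero
    then show ?case by (simp add: rctr_simps)
  next
    case (add x y)
    have "(\<Sum>(\<xi>, u)\<leftarrow>bs. rctr \<xi> (x + y) * vect u) =
        (\<Sum>(\<xi>, u)\<leftarrow>bs. rctr \<xi> x * vect u) + (\<Sum>(\<xi>, u)\<leftarrow>bs. rctr \<xi> y * vect u)"
      by (simp add: rctr_simps distrib_right split_def sum_list_addf)
    then show ?case using add by metis
  next
    case (mult x y)
    then obtain \<omega> v where [simp]: "x = form \<omega>" "y = vect v" and \<omega>: "\<omega> \<in> Om 1" and v: "v \<in> Vec"
      by blast
    have mem: "fst p \<in> Om 1" "snd p \<in> Vec" if "p \<in> set bs" for p
      using bs that by (auto simp: dual_basis_def)
    \<comment> \<open>The dual half of the basis property: the vectors of the basis generate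
      \<open>Vec\<close> from the left, with the coefficients \<open>v (fst p)\<close>.\<close>
    have "v = (\<lambda>\<zeta>. \<Sum>p\<leftarrow>bs. vec_lact (v (fst p)) (snd p) \<zeta>)"
    proof
      fix \<zeta> show "v \<zeta> = (\<Sum>p\<leftarrow>bs. vec_lact (v (fst p)) (snd p) \<zeta>)"
      proof (cases "\<zeta> \<in> Om 1")
        case True
        have "v \<zeta> = v (\<Sum>p\<leftarrow>bs. fst p * snd p \<zeta>)"
          using bs True by (auto simp: dual_basis_def split_def)
        also have "\<dots> = (\<Sum>p\<leftarrow>bs. v (fst p * snd p \<zeta>))"
          by (rule Vec_sum_list[OF v]) (use mem in \<open>simp add: Om_mult_10 Vec_in\<close>)
        also have "\<dots> = (\<Sum>p\<leftarrow>bs. vec_lact (v (fst p)) (snd p) \<zeta>)"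
          by (rule sum_list_cong) (use mem True v in \<open>auto simp: vec_lact_apply Vec_mult Vec_in\<close>)
        finally show ?thesis .
      next
        case False
        then have "(\<Sum>p\<leftarrow>bs. vec_lact (v (fst p)) (snd p) \<zeta>) = (\<Sum>p\<leftarrow>bs. 0)"
          by (intro sum_list_cong) (simp add: vec_lact_def)
        then show ?thesis using False v by (simp add: Vec_notin)
      qed
    qed
    then have "vect v = (\<Sum>p\<leftarrow>bs. vect (vec_lact (v (fst p)) (snd p)))"
      using vect_vsum[of bs "\<lambda>p. vec_lact (v (fst p)) (snd p)"] mem v by (simp add: vec_lact_in Vec_in)
    then have "form \<omega> * vect v = (\<Sum>p\<leftarrow>bs. form \<omega> * vect (vec_lact (v (fst p)) (snd p)))"
      by (simp add: sum_list_const_mult)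
    also have "\<dots> = (\<Sum>p\<leftarrow>bs. rctr (fst p) (form \<omega> * vect v) * vect (snd p))"
      by (rule sum_list_cong)
        (use mem v \<omega> in \<open>simp add: rctr_simps scal_vect[symmetric] form_mult_scal Vec_in\<close>)
    finally show ?case by (simp add: split_def)
  qed
  then have "s = (\<Sum>(\<xi>, u)\<leftarrow>bs. rctr \<xi> s * vect u)" "t = (\<Sum>(\<xi>, u)\<leftarrow>bs. rctr \<xi> t * vect u)"
    using s t by blast+
  moreover have "(\<Sum>(\<xi>, u)\<leftarrow>bs. rctr \<xi> s * vect u) = (\<Sum>(\<xi>, u)\<leftarrow>bs. rctr \<xi> t * vect u)"
    by (rule sum_list_cong) (use bs eq in \<open>auto simp: dual_basis_def\<close>)
  ultimately show ?thesis by simp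
qed

section \<open>The covariant derivative on tensor powers of vector fields\<close>

abbreviation FF :: "'w::star_dga tens set" where "FF \<equiv> form ` Om 1 \<otimes>\<^sub>A form ` Om 1"

lemma FF_FT: "t \<in> FF \<Longrightarrow> t \<in> FT"
  by (rule FT_prod[OF order_refl])

locale bimod_conn =
  fixes sq :: "'w::star_dga \<Rightarrow> 'w tens" and sinv :: "'w tens \<Rightarrow> 'w tens"
  assumes fgp: "right_fgp (Om 1 :: 'w set)" and conn: "right_bimod_conn sq sinv"
begin

lemma sinv_in: "t \<in> FF \<Longrightarrow> sinv t \<in> FF"
  and sinv_add: "s \<in> FF \<Longrightarrow> t \<in> FF \<Longrightarrow> sinv (s + t) = sinv s + sinv t"
  and sinv_scal: "a \<in> Om 0 \<Longrightarrow> t \<in> FF \<Longrightarrow> sinv (scal a * t) = scal a * sinv t"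
  and sinv_scal_right: "a \<in> Om 0 \<Longrightarrow> t \<in> FF \<Longrightarrow> sinv (t * scal a) = sinv t * scal a"
  and sq_in: "\<xi> \<in> Om 1 \<Longrightarrow> sq \<xi> \<in> FF"
  and sq_add: "\<xi> \<in> Om 1 \<Longrightarrow> \<eta> \<in> Om 1 \<Longrightarrow> sq (\<xi> + \<eta>) = sq \<xi> + sq \<eta>"
  and sq_mult: "\<xi> \<in> Om 1 \<Longrightarrow> a \<in> Om 0 \<Longrightarrow> sq (\<xi> * a) = sq \<xi> * scal a + form \<xi> * form (exd a)"
  and sq_lmult: "\<xi> \<in> Om 1 \<Longrightarrow> a \<in> Om 0 \<Longrightarrow> sq (a * \<xi>) = scal a * sq \<xi> + sinv (form (exd a) * form \<xi>)"
  using conn by (auto simp: right_bimod_conn_def Let_def additive_on_def Pi_iff)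

lemma sinv_zero: "sinv 0 = 0"
  using sinv_add[OF tens_prod_zero tens_prod_zero] by simp

subsection \<open>The braiding\<close>

text \<open>Since \<open>tens_case\<close> reads a single letter, \<sigma>^-1 on the first two forms
  is built by nesting: here the first form is fixed and the second is read. \<open>sinv_id\<close>
  then reads the first.\<close>

definition sinv1 :: "'w \<Rightarrow> 'w tens \<Rightarrow> 'w tens" where
  "sinv1 \<xi> = tens_case (\<lambda>_. 0) (\<lambda>\<eta> x. sinv (form \<xi> * form \<eta>) * x) (\<lambda>_ _. 0)"

lemma sinv1_bal:
  assumes \<xi>: "\<xi> \<in> Om 1"
  shows "fbal (\<lambda>\<eta> x. sinv (form \<xi> * form \<eta>) * x)"
proof -
  have "sinv (form \<xi> * form (\<eta> + \<zeta>)) = sinv (form \<xi> * form \<eta>) + sinv (form \<xi> * form \<zeta>)"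
    if "\<eta> \<in> Om 1" "\<zeta> \<in> Om 1" for \<eta> \<zeta>
    using \<xi> that by (simp add: form_add distrib_left sinv_add tens_prodI)
  moreover have "sinv (form \<xi> * form (\<eta> * a)) = sinv (form \<xi> * form \<eta>) * scal a"
    if "\<eta> \<in> Om 1" "a \<in> Om 0" for \<eta> a
    using \<xi> that sinv_scal_right[of a "form \<xi> * form \<eta>"] by (simp add: form_scal tens_prodI mult.assoc)
  ultimately show ?thesis
    by (simp add: fbal_def additive_def distrib_left distrib_right mult.assoc)
qed

lemma additive_sinv1: "\<xi> \<in> Om 1 \<Longrightarrow> additive (sinv1 \<xi>)"
  unfolding sinv1_def by (rule additive_tens_case) (simp_all add: sinv1_bal)

lemmas sinv1_add = additive.add[OF additive_sinv1] and sinv1_zero = additive.zero[OF additive_sinv1]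

lemma sinv1_form: "\<xi> \<in> Om 1 \<Longrightarrow> \<eta> \<in> Om 1 \<Longrightarrow> sinv1 \<xi> (form \<eta> * x) = sinv (form \<xi> * form \<eta>) * x"
  unfolding sinv1_def by (rule tens_case_form) (simp_all add: sinv1_bal)

lemma sinv1_vect: "\<xi> \<in> Om 1 \<Longrightarrow> v \<in> Vec \<Longrightarrow> sinv1 \<xi> (vect v * x) = 0"
  unfolding sinv1_def by (rule tens_case_vect) (simp_all add: sinv1_bal)

lemma sinv1_scal: "\<xi> \<in> Om 1 \<Longrightarrow> a \<in> Om 0 \<Longrightarrow> sinv1 \<xi> (scal a) = 0"
  unfolding sinv1_def by (rule tens_case_scal) (simp_all add: sinv1_bal)

lemma fbal_sinv1: "fbal sinv1"
proof -
  have "sinv1 (\<xi> + \<eta>) x = sinv1 \<xi> x + sinv1 \<eta> x" if "\<xi> \<in> Om 1" "\<eta> \<in> Om 1" for \<xi> \<eta> x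
  proof (induction x rule: tens_induct)
    case (form \<zeta> x)
    then show ?case using that
      by (simp add: sinv1_form Om_intros form_add distrib_right sinv_add tens_prodI)
  qed (use that in \<open>simp_all add: sinv1_vect sinv1_scal sinv1_add Om_intros\<close>)
  moreover have "sinv1 (\<xi> * a) x = sinv1 \<xi> (scal a * x)" if "\<xi> \<in> Om 1" "a \<in> Om 0" for \<xi> a x
  proof (induction x rule: tens_induct)
    case (form \<zeta> x)
    have "form (\<xi> * a) * form \<zeta> = form \<xi> * form (a * \<zeta>)"
      using that form by (simp add: form_scal[symmetric] scal_form[symmetric] mult.assoc)
    then show ?case using that form
      by (simp add: sinv1_form Om_intros scal_mult_form)
  qed (use that in \<open>simp_all add: sinv1_vect sinv1_scal sinv1_add Om_intros distrib_left
      scal_mult_vect vec_lact_in scal_scal\<close>)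
  ultimately show ?thesis by (simp add: fbal_def additive_sinv1)
qed

definition sinv_id :: "'w tens \<Rightarrow> 'w tens" where
  "sinv_id = tens_case (\<lambda>_. 0) sinv1 (\<lambda>_ _. 0)"

lemma additive_sinv_id: "additive sinv_id"
  unfolding sinv_id_def by (rule additive_tens_case) (simp_all add: fbal_sinv1)

lemmas sinv_id_add = additive.add[OF additive_sinv_id] and sinv_id_zero = additive.zero[OF additive_sinv_id]

lemma sinv_id_form: "\<xi> \<in> Om 1 \<Longrightarrow> \<eta> \<in> Om 1 \<Longrightarrow> sinv_id (form \<xi> * (form \<eta> * x)) = sinv (form \<xi> * form \<eta>) * x"
  unfolding sinv_id_def by (simp add: tens_case_form fbal_sinv1 sinv1_form)

lemma sinv_id_form1: "\<xi> \<in> Om 1 \<Longrightarrow> sinv_id (form \<xi> * x) = sinv1 \<xi> x"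
  unfolding sinv_id_def by (simp add: tens_case_form fbal_sinv1)


lemma sinv_id_scal: "a \<in> Om 0 \<Longrightarrow> sinv_id (scal a) = 0"
  unfolding sinv_id_def by (simp add: tens_case_scal fbal_sinv1)

lemma sinv_id_vect: "v \<in> Vec \<Longrightarrow> sinv_id (vect v * x) = 0"
  unfolding sinv_id_def by (simp add: tens_case_vect fbal_sinv1)

lemma sinv_id_FF: "s \<in> FF \<Longrightarrow> sinv_id (s * x) = sinv s * x"
proof -
  assume "s \<in> FF"
  then have "s \<in> FF \<and> sinv_id (s * x) = sinv s * x"
    by (induction rule: tens_prod_induct)
      (auto simp: sinv_zero sinv_id_zero sinv_id_form mult.assoc tens_prod_zero
        sinv_add tens_prodI distrib_right sinv_id_add intro: tens_prod_add)
  then show ?thesis ..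
qed

lemma sinv_id_scal_mult: "a \<in> Om 0 \<Longrightarrow> sinv_id (scal a * t) = scal a * sinv_id t"
proof (induction t rule: tens_induct)
  case (form \<xi> x)
  have "sinv1 (a * \<xi>) x = scal a * sinv1 \<xi> x"
  proof (induction x rule: tens_induct)
    case (form \<eta> x)
    have "sinv (form (a * \<xi>) * form \<eta>) = scal a * sinv (form \<xi> * form \<eta>)"
      using form \<open>\<xi> \<in> Om 1\<close> \<open>a \<in> Om 0\<close> sinv_scal[of a "form \<xi> * form \<eta>"]
      by (simp add: scal_mult_form tens_prodI)
    then show ?case using form \<open>\<xi> \<in> Om 1\<close> \<open>a \<in> Om 0\<close>
      by (simp add: sinv1_form Om_intros mult.assoc)
  qed (use \<open>\<xi> \<in> Om 1\<close> \<open>a \<in> Om 0\<close> in \<open>simp_all add: sinv1_vect sinv1_scal sinv1_add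
    Om_intros distrib_left\<close>)
  then show ?case using form by (simp add: scal_mult_form sinv_id_form1 Om_intros)
qed (simp_all add: distrib_left sinv_id_add scal_scal scal_mult_vect
    sinv_id_scal sinv_id_vect Om_intros vec_lact_in)

lemma sinv_id_mult: "t \<in> FF \<otimes>\<^sub>A UNIV \<Longrightarrow> sinv_id (t * z) = sinv_id t * z"
  by (induction rule: tens_prod_induct)
    (simp_all add: sinv_id_zero sinv_id_add distrib_right
      mult.assoc sinv_id_FF)

lemma sinv_id_in: "t \<in> FF \<otimes>\<^sub>A Y \<Longrightarrow> sinv_id t \<in> FF \<otimes>\<^sub>A Y"
  by (induction rule: tens_prod_induct)
    (auto simp: sinv_id_zero sinv_id_add
      sinv_id_FF sinv_in tens_prod_zero intro: tens_prod_add tens_prodI)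

lemma ctr_FF:
  assumes v: "v \<in> Vec" and "t \<in> FF"
  shows "ctr v t \<in> Fm"
proof -
  from \<open>t \<in> FF\<close> show ?thesis
    by (induction rule: tens_prod_induct)
      (use v in \<open>auto simp: ctr_zero ctr_add ctr_form Fm_zero Fm_add scal_form Vec_in Om_intros\<close>)
qed

text \<open>Every dual basis yields a tensor whose value at \<xi> is \<xi>. By
  \<open>rctr_ext\<close> all these tensors coincide, so the description in \<open>coev1\<close>
  denotes any one of them.\<close>

lemma coev1_in: "coev1 \<in> (FV :: 'w tens set)"
  and rctr_coev1: "\<xi> \<in> Om 1 \<Longrightarrow> rctr \<xi> coev1 = form (\<xi> :: 'w)"
proof -
  define E where "E bs = (\<Sum>(\<xi>, u)\<leftarrow>bs. form \<xi> * vect u)" for bs :: "('w \<times> ('w \<Rightarrow> 'w)) list"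
  have E: "E bs \<in> FV" "\<And>\<xi>. \<xi> \<in> Om 1 \<Longrightarrow> rctr \<xi> (E bs) = form \<xi>" if "dual_basis (Om 1) Vec bs" for bs
    using dual_basis_rctr[OF that order_refl order_refl] unfolding E_def by simp_all
  obtain bs :: "('w \<times> ('w \<Rightarrow> 'w)) list" where bs: "dual_basis (Om 1) Vec bs"
    using dual_basis_exists[OF fgp] by blast
  have "coev1 = E bs"
    unfolding coev1_def E_def[symmetric]
  proof (rule the_equality)
    show "\<exists>cs. dual_basis (Om 1) Vec cs \<and> E bs = E cs" using bs by blast
    fix c assume "\<exists>cs. dual_basis (Om 1) Vec cs \<and> c = E cs"
    then obtain cs where cs: "dual_basis (Om 1) Vec cs" "c = E cs" by blast
    show "c = E bs"
      unfolding cs(2) by (rule rctr_ext[OF fgp]) (simp_all add: E bs cs(1))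
  qed
  then show "coev1 \<in> (FV :: 'w tens set)" "\<xi> \<in> Om 1 \<Longrightarrow> rctr \<xi> coev1 = form \<xi>" for \<xi> :: 'w
    using E[OF bs] by simp_all
qed

text \<open>Both sides have the value \<open>a * \<xi>\<close> at \<xi>. Centrality is what makes
  \<sigma> right linear, in \<open>sigma_at_mult\<close>.\<close>

lemma coev1_central: "a \<in> Om 0 \<Longrightarrow> scal a * coev1 = coev1 * (scal a :: 'w tens)"
  by (rule rctr_ext[OF fgp])
    (simp_all add: FV_scal FV_scal_right coev1_in rctr_scal rctr_scal_right rctr_coev1 Om_intros scal_form)

section \<open>The dual braiding \<sigma> as a total map\<close>

definition sigma_at :: "('w \<Rightarrow> 'w) \<Rightarrow> 'w \<Rightarrow> 'w tens" where
  "sigma_at v \<omega> = ctr v (sinv_id (form \<omega> * coev1))"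

lemma form_FV: "\<omega> \<in> Om 1 \<Longrightarrow> c \<in> FV \<Longrightarrow> form \<omega> * c \<in> FF \<otimes>\<^sub>A vect ` Vec"
  unfolding tens_prod_assoc by (rule tens_prodI) auto

lemma FFX_FT: "t \<in> FF \<otimes>\<^sub>A Y \<Longrightarrow> t \<in> FT"
  using FT_prod[of "form ` Om 1" t "form ` Om 1 \<otimes>\<^sub>A Y"] by (simp add: tens_prod_assoc)

lemma ctr_FFX: "v \<in> Vec \<Longrightarrow> t \<in> FF \<otimes>\<^sub>A Y \<Longrightarrow> ctr v t \<in> form ` Om 1 \<otimes>\<^sub>A Y"
proof -
  assume v: "v \<in> Vec" and "t \<in> FF \<otimes>\<^sub>A Y"
  from this(2) show ?thesis
  proof (induction rule: tens_prod_induct)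
    case (mult x y)
    then show ?case
      using v ctr_mult[of x v y] ctr_FF[of v x] FF_FT[of x] by (simp add: tens_prodI)
  qed (use v in \<open>auto simp: ctr_zero ctr_add tens_prod_zero intro: tens_prod_add\<close>)
qed

lemma sigma_at_in: "v \<in> Vec \<Longrightarrow> \<omega> \<in> Om 1 \<Longrightarrow> sigma_at v \<omega> \<in> FV"
  unfolding sigma_at_def by (intro ctr_FFX sinv_id_in form_FV coev1_in)

lemma rctr_Fm_vect: "x \<in> Fm \<Longrightarrow> u \<in> Vec \<Longrightarrow> \<xi> \<in> Om 1 \<Longrightarrow> rctr \<xi> (x * vect u) = x * scal (u \<xi>)"
  by (auto simp: rctr_form_vect form_scal Vec_in)

text \<open>The adjunction between \<sigma> and \<sigma>^-1: evaluating the vector produced by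
  \<sigma> at \<xi> undoes the coevaluation and leaves \<sigma>^-1 applied to \<omega> \<otimes>
  \<xi>.\<close>

lemma rctr_sigma_at:
  assumes v: "v \<in> Vec" and \<omega>: "\<omega> \<in> Om 1" and \<xi>: "\<xi> \<in> Om 1"
  shows "rctr \<xi> (sigma_at v \<omega>) = ctr v (sinv (form \<omega> * form \<xi>))"
proof -
  \<comment> \<open>The coevaluation is replaced by an arbitrary vector-valued form, so that an
    induction over decomposable tensors is possible.\<close>
  have "rctr \<xi> (ctr v (sinv_id (form \<omega> * c))) = ctr v (sinv (form \<omega> * rctr \<xi> c))" if "c \<in> FV" for c
  proof -
    have "rctr \<xi> c \<in> Fm \<and> rctr \<xi> (ctr v (sinv_id (form \<omega> * c))) = ctr v (sinv (form \<omega> * rctr \<xi> c))"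
      using that
    proof (induction rule: tens_prod_induct)
      case zero
      then show ?case using v
        by (simp add: rctr_simps ctr_zero sinv_zero sinv_id_zero Fm_zero)
    next
      case (add x y)
      then show ?case using v \<omega>
        by (simp add: rctr_simps ctr_add sinv_add sinv_id_add Fm_add
            distrib_left tens_prodI)
    next
      case (mult x y)
      then obtain \<eta> u where [simp]: "x = form \<eta>" "y = vect u" and \<eta>: "\<eta> \<in> Om 1" and u: "u \<in> Vec"
        by blast
      have s: "sinv (form \<omega> * form \<eta>) \<in> FF"
        using \<omega> \<eta> by (simp add: sinv_in tens_prodI)
      have "rctr \<xi> (ctr v (sinv_id (form \<omega> * (x * y)))) = ctr v (sinv (form \<omega> * form \<eta>)) * scal (u \<xi>)"
        using \<omega> \<eta> u v \<xi> s
        by (simp add: sinv_id_form ctr_mult FF_FT rctr_Fm_vect ctr_FF)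
      also have "\<dots> = ctr v (sinv (form \<omega> * form \<eta>) * scal (u \<xi>))"
        using s v by (simp add: ctr_mult FF_FT)
      also have "\<dots> = ctr v (sinv (form \<omega> * form \<eta> * scal (u \<xi>)))"
        using \<omega> \<eta> u by (simp add: sinv_scal_right tens_prodI Vec_in)
      finally show ?case using \<omega> \<eta> u \<xi> by (simp add: rctr_form_vect form_scal mult.assoc Vec_in Om_intros)
    qed
    then show ?thesis ..
  qed
  then show ?thesis
    using \<xi> by (simp add: sigma_at_def coev1_in rctr_coev1)
qed

lemma sigma_at_add: "v \<in> Vec \<Longrightarrow> \<omega> \<in> Om 1 \<Longrightarrow> \<eta> \<in> Om 1 \<Longrightarrow> sigma_at v (\<omega> + \<eta>) = sigma_at v \<omega> + sigma_at v \<eta>"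
  by (simp add: sigma_at_def form_add distrib_right sinv_id_add ctr_add)

lemma sigma_at_mult:
  assumes v: "v \<in> Vec" and \<omega>: "\<omega> \<in> Om 1" and a: "a \<in> Om 0"
  shows "sigma_at v (\<omega> * a) = sigma_at v \<omega> * scal a"
proof -
  have t: "form \<omega> * coev1 \<in> FF \<otimes>\<^sub>A UNIV"
    using form_FV[OF \<omega> coev1_in] tens_prod_mono[of FF FF "vect ` Vec" UNIV] by auto
  have "form (\<omega> * a) * coev1 = (form \<omega> * coev1) * scal a"
    using \<omega> a by (simp add: form_scal[symmetric] mult.assoc coev1_central)
  then show ?thesis
    using v sinv_id_in[OF t] by (simp add: sigma_at_def sinv_id_mult[OF t] ctr_mult FFX_FT)
qed

lemma sigma_at_plus: "u \<in> Vec \<Longrightarrow> v \<in> Vec \<Longrightarrow> sigma_at (\<lambda>\<xi>. u \<xi> + v \<xi>) \<omega> = sigma_at u \<omega> + sigma_at v \<omega>"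
  by (simp add: sigma_at_def ctr_plus)

lemma sigma_at_lact: "v \<in> Vec \<Longrightarrow> a \<in> Om 0 \<Longrightarrow> sigma_at (vec_lact a v) \<omega> = scal a * sigma_at v \<omega>"
  by (simp add: sigma_at_def ctr_lact)

lemma sigma_at_ract: "v \<in> Vec \<Longrightarrow> a \<in> Om 0 \<Longrightarrow> \<omega> \<in> Om 1 \<Longrightarrow> sigma_at (vec_ract v a) \<omega> = sigma_at v (a * \<omega>)"
  by (simp add: sigma_at_def ctr_ract sinv_id_scal_mult[symmetric] scal_mult_form)

definition sigma_left :: "('w \<Rightarrow> 'w) \<Rightarrow> 'w tens \<Rightarrow> 'w tens" where
  "sigma_left v = tens_case (\<lambda>_. 0) (\<lambda>\<omega> x. sigma_at v \<omega> * x) (\<lambda>_ _. 0)"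

lemma sigma_at_bal: "v \<in> Vec \<Longrightarrow> fbal (\<lambda>\<omega> x. sigma_at v \<omega> * x)"
  by (auto simp: fbal_def additive_def distrib_left distrib_right sigma_at_add sigma_at_mult mult.assoc)

lemma additive_sigma_left: "v \<in> Vec \<Longrightarrow> additive (sigma_left v)"
  unfolding sigma_left_def by (rule additive_tens_case) (simp_all add: sigma_at_bal)

lemmas sigma_left_add = additive.add[OF additive_sigma_left] and sigma_left_zero = additive.zero[OF additive_sigma_left]

lemma sigma_left_form: "v \<in> Vec \<Longrightarrow> \<omega> \<in> Om 1 \<Longrightarrow> sigma_left v (form \<omega> * x) = sigma_at v \<omega> * x"
  unfolding sigma_left_def by (rule tens_case_form) (simp_all add: sigma_at_bal)

lemma sigma_left_vect: "v \<in> Vec \<Longrightarrow> u \<in> Vec \<Longrightarrow> sigma_left v (vect u * x) = 0"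
  unfolding sigma_left_def by (rule tens_case_vect) (simp_all add: sigma_at_bal)

lemma sigma_left_scal: "v \<in> Vec \<Longrightarrow> a \<in> Om 0 \<Longrightarrow> sigma_left v (scal a) = 0"
  unfolding sigma_left_def by (rule tens_case_scal) (simp_all add: sigma_at_bal)

lemma sigma_left_plus: "u \<in> Vec \<Longrightarrow> v \<in> Vec \<Longrightarrow> sigma_left (\<lambda>\<xi>. u \<xi> + v \<xi>) t = sigma_left u t + sigma_left v t"
  by (induction t rule: tens_induct)
    (simp_all add: vec_add_in sigma_left_add sigma_left_vect sigma_left_scal sigma_left_form sigma_at_plus distrib_right)

lemma sigma_left_lact: "v \<in> Vec \<Longrightarrow> a \<in> Om 0 \<Longrightarrow> sigma_left (vec_lact a v) t = scal a * sigma_left v t"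
  by (induction t rule: tens_induct)
    (simp_all add: vec_lact_in sigma_left_add sigma_left_vect sigma_left_scal sigma_left_form sigma_at_lact
      distrib_left mult.assoc)

lemma sigma_left_ract: "v \<in> Vec \<Longrightarrow> a \<in> Om 0 \<Longrightarrow> sigma_left (vec_ract v a) t = sigma_left v (scal a * t)"
  by (induction t rule: tens_induct)
    (simp_all add: vec_ract_in sigma_left_add sigma_left_vect sigma_left_scal sigma_left_form sigma_at_ract
      distrib_left scal_mult_form scal_mult_vect vec_lact_in scal_scal Om_intros)

lemma vbal_sigma_left: "vbal sigma_left"
  by (simp add: vbal_def additive_sigma_left sigma_left_plus sigma_left_ract)

definition sigma_op :: "'w tens \<Rightarrow> 'w tens" where
  "sigma_op = tens_case (\<lambda>_. 0) (\<lambda>_ _. 0) sigma_left"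

lemma additive_sigma_op: "additive sigma_op"
  unfolding sigma_op_def by (rule additive_tens_case) (simp_all add: vbal_sigma_left)

lemmas sigma_op_add = additive.add[OF additive_sigma_op] and sigma_op_zero = additive.zero[OF additive_sigma_op]

lemma sigma_op_vect: "v \<in> Vec \<Longrightarrow> sigma_op (vect v * y) = sigma_left v y"
  unfolding sigma_op_def by (rule tens_case_vect) (simp_all add: vbal_sigma_left)

lemma sigma_eq:
  assumes "s \<in> vect ` Vec \<otimes>\<^sub>A form ` Om 1"
  shows "sigma sinv s = sigma_op s"
proof -
  \<comment> \<open>\<open>H\<close> is the total map that extends
    \<open>id \<otimes> \<sigma>\<^sup>-\<^sup>1 \<otimes> id\<close>, the inner extension in the
    definition of \<open>sigma\<close>.\<close>
  define H where "H = tens_case (\<lambda>_. 0) (\<lambda>_ _. 0) (\<lambda>v y. vect v * sinv_id y)"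
  have bal: "vbal (\<lambda>v y. vect v * sinv_id y)"
    by (auto simp: vbal_def additive_mult_left additive_sinv_id vect_add distrib_right
        sinv_id_scal_mult vect_mult_scal)
  have H_vect: "H (vect v * y) = vect v * sinv_id y" if "v \<in> Vec" for v y
    using that unfolding H_def by (simp add: tens_case_vect bal)
  have additive_H: "additive H"
    unfolding H_def by (rule additive_tens_case) (simp_all add: bal)
  have "s * coev1 \<in> (vect ` Vec \<otimes>\<^sub>A form ` Om 1) \<otimes>\<^sub>A FV"
    using assms by (intro tens_prodI coev1_in)
  then have "s * coev1 \<in> vect ` Vec \<otimes>\<^sub>A ((\<lambda>x. x) ` FF \<otimes>\<^sub>A vect ` Vec)"
    by (simp add: tens_prod_assoc)
  then obtain ps where ps: "set ps \<subseteq> Vec \<times> FF \<times> Vec"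
    "s * coev1 = (\<Sum>(v, s, u)\<leftarrow>ps. vect v * s * vect u)"
    by (rule tens_prod_list3)
  have "H (case p of (v, s, u) \<Rightarrow> vect v * s * vect u) = (case p of (v, s, u) \<Rightarrow> vect v * sinv s * vect u)"
    if "p \<in> Vec \<times> FF \<times> Vec" for p
    using that by (auto simp: H_vect mult.assoc sinv_id_FF)
  then have "sigma sinv s = ev_id (H (s * coev1))"
    unfolding sigma_def by (subst lin_ext_hom[OF additive_H ps(1) _ ps(2)]) auto
  moreover have "H (s * coev1) \<in> vect ` Vec \<otimes>\<^sub>A FT \<and> ctr_vect (H (s * coev1)) = sigma_op s"
      using assms
    proof (induction rule: tens_prod_induct)
      case zero
      then show ?case
        by (simp add: additive.zero[OF additive_H] sigma_op_zero
            ctr_vect_zero tens_prod_zero)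
    next
      case (add x y)
      then show ?case
        by (simp add: additive.add[OF additive_H] sigma_op_add
            ctr_vect_add tens_prod_add distrib_right)
    next
      case (mult x y)
      then obtain v \<omega> where [simp]: "x = vect v" "y = form \<omega>" and v: "v \<in> Vec" and \<omega>: "\<omega> \<in> Om 1"
        by blast
      have "sinv_id (form \<omega> * coev1) \<in> FT"
        using sinv_id_in[OF form_FV[OF \<omega> coev1_in]] by (rule FFX_FT)
      then show ?case
        using v \<omega> sigma_left_form[of v \<omega> 1]
        by (simp add: mult.assoc H_vect tens_prodI ctr_vect_vect sigma_op_vect sigma_at_def)
    qed
  ultimately show ?thesis using ev_id_eq by metis
qed

lemma sigma_id_eq:
  assumes "t \<in> vect ` Vec \<otimes>\<^sub>A FT"
  shows "sigma_id sinv t = sigma_op t"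
proof -
  have "t \<in> (\<lambda>x. x) ` (vect ` Vec \<otimes>\<^sub>A form ` Om 1) \<otimes>\<^sub>A UNIV"
    using assms by (simp add: tens_prod_assoc)
  then obtain ps where ps: "set ps \<subseteq> (vect ` Vec \<otimes>\<^sub>A form ` Om 1) \<times> UNIV" "t = (\<Sum>(s, x)\<leftarrow>ps. s * x)"
    by (rule tens_prod_list)
  have "sigma_op (s * x) = sigma_op s * x" if "s \<in> vect ` Vec \<otimes>\<^sub>A form ` Om 1" for s x
    using that
  proof (induction rule: tens_prod_induct)
    case (mult y z)
    then obtain v \<omega> where "y = vect v" "z = form \<omega>" "v \<in> Vec" "\<omega> \<in> Om 1" by blast
    then show ?case using sigma_left_form[of v \<omega> 1] by (simp add: mult.assoc sigma_op_vect sigma_left_form)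
  qed (simp_all add: sigma_op_zero sigma_op_add distrib_right)
  then have "sigma_op (case p of (s, x) \<Rightarrow> s * x) = (case p of (s, x) \<Rightarrow> sigma sinv s * x)"
    if "p \<in> (vect ` Vec \<otimes>\<^sub>A form ` Om 1) \<times> UNIV" for p
    using that by (auto simp: sigma_eq)
  then show ?thesis
    unfolding sigma_id_def by (rule lin_ext_hom[OF additive_sigma_op ps(1) _ ps(2)])
qed

subsection \<open>The dual covariant derivative\<close>

text \<open>The prescribed value at \<xi> is right linear in \<xi>, because the terms
  \<open>v(\<xi>) da\<close> from the two Leibniz rules cancel. A right linear map is represented by
  its values on a dual basis, tensored with the dual vectors.\<close>

lemma sq_vec_ex:
  assumes v: "v \<in> Vec"
  shows "\<exists>t\<in>FV. \<forall>\<xi>\<in>Om 1. rctr \<xi> t = form (exd (v \<xi>)) - ctr v (sq \<xi>)"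
proof -
  define D where "D \<xi> = form (exd (v \<xi>)) - ctr v (sq \<xi>)" for \<xi>
  have D_in: "D \<xi> \<in> Fm" if "\<xi> \<in> Om 1" for \<xi>
    using v that by (simp add: D_def Fm_diff Om_intros Vec_in ctr_FF sq_in)
  have D_add: "D (\<xi> + \<eta>) = D \<xi> + D \<eta>" if "\<xi> \<in> Om 1" "\<eta> \<in> Om 1" for \<xi> \<eta>
    using v that by (simp add: D_def Vec_add Vec_in exd_add form_add Om_intros sq_add ctr_add)
  have D_mult: "D (\<xi> * a) = D \<xi> * scal a" if "\<xi> \<in> Om 1" "a \<in> Om 0" for \<xi> a
    using v that
    by (simp add: D_def Vec_mult Vec_in exd_mult_0 form_add Om_intros sq_mult ctr_add ctr_form
        left_diff_distrib scal_form form_scal ctr_mult FF_FT sq_in)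
  obtain bs :: "('w \<times> ('w \<Rightarrow> 'w)) list" where bs: "dual_basis (Om 1) Vec bs"
    using dual_basis_exists[OF fgp] by blast
  have mem: "fst p \<in> Om 1" "snd p \<in> Vec" if "p \<in> set bs" for p
    using bs that by (auto simp: dual_basis_def)
  let ?t = "\<Sum>p\<leftarrow>bs. D (fst p) * vect (snd p)"
  have "rctr \<xi> ?t = D \<xi>" if \<xi>: "\<xi> \<in> Om 1" for \<xi>
  proof -
    have "rctr \<xi> ?t = (\<Sum>p\<leftarrow>bs. D (fst p * snd p \<xi>))"
      unfolding additive_sum_list[OF additive_rctr]
      by (rule sum_list_cong) (use mem \<xi> D_in in \<open>auto simp: rctr_Fm_vect D_mult Vec_in\<close>)
    also have "\<dots> = D (\<Sum>p\<leftarrow>bs. fst p * snd p \<xi>)"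
    proof -
      have "(\<Sum>p\<leftarrow>ps. fst p * snd p \<xi>) \<in> Om 1 \<and> (\<Sum>p\<leftarrow>ps. D (fst p * snd p \<xi>)) = D (\<Sum>p\<leftarrow>ps. fst p * snd p \<xi>)"
        if "set ps \<subseteq> set bs" for ps
        using that
      proof (induction ps)
        case Nil
        then show ?case using D_add[of 0 0] by (simp add: Om_zero)
      next
        case (Cons p ps)
        then show ?case using mem[of p] by (simp add: D_add Om_intros Vec_in)
      qed
      then show ?thesis by blast
    qed
    also have "(\<Sum>p\<leftarrow>bs. fst p * snd p \<xi>) = \<xi>"
      using bs \<xi> by (simp add: dual_basis_def split_def)
    finally show ?thesis .
  qed
  moreover have "?t \<in> FV"
    by (rule tens_prod_sum_list) (use mem D_in in \<open>auto intro: tens_prodI\<close>)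
  ultimately show ?thesis unfolding D_def by blast
qed

lemma sq_vec_in: "v \<in> Vec \<Longrightarrow> sq_vec sq v \<in> FV"
  and rctr_sq_vec: "v \<in> Vec \<Longrightarrow> \<xi> \<in> Om 1 \<Longrightarrow> rctr \<xi> (sq_vec sq v) = form (exd (v \<xi>)) - ctr v (sq \<xi>)"
proof -
  assume v: "v \<in> Vec"
  obtain t where t: "t \<in> FV" "\<forall>\<xi>\<in>Om 1. rctr \<xi> t = form (exd (v \<xi>)) - ctr v (sq \<xi>)"
    using sq_vec_ex[OF v] by blast
  have iff: "form (exd (v \<xi>)) = id_ev (s * form \<xi>) + ev_id (vect v * sq \<xi>) \<longleftrightarrow>
      rctr \<xi> s = form (exd (v \<xi>)) - ctr v (sq \<xi>)" if "s \<in> FV" "\<xi> \<in> Om 1" for s \<xi>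
    unfolding id_ev_eq[OF that] ev_id_vect[OF v FF_FT[OF sq_in[OF that(2)]]] by (auto simp: algebra_simps)
  have "sq_vec sq v = t"
    unfolding sq_vec_def
  proof (rule the_equality)
    show "t \<in> FV \<and> (\<forall>\<xi>\<in>Om 1. form (exd (v \<xi>)) = id_ev (t * form \<xi>) + ev_id (vect v * sq \<xi>))"
      using t iff by blast
    show "s = t" if s: "s \<in> FV \<and> (\<forall>\<xi>\<in>Om 1. form (exd (v \<xi>)) = id_ev (s * form \<xi>) + ev_id (vect v * sq \<xi>))" for s
    proof (rule rctr_ext[OF fgp])
      show "rctr \<xi> s = rctr \<xi> t" if "\<xi> \<in> Om 1" for \<xi>
        using s iff[of s \<xi>] t that by metis
    qed (use s t in blast)+
  qed
  then show "sq_vec sq v \<in> FV" "\<xi> \<in> Om 1 \<Longrightarrow> rctr \<xi> (sq_vec sq v) = form (exd (v \<xi>)) - ctr v (sq \<xi>)"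
    using t by auto
qed

lemma sq_vec_plus: "u \<in> Vec \<Longrightarrow> v \<in> Vec \<Longrightarrow> sq_vec sq (\<lambda>\<xi>. u \<xi> + v \<xi>) = sq_vec sq u + sq_vec sq v"
  by (rule rctr_ext[OF fgp])
    (simp_all add: sq_vec_in vec_add_in tens_prod_add rctr_simps rctr_sq_vec exd_add form_add
      Om_intros Vec_in ctr_plus)

lemma sq_vec_lact:
  "v \<in> Vec \<Longrightarrow> a \<in> Om 0 \<Longrightarrow> sq_vec sq (vec_lact a v) = form (exd a) * vect v + scal a * sq_vec sq v"
  by (rule rctr_ext[OF fgp])
    (simp_all add: sq_vec_in vec_lact_in tens_prod_add tens_prodI FV_scal rctr_simps rctr_sq_vec rctr_scal vec_lact_apply
      exd_mult_0 form_add Om_intros Vec_in ctr_lact right_diff_distrib scal_form)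

text \<open>Evaluated at \<xi>, this is the left Leibniz rule of \<box> on forms, with the
  \<sigma>^-1 term turned into \<sigma> by \<open>rctr_sigma_at\<close>. It is the reason for the
  formula that defines \<sigma>.\<close>

lemma sq_vec_ract:
  "v \<in> Vec \<Longrightarrow> a \<in> Om 0 \<Longrightarrow> sq_vec sq (vec_ract v a) = sq_vec sq v * scal a + sigma_at v (exd a)"
  by (rule rctr_ext[OF fgp])
    (simp_all add: sq_vec_in vec_ract_in tens_prod_add FV_scal_right sigma_at_in rctr_simps rctr_sq_vec
      rctr_scal_right rctr_sigma_at vec_ract_apply Om_intros ctr_ract sq_lmult ctr_add)

end

subsection \<open>Degree components\<close>

text \<open>Projects onto the words of exactly \<open>n\<close> vectors, passing each vector through
  \<open>p\<close>; words with a form are sent to 0. With the identity for \<open>p\<close> it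
  computes \<open>vcomp\<close>, and with a retraction it lands in the tensor powers of its
  image.\<close>

primrec gr :: "(('w::star_dga \<Rightarrow> 'w) \<Rightarrow> 'w \<Rightarrow> 'w) \<Rightarrow> nat \<Rightarrow> 'w tens \<Rightarrow> 'w tens" where
  "gr p 0 = tens_case scal (\<lambda>_ _. 0) (\<lambda>_ _. 0)"
| "gr p (Suc n) = tens_case (\<lambda>_. 0) (\<lambda>_ _. 0) (\<lambda>v x. vect (p v) * gr p n x)"

abbreviation "vgr \<equiv> gr (\<lambda>v. v)"

text \<open>\<open>p\<close> is a retraction of bimodules from \<open>Vec\<close> onto
  \<open>V\<close>. The instances are \<open>Vec\<close> with the identity and
  \<open>Vec10 J\<close> with composition with the (1,0)-projection. The retraction is what allows
  maps on powers of \<open>V\<close> to be defined on the whole tensor algebra.\<close>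

locale vec_proj =
  fixes V :: "('w::star_dga \<Rightarrow> 'w) set" and p :: "('w \<Rightarrow> 'w) \<Rightarrow> 'w \<Rightarrow> 'w"
  assumes V_sub: "V \<subseteq> Vec"
    and p_in: "v \<in> Vec \<Longrightarrow> p v \<in> V"
    and p_id: "v \<in> V \<Longrightarrow> p v = v"
    and p_plus: "u \<in> Vec \<Longrightarrow> v \<in> Vec \<Longrightarrow> p (\<lambda>\<xi>. u \<xi> + v \<xi>) = (\<lambda>\<xi>. p u \<xi> + p v \<xi>)"
    and p_lact: "v \<in> Vec \<Longrightarrow> a \<in> Om 0 \<Longrightarrow> p (vec_lact a v) = vec_lact a (p v)"
    and p_ract: "v \<in> Vec \<Longrightarrow> a \<in> Om 0 \<Longrightarrow> p (vec_ract v a) = vec_ract (p v) a"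
begin

abbreviation "W \<equiv> vect ` V"

lemma V_Vec: "v \<in> V \<Longrightarrow> v \<in> Vec"
  using V_sub by blast

lemma p_Vec: "v \<in> Vec \<Longrightarrow> p v \<in> Vec"
  using p_in V_Vec by blast

lemma V_plus: "u \<in> V \<Longrightarrow> v \<in> V \<Longrightarrow> (\<lambda>\<xi>. u \<xi> + v \<xi>) \<in> V"
  using p_in[OF vec_add_in] p_plus[of u v] p_id V_Vec by metis

lemma V_lact: "v \<in> V \<Longrightarrow> a \<in> Om 0 \<Longrightarrow> vec_lact a v \<in> V"
  using p_in[OF vec_lact_in] p_lact[of v a] p_id V_Vec by metis

lemma V_ract: "v \<in> V \<Longrightarrow> a \<in> Om 0 \<Longrightarrow> vec_ract v a \<in> V"
  using p_in[OF vec_ract_in] p_ract[of v a] p_id V_Vec by metis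

lemma W_add: "x \<in> W \<Longrightarrow> y \<in> W \<Longrightarrow> x + y \<in> W"
  using V_plus by (auto simp: vect_add[symmetric] V_Vec)

lemma W_scal: "x \<in> W \<Longrightarrow> a \<in> Om 0 \<Longrightarrow> scal a * x \<in> W"
  by (auto simp: scal_vect V_Vec V_lact)

lemma W_scal_right: "x \<in> W \<Longrightarrow> a \<in> Om 0 \<Longrightarrow> x * scal a \<in> W"
  by (auto simp: vect_scal V_Vec V_ract)

lemma gr_bal_aux:
  assumes "additive (gr p n)" "\<And>a x. a \<in> Om 0 \<Longrightarrow> gr p n (scal a * x) = scal a * gr p n x"
  shows "vbal (\<lambda>v x. vect (p v) * gr p n x)"
  using assms by (auto simp: vbal_def additive_mult_left p_plus vect_add p_Vec distrib_right
      p_ract vect_mult_scal)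

lemma gr_additive_scal: "additive (gr p n) \<and> (\<forall>a\<in>Om 0. \<forall>x. gr p n (scal a * x) = scal a * gr p n x)"
proof (induction n)
  case 0
  have ad: "additive (gr p 0)"
    by (simp add: additive_tens_case)
  have "gr p 0 (scal a * x) = scal a * gr p 0 x" if "a \<in> Om 0" for a x
    by (induction x rule: tens_induct)
      (use that additive.add[OF ad] in \<open>simp_all add: distrib_left scal_scal tens_case_scal tens_case_form tens_case_vect
        scal_mult_form scal_mult_vect Om_intros vec_lact_in\<close>)
  then show ?case using ad by blast
next
  case (Suc n)
  have bal: "vbal (\<lambda>v x. vect (p v) * gr p n x)"
    using Suc by (intro gr_bal_aux) blast+
  have ad: "additive (gr p (Suc n))"
    by (simp add: additive_tens_case bal)
  have "gr p (Suc n) (scal a * x) = scal a * gr p (Suc n) x" if "a \<in> Om 0" for a x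
    by (induction x rule: tens_induct)
      (use that additive.add[OF ad] bal in \<open>simp_all add: distrib_left scal_scal tens_case_scal tens_case_form tens_case_vect
        scal_mult_form scal_mult_vect Om_intros vec_lact_in p_lact p_Vec\<close>)
  then show ?case using ad by blast
qed

lemma additive_gr: "additive (gr p n)" and gr_scal_mult: "a \<in> Om 0 \<Longrightarrow> gr p n (scal a * x) = scal a * gr p n x"
  using gr_additive_scal by blast+

lemmas gr_bal = gr_bal_aux[OF additive_gr gr_scal_mult]
  and gr_add = additive.add[OF additive_gr] and gr_zero = additive.zero[OF additive_gr]

lemma gr_scal: "a \<in> Om 0 \<Longrightarrow> gr p n (scal a) = (if n = 0 then scal a else 0)"
  by (cases n) (simp_all add: tens_case_scal gr_bal)

lemma gr_form: "\<xi> \<in> Om 1 \<Longrightarrow> gr p n (form \<xi> * x) = 0"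
  by (cases n) (simp_all add: tens_case_form gr_bal)

lemma gr_vect: "v \<in> Vec \<Longrightarrow> gr p n (vect v * x) = (case n of 0 \<Rightarrow> 0 | Suc m \<Rightarrow> vect (p v) * gr p m x)"
  by (cases n) (simp_all add: tens_case_vect gr_bal)

declare gr.simps [simp del]

lemma pow_zero: "0 \<in> tens_pow W n"
  by (cases n) (auto simp: tens_prod_zero Om_zero intro!: image_eqI[of _ _ 0])

lemma pow_add: "x \<in> tens_pow W n \<Longrightarrow> y \<in> tens_pow W n \<Longrightarrow> x + y \<in> tens_pow W n"
  by (cases n) (auto simp: tens_prod_add scal_add[symmetric] Om_intros)

lemma pow_scal: "x \<in> tens_pow W n \<Longrightarrow> a \<in> Om 0 \<Longrightarrow> scal a * x \<in> tens_pow W n"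
  by (cases n) (auto simp: scal_scal Om_intros intro: tens_prod_left W_scal)

lemma gr_in: "gr p n x \<in> tens_pow W n"
proof (induction x arbitrary: n rule: tens_induct)
  case (vect v x)
  then show ?case using pow_zero[of 0] by (cases n) (auto simp: gr_vect p_in intro: tens_prodI)
qed (auto simp: gr_add gr_scal gr_form pow_zero pow_add)

text \<open>Makes the sum of the tensor powers direct, so that components of elements of
  \<open>tens_pow_le\<close> can be read off by \<open>gr\<close>.\<close>

lemma gr_pow: "x \<in> tens_pow W n \<Longrightarrow> gr p m x = (if m = n then x else 0)"
proof (induction n arbitrary: x m)
  case 0
  then show ?case by (auto simp: gr_scal)
next
  case (Suc n)
  then have "x \<in> W \<otimes>\<^sub>A tens_pow W n" by simp
  then show ?case
  proof (induction rule: tens_prod_induct)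
    case (mult x y)
    then show ?case using Suc.IH by (cases m) (auto simp: gr_vect V_Vec p_id)
  qed (auto simp: gr_add gr_zero)
qed

lemma pow_induct [consumes 1, case_names zero add mult]:
  assumes "x \<in> tens_pow W (Suc n)" "P 0" "\<And>x y. P x \<Longrightarrow> P y \<Longrightarrow> P (x + y)"
    "\<And>u y. u \<in> V \<Longrightarrow> y \<in> tens_pow W n \<Longrightarrow> P (vect u * y)"
  shows "P x"
proof -
  have "x \<in> W \<otimes>\<^sub>A tens_pow W n" using assms(1) by simp
  then show ?thesis by (induction rule: tens_prod_induct) (use assms in auto)
qed

lemma pow_vect: "v \<in> V \<Longrightarrow> vect v \<in> tens_pow W 1"
  using tens_prodI[of "vect v" W "scal 1" "scal ` Om 0"] imageI[OF Om_one, of scal]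
  by (auto simp: One_nat_def)

lemma pow_le_iff: "x \<in> tens_pow_le W n \<longleftrightarrow> x = (\<Sum>m\<le>n. gr p m x)"
proof
  assume "x \<in> tens_pow_le W n"
  then obtain f where f: "x = (\<Sum>m\<le>n. f m)" "\<forall>m\<le>n. f m \<in> tens_pow W m"
    by (auto simp: tens_pow_le_def)
  have "gr p k x = f k" if "k \<le> n" for k
  proof -
    have "gr p k x = (\<Sum>m\<le>n. gr p k (f m))"
      unfolding f(1) by (rule additive.sum[OF additive_gr])
    also have "\<dots> = (\<Sum>m\<le>n. if m = k then f m else 0)"
      by (rule sum.cong) (use f(2) gr_pow in auto)
    finally show ?thesis using that by simp
  qed
  then show "x = (\<Sum>m\<le>n. gr p m x)" using f(1) by simp
next
  assume "x = (\<Sum>m\<le>n. gr p m x)"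
  then show "x \<in> tens_pow_le W n" using gr_in unfolding tens_pow_le_def by blast
qed

lemma gr_pow_le:
  assumes x: "x \<in> tens_pow_le W n" and m: "m > n"
  shows "gr p m x = 0"
proof -
  have "gr p m x = gr p m (\<Sum>k\<le>n. gr p k x)"
    using x unfolding pow_le_iff by simp
  also have "\<dots> = (\<Sum>k\<le>n. gr p m (gr p k x))"
    by (rule additive.sum[OF additive_gr])
  also have "\<dots> = 0"
    by (rule sum.neutral) (use m gr_pow[OF gr_in] in auto)
  finally show ?thesis .
qed

lemma pow_le_zero: "0 \<in> tens_pow_le W n"
  by (simp add: pow_le_iff gr_zero)

lemma pow_le_add: "x \<in> tens_pow_le W n \<Longrightarrow> y \<in> tens_pow_le W n \<Longrightarrow> x + y \<in> tens_pow_le W n"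
  by (simp add: pow_le_iff gr_add sum.distrib)

lemma pow_le_scal: "x \<in> tens_pow_le W n \<Longrightarrow> a \<in> Om 0 \<Longrightarrow> scal a * x \<in> tens_pow_le W n"
  by (simp add: pow_le_iff gr_scal_mult sum_distrib_left[symmetric])

lemma pow_le_uminus: "x \<in> tens_pow_le W n \<Longrightarrow> - x \<in> tens_pow_le W n"
  using pow_le_scal[of x n "- 1"] by (simp add: Om_intros scal_uminus)

lemma pow_in_le: "x \<in> tens_pow W m \<Longrightarrow> m \<le> n \<Longrightarrow> x \<in> tens_pow_le W n"
  by (simp add: pow_le_iff gr_pow)

lemma pow_le_mono: "m \<le> n \<Longrightarrow> tens_pow_le W m \<subseteq> tens_pow_le W n"
proof
  fix x assume mn: "m \<le> n" and x: "x \<in> tens_pow_le W m"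
  have "(\<Sum>k\<le>n. gr p k x) = (\<Sum>k\<le>m. gr p k x)"
    by (rule sum.mono_neutral_right) (use mn gr_pow_le[OF x] in auto)
  then show "x \<in> tens_pow_le W n" using x by (simp add: pow_le_iff)
qed

lemma pow_le_induct [consumes 1, case_names add pow]:
  assumes x: "x \<in> tens_pow_le W n" and add: "\<And>x y. P x \<Longrightarrow> P y \<Longrightarrow> P (x + y)"
    and pow: "\<And>m x. m \<le> n \<Longrightarrow> x \<in> tens_pow W m \<Longrightarrow> P x"
  shows "P x"
proof -
  have "P (\<Sum>k\<le>m. gr p k x)" if "m \<le> n" for m
    using that by (induction m) (auto intro: add pow gr_in)
  then show ?thesis using x by (metis order_refl pow_le_iff)
qed

lemma pow_le_vect: "u \<in> V \<Longrightarrow> x \<in> tens_pow_le W n \<Longrightarrow> vect u * x \<in> tens_pow_le W (Suc n)"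
proof -
  assume u: "u \<in> V"
  assume "x \<in> tens_pow_le W n"
  then show ?thesis
  proof (induction rule: pow_le_induct)
    case (pow m x)
    then show ?case using u by (intro pow_in_le[of _ "Suc m"]) (auto intro: tens_prodI)
  qed (simp add: distrib_left pow_le_add)
qed

lemma ctr_pow: "v \<in> Vec \<Longrightarrow> t \<in> Fm \<otimes>\<^sub>A tens_pow W n \<Longrightarrow> ctr v t \<in> tens_pow W n"
proof -
  assume v: "v \<in> Vec" and "t \<in> Fm \<otimes>\<^sub>A tens_pow W n"
  from this(2) show ?thesis
    by (induction rule: tens_prod_induct)
      (use v in \<open>auto simp: ctr_zero ctr_add ctr_form pow_zero pow_add pow_scal Vec_in\<close>)
qed

lemma ctr_pow_le: "v \<in> Vec \<Longrightarrow> t \<in> Fm \<otimes>\<^sub>A tens_pow_le W n \<Longrightarrow> ctr v t \<in> tens_pow_le W n"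
proof -
  assume v: "v \<in> Vec" and "t \<in> Fm \<otimes>\<^sub>A tens_pow_le W n"
  from this(2) show ?thesis
    by (induction rule: tens_prod_induct)
      (use v in \<open>auto simp: ctr_zero ctr_add ctr_form pow_le_zero pow_le_add pow_le_scal Vec_in\<close>)
qed

end

section \<open>All vector fields: \<open>TVec\<close> and its degree components\<close>

interpretation full: vec_proj Vec "\<lambda>v. v"
  by standard auto

abbreviation "VecT \<equiv> vect ` Vec"

lemma TVecE:
  assumes "x \<in> TVec" obtains n where "x \<in> tens_pow_le VecT n"
  using assms by (auto simp: TVec_def)

lemma TVecI: "x \<in> tens_pow_le VecT n \<Longrightarrow> x \<in> TVec"
  by (auto simp: TVec_def)

lemma TVecE2:
  assumes "x \<in> TVec" "y \<in> TVec"
  obtains n where "x \<in> tens_pow_le VecT n" "y \<in> tens_pow_le VecT n"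
proof -
  obtain m n where "x \<in> tens_pow_le VecT m" "y \<in> tens_pow_le VecT n"
    using assms by (auto simp: TVec_def)
  then show ?thesis
    using that[of "max m n"] full.pow_le_mono[of m "max m n"] full.pow_le_mono[of n "max m n"] by auto
qed

lemma TVec_add: "x \<in> TVec \<Longrightarrow> y \<in> TVec \<Longrightarrow> x + y \<in> TVec"
  by (erule (1) TVecE2) (auto intro: full.pow_le_add TVecI)

lemma TVec_zero: "0 \<in> TVec"
  by (rule TVecI[OF full.pow_le_zero[of 0]])

lemma TVec_scal: "x \<in> TVec \<Longrightarrow> a \<in> Om 0 \<Longrightarrow> scal a * x \<in> TVec"
  by (erule TVecE) (auto intro: full.pow_le_scal TVecI)

lemma TVec_uminus: "x \<in> TVec \<Longrightarrow> - x \<in> TVec"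
  by (erule TVecE) (auto intro: full.pow_le_uminus TVecI)

lemma finite_gr: "x \<in> TVec \<Longrightarrow> finite {m. vgr m x \<noteq> 0}"
proof (erule TVecE)
  fix n assume "x \<in> tens_pow_le VecT n"
  then have "{m. vgr m x \<noteq> 0} \<subseteq> {..n}"
    using full.gr_pow_le not_less by blast
  then show ?thesis by (rule finite_subset) simp
qed

lemma vcomp_eq: "x \<in> TVec \<Longrightarrow> vcomp m x = vgr m x"
proof -
  assume x: "x \<in> TVec"
  then obtain n where n: "x \<in> tens_pow_le VecT n" by (rule TVecE)
  show ?thesis
    unfolding vcomp_def
  proof (rule the_equality)
    have "x = (\<Sum>k\<le>n. vgr k x)"
      using n full.pow_le_iff by blast
    also have "\<dots> = (\<Sum>k | vgr k x \<noteq> 0. vgr k x)"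
      by (rule sum.mono_neutral_right) (use full.gr_pow_le[OF n] in \<open>auto simp: not_less[symmetric]\<close>)
    finally show "\<exists>f. (\<forall>k. f k \<in> tens_pow VecT k) \<and> finite {k. f k \<noteq> 0} \<and>
        x = (\<Sum>k | f k \<noteq> 0. f k) \<and> vgr m x = f m"
      using full.gr_in finite_gr[OF x] by (intro exI[of _ "\<lambda>k. vgr k x"]) blast
    fix y assume "\<exists>f. (\<forall>k. f k \<in> tens_pow VecT k) \<and> finite {k. f k \<noteq> 0} \<and>
        x = (\<Sum>k | f k \<noteq> 0. f k) \<and> y = f m"
    then obtain f where f: "\<forall>k. f k \<in> tens_pow VecT k" "finite {k. f k \<noteq> 0}"
        "x = (\<Sum>k | f k \<noteq> 0. f k)" "y = f m" by blast
    have "vgr m x = (\<Sum>k | f k \<noteq> 0. vgr m (f k))"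
      unfolding f(3) by (rule additive.sum[OF full.additive_gr])
    also have "\<dots> = (\<Sum>k | f k \<noteq> 0. if k = m then f k else 0)"
      by (rule sum.cong) (simp_all add: full.gr_pow[OF f(1)[rule_format]])
    also have "\<dots> = f m"
      using f(2) by (simp add: sum.delta')
    finally show "y = vgr m x" using f(4) by simp
  qed
qed

context bimod_conn
begin

subsection \<open>Extension to tensor powers\<close>

text \<open>The component \<open>vgr n x\<close> stands in place of \<open>x\<close> so that the two
  summands stay jointly balanced for every \<open>x\<close> of the tensor algebra, not only for
  those of degree \<open>n\<close>.\<close>

primrec sq_deg :: "nat \<Rightarrow> 'w tens \<Rightarrow> 'w tens" where
  "sq_deg 0 = tens_case (\<lambda>a. form (exd a)) (\<lambda>_ _. 0) (\<lambda>_ _. 0)"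
| "sq_deg (Suc n) = tens_case (\<lambda>_. 0) (\<lambda>_ _. 0) (\<lambda>u x. sq_vec sq u * vgr n x + sigma_left u (sq_deg n x))"

lemma dform_bal: "additive_on (Om 0) (\<lambda>a. form (exd a) :: 'w tens)"
  by (auto simp: additive_on_def exd_add form_add Om_intros)

text \<open>Neither summand is balanced alone: when a scalar \<open>a\<close> crosses the tensor
  sign, the first produces \<sigma>(v \<otimes> da) from \<open>sq_vec_ract\<close>, and the second
  produces the same term from the Leibniz rule of the inner derivative.\<close>

lemma sq_deg_bal_aux:
  assumes add: "additive (sq_deg n)"
    and scal: "\<And>a x. a \<in> Om 0 \<Longrightarrow> sq_deg n (scal a * x) = form (exd a) * vgr n x + scal a * sq_deg n x"
  shows "vbal (\<lambda>u x. sq_vec sq u * vgr n x + sigma_left u (sq_deg n x))"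
proof -
  have "sq_vec sq (vec_ract v a) * vgr n x + sigma_left (vec_ract v a) (sq_deg n x) =
      sq_vec sq v * vgr n (scal a * x) + sigma_left v (sq_deg n (scal a * x))"
    if "v \<in> Vec" "a \<in> Om 0" for v a x
    using that
    by (simp add: sq_vec_ract sigma_left_ract full.gr_scal_mult sigma_left_add sigma_left_form
        scal Om_intros distrib_right mult.assoc)
  then show ?thesis
    by (simp add: vbal_def additive_def distrib_left full.gr_add additive.add[OF add] sigma_left_add
      sq_vec_plus sigma_left_plus distrib_right)
qed

lemma sq_deg_additive_scal:
  "additive (sq_deg n) \<and> (\<forall>a\<in>Om 0. \<forall>x. sq_deg n (scal a * x) = form (exd a) * vgr n x + scal a * sq_deg n x)"
proof (induction n)
  case 0
  have ad: "additive (sq_deg 0)"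
    by (simp add: additive_tens_case dform_bal)
  have "sq_deg 0 (scal a * x) = form (exd a) * vgr 0 x + scal a * sq_deg 0 x" if a: "a \<in> Om 0" for a x
  proof (induction x rule: tens_induct)
    case (scal b)
    then show ?case using a
      by (simp add: scal_scal tens_case_scal dform_bal Om_intros full.gr_scal exd_mult_0 form_add
          form_scal scal_form)
  qed (use a additive.add[OF ad] in \<open>simp_all add: distrib_left tens_case_form tens_case_vect
        scal_mult_form scal_mult_vect Om_intros vec_lact_in dform_bal full.gr_form full.gr_vect full.gr_add\<close>)
  then show ?case using ad by blast
next
  case (Suc n)
  then have bal: "vbal (\<lambda>u x. sq_vec sq u * vgr n x + sigma_left u (sq_deg n x))"
    by (intro sq_deg_bal_aux) blast+
  have ad: "additive (sq_deg (Suc n))"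
    by (simp add: additive_tens_case bal)
  have "sq_deg (Suc n) (scal a * x) = form (exd a) * vgr (Suc n) x + scal a * sq_deg (Suc n) x"
    if a: "a \<in> Om 0" for a x
  proof (induction x rule: tens_induct)
    case (vect v x)
    then show ?case using a
      by (simp add: scal_mult_vect tens_case_vect bal vec_lact_in full.gr_vect sq_vec_lact sigma_left_lact
          distrib_left distrib_right mult.assoc)
  qed (use a additive.add[OF ad] bal in \<open>simp_all add: distrib_left tens_case_form tens_case_scal scal_scal
        scal_mult_form Om_intros full.gr_form full.gr_scal full.gr_add\<close>)
  then show ?case using ad by blast
qed

lemma additive_sq_deg: "additive (sq_deg n)"
  and sq_deg_scal_mult: "a \<in> Om 0 \<Longrightarrow> sq_deg n (scal a * x) = form (exd a) * vgr n x + scal a * sq_deg n x"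
  using sq_deg_additive_scal by blast+

lemmas sq_deg_bal = sq_deg_bal_aux[OF additive_sq_deg sq_deg_scal_mult]
  and sq_deg_add = additive.add[OF additive_sq_deg] and sq_deg_zero = additive.zero[OF additive_sq_deg]

lemma sq_deg_0_scal: "a \<in> Om 0 \<Longrightarrow> sq_deg 0 (scal a) = form (exd a)"
  by (simp add: tens_case_scal dform_bal)

lemma sq_deg_Suc_vect: "u \<in> Vec \<Longrightarrow> sq_deg (Suc n) (vect u * x) = sq_vec sq u * vgr n x + sigma_left u (sq_deg n x)"
  by (simp add: tens_case_vect sq_deg_bal)

declare sq_deg.simps [simp del]

end

text \<open>The two assumptions make the tensor powers of \<open>V\<close> stable under the
  derivative, hence closed under \<bullet>. For \<open>Vec10 J\<close> they are consequences of
  (b).\<close>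

locale vec_sub = bimod_conn sq sinv + vec_proj V p
  for sq :: "'w::star_dga \<Rightarrow> 'w tens" and sinv :: "'w tens \<Rightarrow> 'w tens"
    and V :: "('w \<Rightarrow> 'w) set" and p :: "('w \<Rightarrow> 'w) \<Rightarrow> 'w \<Rightarrow> 'w" +
  assumes sq_vec_V: "v \<in> V \<Longrightarrow> sq_vec sq v \<in> form ` Om 1 \<otimes>\<^sub>A vect ` V"
    and sigma_at_V: "v \<in> V \<Longrightarrow> \<omega> \<in> Om 1 \<Longrightarrow> sigma_at v \<omega> \<in> form ` Om 1 \<otimes>\<^sub>A vect ` V"
begin

lemma pow_full: "tens_pow W n \<subseteq> tens_pow VecT n"
  by (induction n) (use V_sub in \<open>simp_all add: tens_prod_mono image_mono\<close>)

lemma gr_id_pow: "x \<in> tens_pow W n \<Longrightarrow> vgr m x = (if m = n then x else 0)"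
  using pow_full full.gr_pow by blast

lemma pow_le_full: "tens_pow_le W n \<subseteq> tens_pow_le VecT n"
proof
  fix x assume "x \<in> tens_pow_le W n"
  then show "x \<in> tens_pow_le VecT n"
  proof (induction rule: pow_le_induct)
    case (pow m x)
    then show ?case using pow_full full.pow_in_le by blast
  qed (rule full.pow_le_add)
qed

lemma pow_le_TVec: "x \<in> tens_pow_le W n \<Longrightarrow> x \<in> TVec"
  using pow_le_full TVecI by blast

lemma FW_prod: "t \<in> Fm \<otimes>\<^sub>A W \<Longrightarrow> y \<in> tens_pow W n \<Longrightarrow> t * y \<in> Fm \<otimes>\<^sub>A tens_pow W (Suc n)"
  using tens_prodI[of t "Fm \<otimes>\<^sub>A W" y "tens_pow W n"] by (simp add: tens_prod_assoc)

lemma sq_deg_in: "x \<in> tens_pow W n \<Longrightarrow> sq_deg n x \<in> Fm \<otimes>\<^sub>A tens_pow W n"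
proof (induction n arbitrary: x)
  case 0
  then obtain a where a: "x = scal a" "a \<in> Om 0" by auto
  have "form (exd a) * scal 1 \<in> Fm \<otimes>\<^sub>A scal ` Om 0"
    using a by (intro tens_prodI imageI Om_intros)
  then show ?case using a by (simp add: sq_deg_0_scal)
next
  case (Suc n)
  from Suc.prems show ?case
  proof (induction rule: pow_induct)
    case (mult u y)
    have "sigma_left u t \<in> Fm \<otimes>\<^sub>A tens_pow W (Suc n)" if "t \<in> Fm \<otimes>\<^sub>A tens_pow W n" for t
      using that
    proof (induction rule: tens_prod_induct)
      case (mult x z)
      then obtain \<omega> where "x = form \<omega>" "\<omega> \<in> Om 1" by blast
      then show ?case using \<open>u \<in> V\<close> mult by (simp add: sigma_left_form V_Vec FW_prod sigma_at_V del: tens_pow.simps)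
    qed (use \<open>u \<in> V\<close> in \<open>auto simp: sigma_left_add sigma_left_zero V_Vec tens_prod_zero
      simp del: tens_pow.simps intro: tens_prod_add\<close>)
    then show ?case using mult Suc.IH[of y]
      by (simp add: sq_deg_Suc_vect V_Vec gr_id_pow tens_prod_add FW_prod sq_vec_V del: tens_pow.simps)
  qed (auto simp: sq_deg_add sq_deg_zero tens_prod_zero simp del: tens_pow.simps intro: tens_prod_add)
qed

end

context bimod_conn
begin

sublocale full: vec_sub sq sinv Vec "\<lambda>v. v"
  by unfold_locales (auto simp: sq_vec_in sigma_at_in)

lemma sq_pow_eq: "x \<in> tens_pow VecT n \<Longrightarrow> sq_pow sq sinv n x = sq_deg n x"
proof (induction n arbitrary: x)
  case 0
  then obtain a where a: "x = scal a" "a \<in> Om 0" by auto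
  show ?case
    unfolding sq_pow.simps
    by (rule lin_ext_hom[where ps = "[a]", OF additive_sq_deg]) (use a in \<open>auto simp: sq_deg_0_scal\<close>)
next
  case (Suc n)
  then have "x \<in> vect ` Vec \<otimes>\<^sub>A tens_pow VecT n" by simp
  then obtain ps where ps: "set ps \<subseteq> Vec \<times> tens_pow VecT n" "x = (\<Sum>(u, w)\<leftarrow>ps. vect u * w)"
    by (rule tens_prod_list)
  have "sq_deg (Suc n) (case q of (u, w) \<Rightarrow> vect u * w) =
      (case q of (u, w) \<Rightarrow> sq_vec sq u * w + sigma_id sinv (vect u * sq_pow sq sinv n w))"
    if q: "q \<in> Vec \<times> tens_pow VecT n" for q
  proof -
    obtain u w where [simp]: "q = (u, w)" and u: "u \<in> Vec" and w: "w \<in> tens_pow VecT n"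
      using q by blast
    have "sq_deg n w \<in> FT"
      by (rule FT_prod[OF order_refl full.sq_deg_in[OF w]])
    then show ?thesis
      using u w Suc.IH[OF w] by (simp add: sq_deg_Suc_vect full.gr_pow sigma_id_eq tens_prodI sigma_op_vect)
  qed
  then show ?case
    unfolding sq_pow.simps by (rule lin_ext_hom[OF additive_sq_deg ps(1) _ ps(2)])
qed

section \<open>The product on tensor powers\<close>

definition sq_all :: "'w tens \<Rightarrow> 'w tens" where
  "sq_all w = (\<Sum>m | vgr m w \<noteq> 0. sq_deg m (vgr m w))"

lemma sq_all_bound: "w \<in> tens_pow_le VecT n \<Longrightarrow> sq_all w = (\<Sum>m\<le>n. sq_deg m (vgr m w))"
  unfolding sq_all_def
  by (rule sum.mono_neutral_left) (use full.gr_pow_le in \<open>force simp: sq_deg_zero not_less[symmetric]\<close>)+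

lemma sq_all_add: "x \<in> TVec \<Longrightarrow> y \<in> TVec \<Longrightarrow> sq_all (x + y) = sq_all x + sq_all y"
proof (erule (1) TVecE2)
  fix n assume "x \<in> tens_pow_le VecT n" "y \<in> tens_pow_le VecT n"
  then show ?thesis
    using full.pow_le_add[of x n y] by (simp add: sq_all_bound[of _ n] full.gr_add sq_deg_add sum.distrib)
qed

lemma sq_all_scal: "x \<in> TVec \<Longrightarrow> a \<in> Om 0 \<Longrightarrow> sq_all (scal a * x) = form (exd a) * x + scal a * sq_all x"
proof (erule TVecE)
  fix n assume n: "x \<in> tens_pow_le VecT n" and a: "a \<in> Om 0"
  have "sq_all (scal a * x) = (\<Sum>m\<le>n. form (exd a) * vgr m x + scal a * sq_deg m (vgr m x))"
    using n a
    by (simp add: sq_all_bound[of _ n] full.pow_le_scal full.gr_scal_mult sq_deg_scal_mult full.gr_pow[OF full.gr_in])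
  also have "\<dots> = form (exd a) * (\<Sum>m\<le>n. vgr m x) + scal a * sq_all x"
    by (simp add: sq_all_bound[OF n] sum.distrib sum_distrib_left)
  finally show ?thesis using n full.pow_le_iff[of x n] by simp
qed

lemma sq_all_pow: "x \<in> tens_pow VecT n \<Longrightarrow> sq_all x = sq_deg n x"
  using sq_all_bound[OF full.pow_in_le[OF _ order_refl]]
  by (simp add: full.gr_pow if_distrib[of "sq_deg _"] sq_deg_zero cong: if_cong)

definition vbullet :: "('w \<Rightarrow> 'w) \<Rightarrow> 'w tens \<Rightarrow> 'w tens" where
  "vbullet u w = vect u * w + ctr u (sq_all w)"

lemma vbullet_add: "u \<in> Vec \<Longrightarrow> x \<in> TVec \<Longrightarrow> y \<in> TVec \<Longrightarrow> vbullet u (x + y) = vbullet u x + vbullet u y"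
  by (simp add: vbullet_def distrib_left sq_all_add ctr_add)

lemma vbullet_plus: "u \<in> Vec \<Longrightarrow> v \<in> Vec \<Longrightarrow> vbullet (\<lambda>\<xi>. u \<xi> + v \<xi>) x = vbullet u x + vbullet v x"
  by (simp add: vbullet_def vect_add distrib_right ctr_plus)

lemma vbullet_lact: "u \<in> Vec \<Longrightarrow> a \<in> Om 0 \<Longrightarrow> vbullet (vec_lact a u) x = scal a * vbullet u x"
  by (simp add: vbullet_def scal_vect[symmetric] mult.assoc ctr_lact distrib_left)

text \<open>The right balancing of the tensor product handles the first summand of \<bullet>; in the
  second, the Leibniz rule contributes \<open>da \<otimes> x\<close>, which contracts to
  \<open>u(da) x\<close>.\<close>

lemma vbullet_scal: "u \<in> Vec \<Longrightarrow> a \<in> Om 0 \<Longrightarrow> x \<in> TVec \<Longrightarrow>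
    vbullet u (scal a * x) = vbullet (vec_ract u a) x + scal (u (exd a)) * x"
  by (simp add: vbullet_def vect_mult_scal sq_all_scal ctr_add ctr_form ctr_ract Om_intros)

end

context vec_sub
begin

lemma sq_all_in: "x \<in> tens_pow_le W n \<Longrightarrow> sq_all x \<in> Fm \<otimes>\<^sub>A tens_pow_le W n"
proof -
  assume x: "x \<in> tens_pow_le W n"
  then have "x \<in> TVec \<and> sq_all x \<in> Fm \<otimes>\<^sub>A tens_pow_le W n"
  proof (induction rule: pow_le_induct)
    case (pow m x)
    have "sq_all x = sq_deg m x"
      using pow pow_full sq_all_pow by blast
    moreover have "Fm \<otimes>\<^sub>A tens_pow W m \<subseteq> Fm \<otimes>\<^sub>A tens_pow_le W n"
      by (rule tens_prod_mono) (use pow pow_in_le in auto)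
    ultimately show ?case
      using sq_deg_in[OF pow(2)] pow_le_TVec[OF pow_in_le[OF pow(2,1)]] by auto
  qed (simp add: sq_all_add TVec_add tens_prod_add)
  then show ?thesis ..
qed

lemma vbullet_in: "u \<in> V \<Longrightarrow> x \<in> tens_pow_le W n \<Longrightarrow> vbullet u x \<in> tens_pow_le W (Suc n)"
  unfolding vbullet_def
  using ctr_pow_le[OF V_Vec sq_all_in, of u x n] pow_le_mono[of n "Suc n"] pow_le_vect[of u x n]
  by (auto intro: pow_le_add)

end

lemma (in bimod_conn) vbullet_TVec: "u \<in> Vec \<Longrightarrow> x \<in> TVec \<Longrightarrow> vbullet u x \<in> TVec"
  by (erule TVecE) (auto intro: TVecI full.vbullet_in)

subsection \<open>Balanced maps on a restricted domain\<close>

text \<open>Balanced maps whose properties are known only for second arguments in a submodule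
  \<open>Y\<close>, such as \<open>TVec\<close>, where \<bullet> is controlled. Hence
  \<open>tens_case\<close> does not apply to them.\<close>

definition bbal :: "'w::star_dga tens set \<Rightarrow> ('w \<Rightarrow> 'w tens \<Rightarrow> 'w tens) \<Rightarrow> bool" where
  "bbal Y f \<longleftrightarrow> 0 \<in> Y \<and> (\<forall>x\<in>Y. \<forall>y\<in>Y. x + y \<in> Y) \<and> (\<forall>a\<in>Om 0. \<forall>x\<in>Y. scal a * x \<in> Y) \<and>
     (\<forall>\<xi>\<in>Om 1. \<forall>x\<in>Y. \<forall>y\<in>Y. f \<xi> (x + y) = f \<xi> x + f \<xi> y) \<and>
     (\<forall>\<xi>\<in>Om 1. \<forall>\<eta>\<in>Om 1. \<forall>x\<in>Y. f (\<xi> + \<eta>) x = f \<xi> x + f \<eta> x) \<and>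
     (\<forall>\<xi>\<in>Om 1. \<forall>a\<in>Om 0. \<forall>x\<in>Y. f (\<xi> * a) x = f \<xi> (scal a * x))"

text \<open>A tensor \<open>t\<close> of a form with \<open>Y\<close> has canonical coordinates
  \<open>ctr u t\<close> in \<open>Y\<close> with respect to a dual basis. So \<open>f\<close> can
  be applied without choosing a decomposition of \<open>t\<close>, and the choice of basis does not
  matter, by \<open>bcase_form\<close>.\<close>

definition bcase :: "('w::star_dga \<Rightarrow> 'w tens \<Rightarrow> 'w tens) \<Rightarrow> 'w tens \<Rightarrow> 'w tens" where
  "bcase f t = (\<Sum>(\<xi>, u)\<leftarrow>(SOME bs. dual_basis (Om 1) Vec bs). f \<xi> (ctr u t))"

context bimod_conn
begin

context
  fixes Y and f assumes f: "bbal Y (f :: 'w \<Rightarrow> 'w tens \<Rightarrow> 'w tens)"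
begin

lemma ctr_Y: "u \<in> Vec \<Longrightarrow> t \<in> Fm \<otimes>\<^sub>A Y \<Longrightarrow> ctr u t \<in> Y"
proof -
  assume u: "u \<in> Vec" and "t \<in> Fm \<otimes>\<^sub>A Y"
  from this(2) show ?thesis
    by (induction rule: tens_prod_induct)
      (use u f in \<open>auto simp: bbal_def ctr_zero ctr_add ctr_form Vec_in\<close>)
qed

lemma bcase_basis:
  obtains bs :: "('w \<times> ('w \<Rightarrow> 'w)) list" where "\<And>t. bcase f t = (\<Sum>q\<leftarrow>bs. f (fst q) (ctr (snd q) t))"
    "\<And>\<omega>. \<omega> \<in> Om 1 \<Longrightarrow> \<omega> = (\<Sum>q\<leftarrow>bs. fst q * snd q \<omega>)"
    "\<And>q. q \<in> set bs \<Longrightarrow> fst q \<in> Om 1 \<and> snd q \<in> Vec"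
proof -
  define bs where "bs = (SOME bs. dual_basis (Om 1 :: 'w set) Vec bs)"
  have "dual_basis (Om 1) Vec bs"
    unfolding bs_def by (rule someI_ex[OF dual_basis_exists[OF fgp]])
  moreover have "bcase f t = (\<Sum>q\<leftarrow>bs. f (fst q) (ctr (snd q) t))" for t
    by (simp add: bcase_def bs_def split_def)
  ultimately show ?thesis
    using that[of bs] by (force simp: dual_basis_def split_def)
qed

lemma bcase_add: "s \<in> Fm \<otimes>\<^sub>A Y \<Longrightarrow> t \<in> Fm \<otimes>\<^sub>A Y \<Longrightarrow> bcase f (s + t) = bcase f s + bcase f t"
proof (rule bcase_basis)
  fix bs :: "('w \<times> ('w \<Rightarrow> 'w)) list"
  assume st: "s \<in> Fm \<otimes>\<^sub>A Y" "t \<in> Fm \<otimes>\<^sub>A Y"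
    and bs: "\<And>t. bcase f t = (\<Sum>q\<leftarrow>bs. f (fst q) (ctr (snd q) t))"
      "\<And>q. q \<in> set bs \<Longrightarrow> fst q \<in> Om 1 \<and> snd q \<in> Vec"
  show ?thesis
    unfolding bs(1) sum_list_addf[symmetric]
    by (rule sum_list_cong) (use bs(2) st f ctr_Y in \<open>simp add: ctr_add bbal_def\<close>)
qed

text \<open>The coordinate of \<open>form \<xi> * x\<close> at \<open>u\<close> is
  \<open>u \<xi>\<close> times \<open>x\<close>. Balancing moves \<open>u \<xi>\<close> into the
  first argument of \<open>f\<close>, where the dual basis sums up to \<xi>.\<close>

lemma bcase_form: "\<xi> \<in> Om 1 \<Longrightarrow> x \<in> Y \<Longrightarrow> bcase f (form \<xi> * x) = f \<xi> x"
proof (rule bcase_basis)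
  fix bs :: "('w \<times> ('w \<Rightarrow> 'w)) list"
  assume \<xi>: "\<xi> \<in> Om 1" and x: "x \<in> Y"
    and bs: "\<And>t. bcase f t = (\<Sum>q\<leftarrow>bs. f (fst q) (ctr (snd q) t))"
      "\<And>\<omega>. \<omega> \<in> Om 1 \<Longrightarrow> \<omega> = (\<Sum>q\<leftarrow>bs. fst q * snd q \<omega>)"
      "\<And>q. q \<in> set bs \<Longrightarrow> fst q \<in> Om 1 \<and> snd q \<in> Vec"
  have f0: "f 0 x = 0"
    using f x Om_zero[of 1] unfolding bbal_def by (metis add_cancel_right_right)
  have f_sum: "(\<Sum>q\<leftarrow>qs. h q) \<in> Om 1 \<and> (\<Sum>q\<leftarrow>qs. f (h q) x) = f (\<Sum>q\<leftarrow>qs. h q) x"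
    if "\<And>q. q \<in> set qs \<Longrightarrow> h q \<in> Om 1" for h and qs :: "('w \<times> ('w \<Rightarrow> 'w)) list"
    using that by (induction qs) (use f x f0 in \<open>auto simp: bbal_def Om_intros\<close>)
  have "bcase f (form \<xi> * x) = (\<Sum>q\<leftarrow>bs. f (fst q * snd q \<xi>) x)"
    unfolding bs(1)
    by (rule sum_list_cong) (use bs(3) \<xi> x f in \<open>simp add: ctr_form bbal_def Vec_in\<close>)
  also have "\<dots> = f (\<Sum>q\<leftarrow>bs. fst q * snd q \<xi>) x"
    using f_sum[of bs "\<lambda>q. fst q * snd q \<xi>"] bs(3) by (simp add: Om_intros Vec_in)
  also have "(\<Sum>q\<leftarrow>bs. fst q * snd q \<xi>) = \<xi>"
    using bs(2)[OF \<xi>] by simp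
  finally show ?thesis .
qed

lemma bcase_zero: "bcase f 0 = 0"
  using bcase_add[OF tens_prod_zero tens_prod_zero] by simp

lemma bcase_sum_list:
  "set ps \<subseteq> Om 1 \<times> Y \<Longrightarrow> (\<Sum>(\<xi>, x)\<leftarrow>ps. form \<xi> * x) \<in> Fm \<otimes>\<^sub>A Y \<and>
     bcase f (\<Sum>(\<xi>, x)\<leftarrow>ps. form \<xi> * x) = (\<Sum>(\<xi>, x)\<leftarrow>ps. f \<xi> x)"
  by (induction ps)
    (auto simp: bcase_zero bcase_add bcase_form tens_prodI tens_prod_zero intro!: tens_prod_add)

end

end

subsection \<open>Modules over the algebra of tensor powers\<close>

text \<open>The relation \<open>act_sm\<close> is that of \<open>u \<bullet> a = u a + u(da)\<close>, so that \<open>orbit\<close> below is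
  \<open>x \<mapsto> x \<triangleright> m0\<close> for the module structure given by \<open>sm\<close> and \<open>act\<close>.\<close>

locale mod_rec = vec_sub sq sinv V p
  for sq :: "'w::star_dga \<Rightarrow> 'w tens" and sinv :: "'w tens \<Rightarrow> 'w tens"
    and V :: "('w \<Rightarrow> 'w) set" and p :: "('w \<Rightarrow> 'w) \<Rightarrow> 'w \<Rightarrow> 'w" +
  fixes M :: "nat \<Rightarrow> 'y::ab_group_add set" and act :: "('w \<Rightarrow> 'w) \<Rightarrow> 'y \<Rightarrow> 'y"
    and sm :: "'w \<Rightarrow> 'y \<Rightarrow> 'y" and m0 :: 'y
  assumes M_zero: "0 \<in> M n" and M_add: "x \<in> M n \<Longrightarrow> y \<in> M n \<Longrightarrow> x + y \<in> M n"
    and M_uminus: "x \<in> M n \<Longrightarrow> - x \<in> M n" and M_Suc: "M n \<subseteq> M (Suc n)"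
    and sm_in: "a \<in> Om 0 \<Longrightarrow> x \<in> M n \<Longrightarrow> sm a x \<in> M n"
    and sm_add: "a \<in> Om 0 \<Longrightarrow> x \<in> M n \<Longrightarrow> y \<in> M n \<Longrightarrow> sm a (x + y) = sm a x + sm a y"
    and sm_plus: "a \<in> Om 0 \<Longrightarrow> b \<in> Om 0 \<Longrightarrow> x \<in> M n \<Longrightarrow> sm (a + b) x = sm a x + sm b x"
    and sm_mult: "a \<in> Om 0 \<Longrightarrow> b \<in> Om 0 \<Longrightarrow> x \<in> M n \<Longrightarrow> sm (a * b) x = sm a (sm b x)"
    and act_in: "u \<in> V \<Longrightarrow> x \<in> M n \<Longrightarrow> act u x \<in> M (Suc n)"
    and act_add: "u \<in> V \<Longrightarrow> x \<in> M n \<Longrightarrow> y \<in> M n \<Longrightarrow> act u (x + y) = act u x + act u y"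
    and act_plus: "u \<in> V \<Longrightarrow> v \<in> V \<Longrightarrow> x \<in> M n \<Longrightarrow> act (\<lambda>\<xi>. u \<xi> + v \<xi>) x = act u x + act v x"
    and act_lact: "u \<in> V \<Longrightarrow> a \<in> Om 0 \<Longrightarrow> x \<in> M n \<Longrightarrow> act (vec_lact a u) x = sm a (act u x)"
    and act_sm: "u \<in> V \<Longrightarrow> a \<in> Om 0 \<Longrightarrow> x \<in> M n \<Longrightarrow>
      act u (sm a x) = act (vec_ract u a) x + sm (u (exd a)) x"
    and m0_in: "m0 \<in> M 0"
begin

text \<open>Solves \<open>u \<bullet> x = u \<otimes> x + ev(u \<otimes> \<box>x)\<close> for
  \<open>u \<otimes> x\<close>. The correction has the same degree as \<open>x\<close>, so this is a
  recursion on the degree; \<open>p\<close> and \<open>gr p\<close> only serve to make the map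
  total.\<close>

primrec orbit :: "nat \<Rightarrow> 'w tens \<Rightarrow> 'y" where
  "orbit 0 = tens_case (\<lambda>a. sm a m0) (\<lambda>_ _. 0) (\<lambda>_ _. 0)"
| "orbit (Suc n) = tens_case (\<lambda>_. 0) (\<lambda>_ _. 0)
     (\<lambda>u x. act (p u) (orbit n (gr p n x)) - orbit n (ctr (p u) (sq_deg n (gr p n x))))"

lemma sm_zero: "a \<in> Om 0 \<Longrightarrow> sm a 0 = 0"
  using sm_add[of a 0 0 0] M_zero by simp

lemma sm_uminus: "a \<in> Om 0 \<Longrightarrow> x \<in> M n \<Longrightarrow> sm a (- x) = - sm a x"
  using sm_add[of a x n "- x"] sm_zero[of a] M_uminus[of x n]
  by (simp add: eq_neg_iff_add_eq_0 add.commute)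

lemma sm_diff: "a \<in> Om 0 \<Longrightarrow> x \<in> M n \<Longrightarrow> y \<in> M n \<Longrightarrow> sm a (x - y) = sm a x - sm a y"
  using sm_add[of a x n "- y"] sm_uminus[of a y n] M_uminus[of y n] by simp

lemma ctr_sq_deg_in: "u \<in> V \<Longrightarrow> x \<in> tens_pow W n \<Longrightarrow> ctr u (sq_deg n x) \<in> tens_pow W n"
  by (intro ctr_pow sq_deg_in V_Vec)

lemma sq_deg_gr_scal: "a \<in> Om 0 \<Longrightarrow> x \<in> tens_pow W n \<Longrightarrow>
    sq_deg n (scal a * x) = form (exd a) * x + scal a * sq_deg n x"
  by (simp add: sq_deg_scal_mult gr_id_pow)

text \<open>When a scalar \<open>a\<close> crosses the tensor sign, \<open>act_sm\<close> gives an
  extra term \<open>sm (u (exd a))\<close>, and the Leibniz rule of \<open>sq_deg\<close> gives the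
  same term in the subtracted part. The two cancel.\<close>

lemma orbit_bal:
  assumes "additive (orbit n)" "\<And>x. x \<in> tens_pow W n \<Longrightarrow> orbit n x \<in> M n"
    "\<And>a x. a \<in> Om 0 \<Longrightarrow> x \<in> tens_pow W n \<Longrightarrow> orbit n (scal a * x) = sm a (orbit n x)"
  shows "vbal (\<lambda>u x. act (p u) (orbit n (gr p n x)) - orbit n (ctr (p u) (sq_deg n (gr p n x))))"
proof -
  note ad = additive.add[OF assms(1)]
  have in_M: "orbit n (gr p n x) \<in> M n" for x
    by (rule assms(2)[OF gr_in])
  have 1: "act (p v) (orbit n (gr p n (x + y))) - orbit n (ctr (p v) (sq_deg n (gr p n (x + y)))) =
     act (p v) (orbit n (gr p n x)) - orbit n (ctr (p v) (sq_deg n (gr p n x))) +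
     (act (p v) (orbit n (gr p n y)) - orbit n (ctr (p v) (sq_deg n (gr p n y))))" if "v \<in> Vec" for v x y
    using that by (simp add: gr_add ad act_add[OF p_in in_M in_M] sq_deg_add ctr_add p_Vec)
  have 2: "act (p (\<lambda>\<xi>. u \<xi> + v \<xi>)) (orbit n (gr p n x)) - orbit n (ctr (p (\<lambda>\<xi>. u \<xi> + v \<xi>)) (sq_deg n (gr p n x))) =
     act (p u) (orbit n (gr p n x)) - orbit n (ctr (p u) (sq_deg n (gr p n x))) +
     (act (p v) (orbit n (gr p n x)) - orbit n (ctr (p v) (sq_deg n (gr p n x))))" if "u \<in> Vec" "v \<in> Vec" for u v x
    using that by (simp add: p_plus ad act_plus[OF p_in p_in in_M] ctr_plus p_Vec)
  have 3: "act (p (vec_ract v a)) (orbit n (gr p n x)) - orbit n (ctr (p (vec_ract v a)) (sq_deg n (gr p n x))) =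
     act (p v) (orbit n (gr p n (scal a * x))) - orbit n (ctr (p v) (sq_deg n (gr p n (scal a * x))))"
    if v: "v \<in> Vec" and a: "a \<in> Om 0" for v a x
  proof -
    have "act (p v) (orbit n (gr p n (scal a * x))) =
        act (vec_ract (p v) a) (orbit n (gr p n x)) + sm (p v (exd a)) (orbit n (gr p n x))"
      using v a by (simp add: gr_scal_mult assms(3) gr_in act_sm[OF p_in a in_M])
    moreover have "orbit n (ctr (p v) (sq_deg n (gr p n (scal a * x)))) =
        sm (p v (exd a)) (orbit n (gr p n x)) + orbit n (ctr (vec_ract (p v) a) (sq_deg n (gr p n x)))"
      using v a
      by (simp add: gr_scal_mult sq_deg_gr_scal gr_in ctr_add ctr_form p_Vec Om_intros ad assms(3) Vec_in
          ctr_ract)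
    ultimately show ?thesis using v a by (simp add: p_ract)
  qed
  show ?thesis
    unfolding vbal_def additive_def using 1 2 3 by blast
qed

text \<open>One joint induction, since well-definedness in degree \<open>n + 1\<close> rests on
  additivity and linearity over \<open>A\<close> in degree \<open>n\<close>.\<close>

lemma orbit_main: "additive (orbit n) \<and> (\<forall>x\<in>tens_pow W n. orbit n x \<in> M n \<and> (\<forall>a\<in>Om 0. orbit n (scal a * x) = sm a (orbit n x)))"
proof (induction n)
  case 0
  have bal: "additive_on (Om 0) (\<lambda>a. sm a m0)"
    using sm_plus m0_in by (simp add: additive_on_def)
  then show ?case
    using sm_in m0_in sm_mult by (auto simp: additive_tens_case tens_case_scal scal_scal Om_intros)
next
  case (Suc n)
  then have bal: "vbal (\<lambda>u x. act (p u) (orbit n (gr p n x)) - orbit n (ctr (p u) (sq_deg n (gr p n x))))"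
    by (intro orbit_bal) blast+
  have ad: "additive (orbit (Suc n))"
    by (simp add: additive_tens_case bal)
  have "orbit (Suc n) x \<in> M (Suc n) \<and> (\<forall>a\<in>Om 0. orbit (Suc n) (scal a * x) = sm a (orbit (Suc n) x))"
    if "x \<in> tens_pow W (Suc n)" for x
    using that
  proof (induction rule: pow_induct)
    case zero
    then show ?case using additive.zero[OF ad] M_zero sm_zero by simp
  next
    case (add x y)
    then show ?case using additive.add[OF ad] M_add sm_add[of _ "orbit (Suc n) x" "Suc n" "orbit (Suc n) y"]
      by (simp add: distrib_left del: orbit.simps)
  next
    case (mult u y)
    have rec: "orbit (Suc n) (vect v * y) = act v (orbit n y) - orbit n (ctr v (sq_deg n y))" if "v \<in> V" for v
      using that mult by (simp add: tens_case_vect bal V_Vec p_id gr_pow)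
    have mem: "act u (orbit n y) \<in> M (Suc n)" "orbit n (ctr u (sq_deg n y)) \<in> M (Suc n)"
      using mult Suc act_in ctr_sq_deg_in M_Suc by blast+
    have "orbit (Suc n) (vect u * y) \<in> M (Suc n)"
      unfolding rec[OF mult(1)] using M_add[OF mem(1) M_uminus[OF mem(2)]] by simp
    moreover have "orbit (Suc n) (scal a * (vect u * y)) = sm a (orbit (Suc n) (vect u * y))" if a: "a \<in> Om 0" for a
      using a mult mem Suc ctr_sq_deg_in[OF mult]
      by (simp add: scal_mult_vect V_Vec rec V_lact sm_diff act_lact[of u a _ n] ctr_lact del: orbit.simps)
    ultimately show ?case by blast
  qed
  then show ?case using ad by blast
qed

lemma additive_orbit: "additive (orbit n)" and orbit_in: "x \<in> tens_pow W n \<Longrightarrow> orbit n x \<in> M n"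
  and orbit_scal_mult: "a \<in> Om 0 \<Longrightarrow> x \<in> tens_pow W n \<Longrightarrow> orbit n (scal a * x) = sm a (orbit n x)"
  using orbit_main by blast+

lemmas orbit_add = additive.add[OF additive_orbit] and orbit_zero = additive.zero[OF additive_orbit]

lemma orbit_Suc_vect: "u \<in> V \<Longrightarrow> x \<in> tens_pow W n \<Longrightarrow>
    orbit (Suc n) (vect u * x) = act u (orbit n x) - orbit n (ctr u (sq_deg n x))"
  using orbit_bal[OF additive_orbit orbit_in orbit_scal_mult, of n]
  by (simp add: tens_case_vect V_Vec p_id gr_pow)

lemma orbit_0_scal: "a \<in> Om 0 \<Longrightarrow> orbit 0 (scal a) = sm a m0"
  using sm_plus m0_in by (simp add: tens_case_scal additive_on_def)

declare orbit.simps [simp del]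

lemma orbit_1_vect: "u \<in> V \<Longrightarrow> sm 1 m0 = m0 \<Longrightarrow> orbit 1 (vect u) = act u m0"
  using orbit_Suc_vect[of u "scal 1" 0] orbit_0_scal[OF Om_one] sq_deg_0_scal[OF Om_one]
  by (simp add: One_nat_def ctr_zero V_Vec Om_one orbit_zero)
    (metis Om_one orbit_0_scal sq_deg_0_scal additive.zero additive_orbit ctr_zero V_Vec exd_one form_zero image_eqI scal_one diff_zero)

end

subsection \<open>The product\<close>

context bimod_conn
begin

lemma pow_1: "x \<in> tens_pow VecT 1 \<Longrightarrow> x \<in> (VecT :: 'w tens set)"
proof -
  assume "x \<in> tens_pow VecT 1"
  then have "x \<in> VecT \<otimes>\<^sub>A scal ` Om 0" by (simp add: One_nat_def)
  then show ?thesis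
  proof (induction rule: tens_prod_induct)
    case zero
    show ?case by (metis vect_zero zero_in_Vec image_eqI)
  next
    case (add x y)
    then show ?case by (rule full.W_add)
  next
    case (mult x y)
    then show ?case using full.W_scal_right by blast
  qed
qed

lemma bullet_deg_1:
  assumes u: "u \<in> Vec" and w: "w \<in> TVec"
  shows "bullet_deg sq sinv (Suc 0) (vect u) w = vbullet u w"
proof -
  have "ev_id (vect u * sq_pow sq sinv m (vcomp m w)) = ctr u (sq_deg m (vgr m w))" for m
    using u FT_prod[OF order_refl full.sq_deg_in[OF full.gr_in]]
    by (simp add: vcomp_eq[OF w] sq_pow_eq[OF full.gr_in] ev_id_vect)
  then show ?thesis
    using u by (simp add: vbullet_def sq_all_def vcomp_eq[OF w] additive.sum[OF additive_ctr])
qed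

text \<open>Multiplication into \<open>w\<close> is the orbit map of \<open>w\<close> in the module
  \<open>TVec\<close> with operators \<open>vbullet\<close>, taken with the constant filtration.
  This shows that the extension in \<open>bullet_deg\<close> does not depend on decompositions, for
  which \<open>vbullet_scal\<close> is decisive.\<close>

lemma bullet_deg_orbit:
  assumes w: "w \<in> TVec"
  obtains G where "\<And>n. additive (G n)" "\<And>n x. x \<in> tens_pow VecT n \<Longrightarrow> G n x \<in> TVec"
    "\<And>n x a. a \<in> Om 0 \<Longrightarrow> x \<in> tens_pow VecT n \<Longrightarrow> G n (scal a * x) = scal a * G n x"
    "\<And>n x. x \<in> tens_pow VecT n \<Longrightarrow> bullet_deg sq sinv n x w = G n x"
    "\<And>u. u \<in> Vec \<Longrightarrow> G 1 (vect u) = vbullet u w"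
proof -
  interpret mod_rec sq sinv Vec "\<lambda>v. v" "\<lambda>_. TVec" vbullet "\<lambda>a x. scal a * x" w
    by unfold_locales
      (auto simp: TVec_zero TVec_add TVec_uminus TVec_scal distrib_left scal_add distrib_right
        scal_scal[symmetric] mult.assoc vbullet_TVec vbullet_add vbullet_plus vbullet_lact vbullet_scal w)
  have 1: "orbit 1 (vect u) = vbullet u w" if "u \<in> Vec" for u
    using orbit_1_vect[OF that] by simp
  have "bullet_deg sq sinv n x w = orbit n x" if "x \<in> tens_pow VecT n" for n x
    using that
  proof (induction n arbitrary: x rule: induct_nat_012)
    case 0
    then show ?case by (auto simp: orbit_0_scal)
  next
    case 1
    then obtain u where "u \<in> Vec" "x = vect u" using pow_1[of x] by (auto simp: One_nat_def)
    then show ?case using 1 bullet_deg_1[OF _ w] \<open>\<And>u. u \<in> Vec \<Longrightarrow> orbit 1 (vect u) = vbullet u w\<close> by (simp add: One_nat_def)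
  next
    case (ge2 n)
    then have "x \<in> vect ` Vec \<otimes>\<^sub>A tens_pow VecT (Suc n)" by simp
    then obtain ps where ps: "set ps \<subseteq> Vec \<times> tens_pow VecT (Suc n)" "x = (\<Sum>(u, w)\<leftarrow>ps. vect u * w)"
      by (rule tens_prod_list)
    have "orbit (Suc (Suc n)) (case q of (u, v) \<Rightarrow> vect u * v) = (case q of (u, v) \<Rightarrow>
        bullet_deg sq sinv (Suc 0) (vect u) (bullet_deg sq sinv (Suc n) v w)
          - bullet_deg sq sinv (Suc n) (ev_id (vect u * sq_pow sq sinv (Suc n) v)) w)"
      if q: "q \<in> Vec \<times> tens_pow VecT (Suc n)" for q
    proof -
      obtain u v where [simp]: "q = (u, v)" and u: "u \<in> Vec" and v: "v \<in> tens_pow VecT (Suc n)"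
        using q by blast
      have "ev_id (vect u * sq_pow sq sinv (Suc n) v) = ctr u (sq_deg (Suc n) v)"
        unfolding sq_pow_eq[OF v] by (rule ev_id_vect[OF u FT_prod[OF order_refl full.sq_deg_in[OF v]]])
      then show ?thesis
        using u v bullet_deg_1[OF u orbit_in[OF v]] ge2.IH(2)[OF v] ge2.IH(2)[OF ctr_sq_deg_in[OF u v]]
        by (simp add: orbit_Suc_vect del: bullet_deg.simps tens_pow.simps)
    qed
    then show ?case
      unfolding bullet_deg.simps by (rule lin_ext_hom[OF additive_orbit ps(1) _ ps(2)])
  qed
  then show ?thesis
    using that[of orbit] additive_orbit orbit_in orbit_scal_mult 1 by blast
qed

lemma bullet_props:
  assumes w: "w \<in> TVec"
  shows "u \<in> Vec \<Longrightarrow> bullet sq sinv (vect u) w = vbullet u w"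
    and "x \<in> TVec \<Longrightarrow> y \<in> TVec \<Longrightarrow> bullet sq sinv (x + y) w = bullet sq sinv x w + bullet sq sinv y w"
    and "x \<in> TVec \<Longrightarrow> a \<in> Om 0 \<Longrightarrow> bullet sq sinv (scal a * x) w = scal a * bullet sq sinv x w"
proof -
  obtain G where G: "\<And>n. additive (G n)"
    "\<And>n x a. a \<in> Om 0 \<Longrightarrow> x \<in> tens_pow VecT n \<Longrightarrow> G n (scal a * x) = scal a * G n x"
    "\<And>n x. x \<in> tens_pow VecT n \<Longrightarrow> bullet_deg sq sinv n x w = G n x"
    "\<And>u. u \<in> Vec \<Longrightarrow> G 1 (vect u) = vbullet u w"
    using bullet_deg_orbit[OF w] by metis
  have b: "bullet sq sinv x w = (\<Sum>m\<le>n. G m (vgr m x))" if n: "x \<in> tens_pow_le VecT n" for x n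
  proof -
    have "bullet sq sinv x w = (\<Sum>m | vgr m x \<noteq> 0. G m (vgr m x))"
      by (simp add: bullet_def vcomp_eq[OF TVecI[OF n]] G(3)[OF full.gr_in])
    also have "\<dots> = (\<Sum>m\<le>n. G m (vgr m x))"
      by (rule sum.mono_neutral_left)
        (use full.gr_pow_le[OF n] additive.zero[OF G(1)] in \<open>auto simp: not_less[symmetric]\<close>)
    finally show ?thesis .
  qed
  show "bullet sq sinv (vect u) w = vbullet u w" if u: "u \<in> Vec"
    using b[OF full.pow_in_le[OF full.pow_vect[OF u] order_refl]] G(4)[OF u] additive.zero[OF G(1)]
    by (simp add: full.gr_pow[OF full.pow_vect[OF u]] if_distrib[of "G _"] cong: if_cong)
  show "bullet sq sinv (x + y) w = bullet sq sinv x w + bullet sq sinv y w" if xy: "x \<in> TVec" "y \<in> TVec"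
  proof -
    obtain n where "x \<in> tens_pow_le VecT n" "y \<in> tens_pow_le VecT n"
      by (rule TVecE2[OF xy])
    then show ?thesis
      using b[of x n] b[of y n] b[OF full.pow_le_add, of x n y]
      by (simp add: full.gr_add additive.add[OF G(1)] sum.distrib)
  qed
  show "bullet sq sinv (scal a * x) w = scal a * bullet sq sinv x w" if x: "x \<in> TVec" and a: "a \<in> Om 0"
  proof -
    obtain n where n: "x \<in> tens_pow_le VecT n"
      by (rule TVecE[OF x])
    then show ?thesis
      using b[OF n] b[OF full.pow_le_scal[OF n a]] a
      by (simp add: full.gr_scal_mult G(2) full.gr_in sum_distrib_left)
  qed
qed

lemma fbullet_bal: "w \<in> TVec \<Longrightarrow> bbal TVec (\<lambda>\<xi> x. form \<xi> * bullet sq sinv x w)"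
  by (auto simp: bbal_def TVec_zero TVec_add TVec_scal bullet_props distrib_left distrib_right form_add
      form_mult_scal)

lemma form_bullet_eq:
  assumes w: "w \<in> TVec" and t: "t \<in> Fm \<otimes>\<^sub>A TVec"
  shows "form_bullet sq sinv t w = bcase (\<lambda>\<xi> x. form \<xi> * bullet sq sinv x w) t"
proof -
  note bal = fbullet_bal[OF w]
  obtain ps where ps: "set ps \<subseteq> Om 1 \<times> TVec" "t = (\<Sum>(\<xi>, x)\<leftarrow>ps. form \<xi> * x)"
    using tens_prod_list[OF t] .
  show ?thesis
    unfolding form_bullet_def
  proof (rule lin_ext_hom_on[where S = "Fm \<otimes>\<^sub>A TVec" and ps = ps])
    show "(case q of (\<omega>, x) \<Rightarrow> form \<omega> * x) \<in> Fm \<otimes>\<^sub>A TVec \<and>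
        bcase (\<lambda>\<xi> x. form \<xi> * bullet sq sinv x w) (case q of (\<omega>, x) \<Rightarrow> form \<omega> * x) =
        (case q of (\<omega>, x) \<Rightarrow> form \<omega> * bullet sq sinv x w)" if "q \<in> Om 1 \<times> TVec" for q
      using that by (auto intro: tens_prodI simp: bcase_form[OF bal])
  qed (use ps bcase_add[OF bal] bcase_zero[OF bal] tens_prod_add tens_prod_zero in \<open>blast+\<close>)
qed

end

section \<open>Almost complex structures\<close>

subsection \<open>Wedge products of forms\<close>

text \<open>The projection of the tensor algebra onto \<open>A\<close>. It closes the word in
  \<open>wedge_right\<close>, so that \<open>wedge_op\<close> is a total map that only sees words
  with exactly two forms.\<close>

definition scalar_part :: "'w::star_dga tens \<Rightarrow> 'w" where
  "scalar_part = tens_case (\<lambda>a. a) (\<lambda>_ _. 0) (\<lambda>_ _. 0)"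

lemma id_additive_on: "additive_on S (\<lambda>a. a)"
  by (simp add: additive_on_def)

lemma additive_scalar_part: "additive scalar_part"
  unfolding scalar_part_def by (rule additive_tens_case) (simp_all add: id_additive_on)

lemma scalar_part_scal: "a \<in> Om 0 \<Longrightarrow> scalar_part (scal a) = a"
  unfolding scalar_part_def by (rule tens_case_scal) (simp_all add: id_additive_on)

lemma scalar_part_one: "scalar_part 1 = (1 :: 'w::star_dga)"
  using scalar_part_scal[OF Om_one] by simp

lemma scalar_part_form: "\<xi> \<in> Om 1 \<Longrightarrow> scalar_part (form \<xi> * x) = 0"
  unfolding scalar_part_def by (rule tens_case_form) (simp_all add: id_additive_on)

lemma scalar_part_vect: "v \<in> Vec \<Longrightarrow> scalar_part (vect v * x) = 0"
  unfolding scalar_part_def by (rule tens_case_vect) (simp_all add: id_additive_on)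

lemma scalar_part_scal_mult: "a \<in> Om 0 \<Longrightarrow> scalar_part (scal a * x) = a * scalar_part x"
  by (induction x rule: tens_induct)
    (simp_all add: distrib_left additive.add[OF additive_scalar_part] scal_scal scalar_part_scal
      scal_mult_form scal_mult_vect scalar_part_form scalar_part_vect vec_lact_in Om_intros)

lemma bimod_map_fbal:
  "bimod_map g \<Longrightarrow> additive h \<Longrightarrow> (\<And>a x. a \<in> Om 0 \<Longrightarrow> h (scal a * x) = a * h x) \<Longrightarrow>
    fbal (\<lambda>\<eta> x. g \<eta> * h x)" for h :: "'w tens \<Rightarrow> 'w::star_dga"
  by (simp add: fbal_def additive_mult_left bimod_map_simps distrib_right mult.assoc)

definition wedge_right :: "('w::star_dga \<Rightarrow> 'w) \<Rightarrow> 'w tens \<Rightarrow> 'w" where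
  "wedge_right g = tens_case (\<lambda>_. 0) (\<lambda>\<eta> x. g \<eta> * scalar_part x) (\<lambda>_ _. 0)"

definition wedge_op :: "('w::star_dga \<Rightarrow> 'w) \<Rightarrow> ('w \<Rightarrow> 'w) \<Rightarrow> 'w tens \<Rightarrow> 'w" where
  "wedge_op f g = tens_case (\<lambda>_. 0) (\<lambda>\<xi> y. f \<xi> * wedge_right g y) (\<lambda>_ _. 0)"

context
  fixes f g :: "'w::star_dga \<Rightarrow> 'w" assumes f: "bimod_map f" and g: "bimod_map g"
begin

lemma wedge_right_bal: "fbal (\<lambda>\<eta> x. g \<eta> * scalar_part x)"
  by (rule bimod_map_fbal[OF g additive_scalar_part scalar_part_scal_mult])

lemma additive_wedge_right: "additive (wedge_right g)"
  unfolding wedge_right_def by (rule additive_tens_case) (simp_all add: wedge_right_bal)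

lemma wedge_right_form: "\<eta> \<in> Om 1 \<Longrightarrow> wedge_right g (form \<eta> * x) = g \<eta> * scalar_part x"
  unfolding wedge_right_def by (rule tens_case_form) (simp_all add: wedge_right_bal)

lemma wedge_right_form1: "\<eta> \<in> Om 1 \<Longrightarrow> wedge_right g (form \<eta>) = g \<eta>"
  using wedge_right_form[of \<eta> 1] by (simp add: scalar_part_one)

lemma wedge_right_scal: "a \<in> Om 0 \<Longrightarrow> wedge_right g (scal a) = 0"
  unfolding wedge_right_def by (rule tens_case_scal) (simp_all add: wedge_right_bal)

lemma wedge_right_vect: "v \<in> Vec \<Longrightarrow> wedge_right g (vect v * x) = 0"
  unfolding wedge_right_def by (rule tens_case_vect) (simp_all add: wedge_right_bal)

lemma wedge_right_scal_mult: "a \<in> Om 0 \<Longrightarrow> wedge_right g (scal a * x) = a * wedge_right g x"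
  by (induction x rule: tens_induct)
    (simp_all add: distrib_left additive.add[OF additive_wedge_right] scal_scal wedge_right_scal
      scal_mult_form scal_mult_vect wedge_right_form wedge_right_vect vec_lact_in Om_intros
      bimod_map_simps[OF g] mult.assoc)

lemma wedge_op_bal: "fbal (\<lambda>\<xi> y. f \<xi> * wedge_right g y)"
  by (rule bimod_map_fbal[OF f additive_wedge_right wedge_right_scal_mult])

lemma additive_wedge_op: "additive (wedge_op f g)"
  unfolding wedge_op_def by (rule additive_tens_case) (simp_all add: wedge_op_bal)

lemma wedge_op_form: "\<xi> \<in> Om 1 \<Longrightarrow> \<eta> \<in> Om 1 \<Longrightarrow> wedge_op f g (form \<xi> * form \<eta>) = f \<xi> * g \<eta>"
  unfolding wedge_op_def by (simp add: tens_case_form wedge_op_bal wedge_right_form1)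

lemmas wedge_op_add = additive.add[OF additive_wedge_op] and wedge_op_zero = additive.zero[OF additive_wedge_op]
  and wedge_op_diff = additive.diff[OF additive_wedge_op]

lemma wedge_op_scal: "t \<in> FF \<Longrightarrow> a \<in> Om 0 \<Longrightarrow> wedge_op f g (scal a * t) = a * wedge_op f g t"
  by (induction rule: tens_prod_induct)
    (auto simp: wedge_op_add wedge_op_zero wedge_op_form distrib_left scal_mult_form Om_intros bimod_map_simps[OF f] mult.assoc)

lemma wedge_op_scal_right: "t \<in> FF \<Longrightarrow> a \<in> Om 0 \<Longrightarrow> wedge_op f g (t * scal a) = wedge_op f g t * a"
  by (induction rule: tens_prod_induct)
    (auto simp: wedge_op_add wedge_op_zero wedge_op_form distrib_right form_scal Om_intros bimod_map_simps[OF g] mult.assoc)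

lemma wedge2_eq: "t \<in> FF \<Longrightarrow> wedge2 f g t = wedge_op f g t"
proof -
  assume "t \<in> FF"
  then obtain ps where ps: "set ps \<subseteq> Om 1 \<times> Om 1" "t = (\<Sum>(x, y)\<leftarrow>ps. form x * form y)"
    by (rule tens_prod_list2)
  then show ?thesis
    unfolding wedge2_def by (intro lin_ext_hom[where ps = ps]) (auto simp: additive_wedge_op wedge_op_form)
qed

end

lemma bimod_map_id: "bimod_map (\<lambda>x. x)"
  by (auto simp: bimod_map_def right_linear_on_def additive_on_def)

lemma wedge_form: "\<xi> \<in> Om 1 \<Longrightarrow> \<eta> \<in> Om 1 \<Longrightarrow> wedge_op (\<lambda>x. x) (\<lambda>x. x) (form \<xi> * form \<eta>) = \<xi> * \<eta>"
  by (rule wedge_op_form[OF bimod_map_id bimod_map_id])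

lemma wedge_eq: "t \<in> FF \<Longrightarrow> wedge t = wedge_op (\<lambda>x. x) (\<lambda>x. x) t"
  using wedge2_eq[OF bimod_map_id bimod_map_id] by (simp add: id_def)

lemma form_inj: "\<xi> \<in> Om 1 \<Longrightarrow> \<eta> \<in> Om 1 \<Longrightarrow> form \<xi> = form \<eta> \<Longrightarrow> \<xi> = \<eta>"
  by (metis bimod_map_id wedge_right_form1)

subsection \<open>The decomposition by type\<close>

locale almost_cpx =
  fixes J :: "'w::star_dga \<Rightarrow> 'w" assumes ac: "almost_complex J"
begin

lemma bimod_J: "bimod_map J"
  and J_J: "\<xi> \<in> Om 1 \<Longrightarrow> J (J \<xi>) = - \<xi>"
  and J_wedge: "n > 0 \<Longrightarrow> (\<forall>l\<in>set ls. length l = n \<and> set l \<subseteq> Om 1) \<Longrightarrow> (\<Sum>l\<leftarrow>ls. prod_list l) = 0 \<Longrightarrow>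
        (\<Sum>l\<leftarrow>ls. wedge_J J l) = 0"
  using ac unfolding almost_complex_def bimod_map_def by blast+

lemmas J_simps = bimod_map_simps[OF bimod_J]

lemma J_minus: "\<xi> \<in> Om 1 \<Longrightarrow> J (- \<xi>) = - J \<xi>"
  using J_simps(5)[of \<xi> "-1"] by (simp add: cscale_minus_left cscale_one)

lemma J_diff: "\<xi> \<in> Om 1 \<Longrightarrow> \<eta> \<in> Om 1 \<Longrightarrow> J (\<xi> - \<eta>) = J \<xi> - J \<eta>"
  using J_simps(2)[of \<xi> "- \<eta>"] by (simp add: J_minus Om_intros)

lemma wedge_J_minus: "x \<in> Om 1 \<Longrightarrow> wedge_J J ((- x) # l) = - wedge_J J (x # l)"
  unfolding wedge_J_def sum_negf[symmetric]
proof (rule sum.cong)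
  fix k assume "x \<in> Om 1"
  then show "prod_list (((- x) # l)[k := J (((- x) # l) ! k)]) = - prod_list ((x # l)[k := J ((x # l) ! k)])"
    by (cases k) (simp_all add: J_minus)
qed simp

text \<open>Two decompositions of one form differ by a vanishing sum, to which the last clause of
  \<open>almost_complex\<close> applies. Negating the first factor of each word realises the
  difference; this needs \<open>n > 0\<close>.\<close>

lemma J_forms_sum:
  assumes n: "n > 0" and ls: "\<forall>l\<in>set ls. length l = n \<and> set l \<subseteq> Om 1"
  shows "J_forms J n (\<Sum>l\<leftarrow>ls. prod_list l) = (\<Sum>l\<leftarrow>ls. wedge_J J l)"
proof -
  define neg where "neg l = (- hd l) # tl l" for l :: "'w list"
  have neg: "length (neg l) = n \<and> set (neg l) \<subseteq> Om 1 \<and> prod_list (neg l) = - prod_list l \<and>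
      wedge_J J (neg l) = - wedge_J J l" if "length l = n \<and> set l \<subseteq> Om 1" for l
    using n that by (cases l) (auto simp: neg_def wedge_J_minus Om_intros)
  have "(\<Sum>l\<leftarrow>qs. wedge_J J l) = (\<Sum>l\<leftarrow>ls. wedge_J J l)"
    if qs: "set qs \<subseteq> {l. length l = n \<and> set l \<subseteq> Om 1}"
      "(\<Sum>l\<leftarrow>qs. prod_list l) = (\<Sum>l\<leftarrow>ls. prod_list l)" for qs
  proof -
    have 1: "(\<Sum>l\<leftarrow>map neg ls. prod_list l) = - (\<Sum>l\<leftarrow>ls. prod_list l)"
      "(\<Sum>l\<leftarrow>map neg ls. wedge_J J l) = - (\<Sum>l\<leftarrow>ls. wedge_J J l)"
      using ls neg by (induction ls) auto
    have "\<forall>l\<in>set (qs @ map neg ls). length l = n \<and> set l \<subseteq> Om 1"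
    proof -
      have "length (neg l) = n \<and> set (neg l) \<subseteq> Om 1" if "l \<in> set ls" for l
        using neg[of l] ls that by blast
      then show ?thesis using qs(1) by auto
    qed
    then have "(\<Sum>l\<leftarrow>qs @ map neg ls. wedge_J J l) = 0"
      by (rule J_wedge[OF n]) (use qs 1 in simp)
    then show ?thesis using 1 by simp
  qed
  then show ?thesis
    unfolding J_forms_def using n ls by (simp, intro lin_ext_eq) auto
qed

lemma J_forms_1: "\<xi> \<in> Om 1 \<Longrightarrow> J_forms J 1 \<xi> = J \<xi>"
  using J_forms_sum[of 1 "[[\<xi>]]"] by (simp add: wedge_J_def One_nat_def)

lemma J_forms_2:
  assumes "set ps \<subseteq> Om 1 \<times> Om 1"
  shows "J_forms J 2 (\<Sum>(\<xi>, \<eta>)\<leftarrow>ps. \<xi> * \<eta>) = (\<Sum>(\<xi>, \<eta>)\<leftarrow>ps. J \<xi> * \<eta> + \<xi> * J \<eta>)"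
proof -
  have "wedge_J J [\<xi>, \<eta>] = J \<xi> * \<eta> + \<xi> * J \<eta>" for \<xi> \<eta>
    by (simp add: wedge_J_def lessThan_Suc add.commute numeral_2_eq_2)
  moreover have "\<forall>l\<in>set (map (\<lambda>(\<xi>, \<eta>). [\<xi>, \<eta>]) ps). length l = 2 \<and> set l \<subseteq> Om 1"
    using assms by auto
  ultimately show ?thesis
    using J_forms_sum[of 2 "map (\<lambda>(\<xi>, \<eta>). [\<xi>, \<eta>]) ps"] by (simp add: o_def split_def)
qed

lemma Om_2_list:
  assumes "x \<in> Om 2"
  obtains ps where "set ps \<subseteq> Om 1 \<times> Om 1" "x = (\<Sum>(\<xi>, \<eta>)\<leftarrow>ps. \<xi> * \<eta> :: 'w)"
proof -
  obtain ls where ls: "\<forall>l\<in>set ls. length l = 2 \<and> set l \<subseteq> Om 1" "x = (\<Sum>l\<leftarrow>ls. prod_list l)"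
    using Om_generated[OF assms] by auto
  have "set (map (\<lambda>l. (l ! 0, l ! 1)) ls) \<subseteq> Om 1 \<times> Om 1"
    using ls(1) by (force simp: subset_iff)
  moreover have "x = (\<Sum>(\<xi>, \<eta>)\<leftarrow>map (\<lambda>l. (l ! 0, l ! 1)) ls. \<xi> * \<eta>)"
    unfolding ls(2) map_map o_def
    by (rule sum_list_cong) (use ls(1) in \<open>auto simp: length_Suc_conv numeral_2_eq_2 One_nat_def\<close>)
  ultimately show ?thesis by (rule that)
qed

abbreviation J2 where "J2 \<equiv> J_forms J 2"

lemma J2_form: "\<xi> \<in> Om 1 \<Longrightarrow> \<eta> \<in> Om 1 \<Longrightarrow> J2 (\<xi> * \<eta>) = J \<xi> * \<eta> + \<xi> * J \<eta>"
  using J_forms_2[of "[(\<xi>, \<eta>)]"] by simp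

lemma Om_2_form: "\<xi> \<in> Om 1 \<Longrightarrow> \<eta> \<in> Om 1 \<Longrightarrow> \<xi> * \<eta> \<in> (Om 2 :: 'w set)"
  using Om_mult[of \<xi> 1 \<eta> 1] by simp

lemma J2_add: "x \<in> Om 2 \<Longrightarrow> y \<in> Om 2 \<Longrightarrow> J2 (x + y) = J2 x + J2 y"
proof -
  assume "x \<in> Om 2" "y \<in> Om 2"
  then obtain ps qs where "set ps \<subseteq> Om 1 \<times> Om 1" "x = (\<Sum>(\<xi>, \<eta>)\<leftarrow>ps. \<xi> * \<eta>)"
    "set qs \<subseteq> Om 1 \<times> Om 1" "y = (\<Sum>(\<xi>, \<eta>)\<leftarrow>qs. \<xi> * \<eta>)"
    by (metis Om_2_list)
  then show ?thesis
    using J_forms_2[of ps] J_forms_2[of qs] J_forms_2[of "ps @ qs"] by simp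
qed

lemma Om_2_induct [consumes 1, case_names add mult]:
  assumes "x \<in> Om 2" and add: "\<And>x y. x \<in> Om 2 \<Longrightarrow> y \<in> Om 2 \<Longrightarrow> P x \<Longrightarrow> P y \<Longrightarrow> P (x + y :: 'w)"
    and mult: "\<And>\<xi> \<eta>. \<xi> \<in> Om 1 \<Longrightarrow> \<eta> \<in> Om 1 \<Longrightarrow> P (\<xi> * \<eta>)"
  shows "P x"
proof -
  obtain ps where ps: "set ps \<subseteq> Om 1 \<times> Om 1" "x = (\<Sum>(\<xi>, \<eta>)\<leftarrow>ps. \<xi> * \<eta>)"
    using Om_2_list[OF assms(1)] .
  have "P 0" using mult[of 0 0] by (simp add: Om_zero)
  then have "(\<Sum>(\<xi>, \<eta>)\<leftarrow>ps. \<xi> * \<eta>) \<in> Om 2 \<and> P (\<Sum>(\<xi>, \<eta>)\<leftarrow>ps. \<xi> * \<eta>)"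
    using ps(1) by (induction ps) (auto simp: Om_zero Om_add Om_2_form intro: add mult)
  then show ?thesis using ps(2) by blast
qed

lemma J2_cscale: "x \<in> Om 2 \<Longrightarrow> J2 (c *\<^sub>C x) = c *\<^sub>C J2 x"
proof (induction rule: Om_2_induct)
  case (mult \<xi> \<eta>)
  then show ?case
    using J2_form[of "c *\<^sub>C \<xi>" \<eta>]
    by (simp add: cscale_mult_left Om_intros J_simps J2_form cscale_add_right)
qed (simp add: cscale_add_right J2_add Om_intros)

lemma Ompq_10: "Ompq J 1 0 = {\<xi> \<in> Om 1. J \<xi> = \<i> *\<^sub>C \<xi>}"
  by (auto simp: Ompq_def J_forms_1)

lemma Ompq_01: "Ompq J 0 1 = {\<xi> \<in> Om 1. J \<xi> = (- \<i>) *\<^sub>C \<xi>}"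
  by (auto simp: Ompq_def J_forms_1)

lemma Ompq_11: "Ompq J 1 1 = {x \<in> Om 2. J2 x = 0}"
  by (auto simp: Ompq_def)

lemma Ompq_20: "Ompq J 2 0 = {x \<in> Om 2. J2 x = (\<i> * 2) *\<^sub>C x}"
  and Ompq_02: "Ompq J 0 2 = {x \<in> Om 2. J2 x = (- (\<i> * 2)) *\<^sub>C x}"
  by (auto simp: Ompq_def simp del: add_2_eq_Suc add_2_eq_Suc')

text \<open>With \<xi> = f 0 + f 1 of types (0,1) and (1,0), one has J \<xi> = -i f 0 + i f 1.
  Solving these two equations gives the formulas and the uniqueness required by
  \<open>proj\<close>.\<close>

lemma proj_1_eq:
  assumes \<xi>: "\<xi> \<in> Om 1"
  shows "proj J 1 0 \<xi> = (1/2) *\<^sub>C (\<xi> - \<i> *\<^sub>C J \<xi>)" "proj J 0 1 \<xi> = (1/2) *\<^sub>C (\<xi> + \<i> *\<^sub>C J \<xi>)"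
proof -
  let ?P = "(1/2) *\<^sub>C (\<xi> - \<i> *\<^sub>C J \<xi>)" and ?Q = "(1/2) *\<^sub>C (\<xi> + \<i> *\<^sub>C J \<xi>)"
  have in_PQ: "?P \<in> Ompq J 1 0" "?Q \<in> Ompq J 0 1" "?P \<in> Om 1" "?Q \<in> Om 1"
    using \<xi> by (simp_all add: Ompq_10 Ompq_01 Om_intros J_simps J_diff J_J cscale_add_right cscale_diff_right
        cscale_cscale cscale_minus_right cscale_minus_left cscale_one add.commute)
  have "(1/2) *\<^sub>C \<xi> + (1/2) *\<^sub>C \<xi> = \<xi>" by (simp add: cscale_add_left[symmetric] cscale_one)
  then have sum: "?Q + ?P = \<xi>"
    by (simp add: cscale_add_right cscale_diff_right)
  have le1: "(\<forall>k\<le>1. A k) \<longleftrightarrow> A 0 \<and> A 1" for A :: "nat \<Rightarrow> bool"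
    by (auto simp: le_Suc_eq One_nat_def)
  have sum1: "sum f {..1} = f 0 + f 1" for f :: "nat \<Rightarrow> 'w"
    by (simp add: One_nat_def)
  have uniq: "f 1 = ?P \<and> f 0 = ?Q" if f: "f 0 \<in> Ompq J 0 1" "f 1 \<in> Ompq J 1 0" "\<xi> = f 0 + f 1" for f :: "nat \<Rightarrow> 'w"
  proof -
    have f': "f 0 \<in> Om 1" "f 1 \<in> Om 1" "J (f 0) = (- \<i>) *\<^sub>C f 0" "J (f 1) = \<i> *\<^sub>C f 1"
      using f by (simp_all add: Ompq_10 Ompq_01)
    have "(1/2) *\<^sub>C x + (1/2) *\<^sub>C x = x" for x :: 'w by (simp add: cscale_add_left[symmetric] cscale_one)
    then show ?thesis
      using f' by (simp add: f(3) J_simps cscale_add_right cscale_diff_right cscale_cscale cscale_minus_left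
          cscale_minus_right cscale_one)
  qed
  show "proj J 1 0 \<xi> = ?P" "proj J 0 1 \<xi> = ?Q"
    unfolding proj_def by (rule the_equality; simp add: le1 sum1;
      (use in_PQ sum uniq in \<open>force intro!: exI[of _ "\<lambda>k. if k = 0 then ?Q else ?P"]\<close>))+
qed

abbreviation "P \<equiv> proj J 1 0"
abbreviation "Q \<equiv> proj J 0 1"
abbreviation "\<Omega>10 \<equiv> Ompq J 1 0"
abbreviation "\<Omega>01 \<equiv> Ompq J 0 1"

lemma bimod_lin: "bimod_map (\<lambda>\<xi>. c *\<^sub>C (\<xi> + d *\<^sub>C J \<xi>))" "bimod_map (\<lambda>\<xi>. c *\<^sub>C (\<xi> - d *\<^sub>C J \<xi>))"
  by (auto simp: bimod_map_def right_linear_on_def additive_on_def Om_intros J_simps cscale_add_right cscale_diff_right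
      cscale_mult_left cscale_mult_right distrib_left distrib_right left_diff_distrib right_diff_distrib)

lemma bimod_map_cong: "bimod_map f \<Longrightarrow> (\<And>\<xi>. \<xi> \<in> Om 1 \<Longrightarrow> g \<xi> = f \<xi>) \<Longrightarrow> bimod_map g"
  by (auto simp: bimod_map_def right_linear_on_def additive_on_def Om_intros)

lemma bimod_P: "bimod_map P" and bimod_Q: "bimod_map Q"
  by (rule bimod_map_cong[OF bimod_lin(2) proj_1_eq(1)], assumption)
    (rule bimod_map_cong[OF bimod_lin(1) proj_1_eq(2)])

lemmas P_simps = bimod_map_simps[OF bimod_P] and Q_simps = bimod_map_simps[OF bimod_Q]

lemma half: "(1/2) *\<^sub>C x + (1/2) *\<^sub>C x = (x :: 'w)"
  by (simp add: cscale_add_left[symmetric] cscale_one)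

lemma P_in: "\<xi> \<in> Om 1 \<Longrightarrow> P \<xi> \<in> \<Omega>10" and Q_in: "\<xi> \<in> Om 1 \<Longrightarrow> Q \<xi> \<in> \<Omega>01"
  by (simp_all add: proj_1_eq Ompq_10 Ompq_01 Om_intros J_simps J_diff J_J cscale_add_right cscale_diff_right
        cscale_cscale cscale_minus_right cscale_minus_left cscale_one add.commute)

lemma P_plus_Q: "\<xi> \<in> Om 1 \<Longrightarrow> P \<xi> + Q \<xi> = \<xi>"
  using half[of \<xi>] by (simp add: proj_1_eq cscale_add_right cscale_diff_right)

lemma \<Omega>10_D: "\<xi> \<in> \<Omega>10 \<Longrightarrow> \<xi> \<in> Om 1 \<and> J \<xi> = \<i> *\<^sub>C \<xi> \<and> P \<xi> = \<xi> \<and> Q \<xi> = 0"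
  using half[of \<xi>] by (simp add: Ompq_10 proj_1_eq cscale_add_right cscale_diff_right cscale_cscale cscale_minus_left cscale_one)

lemma \<Omega>01_D: "\<xi> \<in> \<Omega>01 \<Longrightarrow> \<xi> \<in> Om 1 \<and> J \<xi> = (- \<i>) *\<^sub>C \<xi> \<and> P \<xi> = 0 \<and> Q \<xi> = \<xi>"
  using half[of \<xi>] by (simp add: Ompq_01 proj_1_eq cscale_add_right cscale_diff_right cscale_cscale cscale_minus_left cscale_minus_right cscale_one)

lemma \<Omega>10_zero: "0 \<in> \<Omega>10" and \<Omega>01_zero: "0 \<in> \<Omega>01"
  using bimod_map_zero[OF bimod_J] by (simp_all add: Ompq_10 Ompq_01 Om_zero)

lemma \<Omega>10_I: "\<xi> \<in> Om 1 \<Longrightarrow> P \<xi> = \<xi> \<Longrightarrow> \<xi> \<in> \<Omega>10" and \<Omega>01_I: "\<xi> \<in> Om 1 \<Longrightarrow> Q \<xi> = \<xi> \<Longrightarrow> \<xi> \<in> \<Omega>01"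
  using P_in Q_in by metis+

lemma \<Omega>10_closed: "\<xi> \<in> \<Omega>10 \<Longrightarrow> \<eta> \<in> \<Omega>10 \<Longrightarrow> \<xi> + \<eta> \<in> \<Omega>10"
  "\<xi> \<in> \<Omega>10 \<Longrightarrow> a \<in> Om 0 \<Longrightarrow> a * \<xi> \<in> \<Omega>10" "\<xi> \<in> \<Omega>10 \<Longrightarrow> a \<in> Om 0 \<Longrightarrow> \<xi> * a \<in> \<Omega>10"
  by (rule \<Omega>10_I; use \<Omega>10_D in \<open>simp add: Om_intros P_simps\<close>)+

lemma \<Omega>01_closed: "\<xi> \<in> \<Omega>01 \<Longrightarrow> \<eta> \<in> \<Omega>01 \<Longrightarrow> \<xi> + \<eta> \<in> \<Omega>01"
  "\<xi> \<in> \<Omega>01 \<Longrightarrow> a \<in> Om 0 \<Longrightarrow> a * \<xi> \<in> \<Omega>01" "\<xi> \<in> \<Omega>01 \<Longrightarrow> a \<in> Om 0 \<Longrightarrow> \<xi> * a \<in> \<Omega>01"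
  by (rule \<Omega>01_I; use \<Omega>01_D in \<open>simp add: Om_intros Q_simps\<close>)+

lemma \<Omega>11_mult: "\<xi> \<in> \<Omega>10 \<Longrightarrow> \<eta> \<in> \<Omega>01 \<Longrightarrow> \<xi> * \<eta> \<in> Ompq J 1 1" "\<xi> \<in> \<Omega>10 \<Longrightarrow> \<eta> \<in> \<Omega>01 \<Longrightarrow> \<eta> * \<xi> \<in> Ompq J 1 1"
  using \<Omega>10_D[of \<xi>] \<Omega>01_D[of \<eta>]
  by (simp_all add: Ompq_11 Om_2_form J2_form cscale_mult_left cscale_mult_right cscale_minus_left)

lemma \<Omega>11_zero: "0 \<in> Ompq J 1 1"
  using \<Omega>11_mult(1)[OF \<Omega>10_zero \<Omega>01_zero] by simp

lemma \<Omega>11_add: "x \<in> Ompq J 1 1 \<Longrightarrow> y \<in> Ompq J 1 1 \<Longrightarrow> x + y \<in> Ompq J 1 1"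
  by (simp add: Ompq_11 J2_add Om_add)

lemma wedge_op_PQ_in: "t \<in> FF \<Longrightarrow> wedge_op P Q t \<in> Ompq J 1 1" and wedge_op_QP_in: "t \<in> FF \<Longrightarrow> wedge_op Q P t \<in> Ompq J 1 1"
  by (induction rule: tens_prod_induct)
    (auto simp: wedge_op_zero wedge_op_add bimod_P bimod_Q \<Omega>11_zero \<Omega>11_add wedge_op_form P_in Q_in \<Omega>11_mult)

lemma proj_11_eqI:
  assumes f: "f0 \<in> Ompq J 0 2" "f1 \<in> Ompq J 1 1" "f2 \<in> Ompq J 2 0"
  shows "proj J 1 1 (f0 + f1 + f2) = f1"
proof -
  let ?x = "f0 + f1 + f2"
  have le2: "(\<forall>k\<le>1 + 1. f k \<in> Ompq J k (1 + 1 - k)) \<longleftrightarrow>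
      f 0 \<in> Ompq J 0 2 \<and> f 1 \<in> Ompq J 1 1 \<and> f 2 \<in> Ompq J 2 0" for f :: "nat \<Rightarrow> 'w"
    by (auto simp: le_Suc_eq One_nat_def numeral_2_eq_2)
  have sum2: "sum f {..1 + 1} = f 0 + f 1 + f 2" for f :: "nat \<Rightarrow> 'w"
    by (simp add: One_nat_def numeral_2_eq_2)
  \<comment> \<open>\<open>J2\<close> has the eigenvalues -2i, 0 and 2i on the three types, so its
    square has -4, 0 and -4, and 1 + \<open>J2\<close>^2 / 4 is the projection onto type (1,1). This
    gives uniqueness of the decomposition.\<close>
  have key: "g 1 = g 0 + g 1 + g 2 + (1/4) *\<^sub>C J2 (J2 (g 0 + g 1 + g 2))"
    if g: "g 0 \<in> Ompq J 0 2" "g 1 \<in> Ompq J 1 1" "g 2 \<in> Ompq J 2 0" for g :: "nat \<Rightarrow> 'w"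
  proof -
    have g0: "g 0 \<in> Om 2" "J2 (g 0) = (- (\<i> * 2)) *\<^sub>C g 0" and g1: "g 1 \<in> Om 2" "J2 (g 1) = 0"
      and g2: "g 2 \<in> Om 2" "J2 (g 2) = (\<i> * 2) *\<^sub>C g 2"
      using g by (simp_all add: Ompq_20 Ompq_02 Ompq_11)
    have "J2 (g 0 + g 1 + g 2) = (- (\<i> * 2)) *\<^sub>C g 0 + (\<i> * 2) *\<^sub>C g 2"
      using g0 g1 g2 by (simp add: J2_add Om_intros)
    then have "J2 (J2 (g 0 + g 1 + g 2)) = (- 4) *\<^sub>C g 0 + (- 4) *\<^sub>C g 2"
      using g0 g2 by (simp add: J2_add J2_cscale Om_intros cscale_cscale algebra_simps)
    then have "(1/4) *\<^sub>C J2 (J2 (g 0 + g 1 + g 2)) = - g 0 - g 2"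
      by (simp add: cscale_add_right cscale_diff_right cscale_cscale cscale_minus_left
          cscale_minus_right cscale_one)
    then show ?thesis by simp
  qed
  show ?thesis
    unfolding proj_def
  proof (rule the_equality)
    show "\<exists>f. (\<forall>k\<le>1 + 1. f k \<in> Ompq J k (1 + 1 - k)) \<and> ?x = (\<Sum>k\<le>1 + 1. f k) \<and> f1 = f 1"
      using f by (intro exI[of _ "\<lambda>k. if k = 0 then f0 else if k = 1 then f1 else f2"]) (simp only: le2 sum2, simp)
    fix y assume "\<exists>f. (\<forall>k\<le>1 + 1. f k \<in> Ompq J k (1 + 1 - k)) \<and> ?x = (\<Sum>k\<le>1 + 1. f k) \<and> y = f 1"
    then obtain g :: "nat \<Rightarrow> 'w" where g: "g 0 \<in> Ompq J 0 2" "g 1 \<in> Ompq J 1 1" "g 2 \<in> Ompq J 2 0" "?x = g 0 + g 1 + g 2" "y = g 1"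
      unfolding le2 sum2 by blast
    show "y = f1"
      using key[of g] key[of "\<lambda>k. if k = 0 then f0 else if k = 1 then f1 else f2"] f g by simp
  qed
qed

text \<open>Splitting both factors by type, the products of equal types lie in degrees (2,0) and
  (0,2), and exactly the two mixed products are of type (1,1).\<close>

lemma proj_11_wedge:
  assumes t: "t \<in> FF"
  shows "proj J 1 1 (wedge_op (\<lambda>x. x) (\<lambda>x. x) t) = wedge_op P Q t + wedge_op Q P t"
proof -
  have 2: "wedge_op P P t \<in> Ompq J 2 0" and 0: "wedge_op Q Q t \<in> Ompq J 0 2"
    and sum: "wedge_op (\<lambda>x. x) (\<lambda>x. x) t = wedge_op Q Q t + (wedge_op P Q t + wedge_op Q P t) + wedge_op P P t"
  proof -
    have "wedge_op P P t \<in> Ompq J 2 0 \<and> wedge_op Q Q t \<in> Ompq J 0 2 \<and>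
        wedge_op (\<lambda>x. x) (\<lambda>x. x) t = wedge_op Q Q t + (wedge_op P Q t + wedge_op Q P t) + wedge_op P P t"
      using t
    proof (induction rule: tens_prod_induct)
      case zero
      have "J2 0 = 0" using \<Omega>11_zero by (simp add: Ompq_11)
      then show ?case by (simp add: wedge_op_zero bimod_P bimod_Q bimod_map_id Ompq_20 Ompq_02 Om_zero)
    next
      case (add x y)
      then show ?case
        by (auto simp: wedge_op_add bimod_P bimod_Q bimod_map_id Ompq_20 Ompq_02 Om_intros J2_add cscale_add_right cscale_minus_left
            algebra_simps)
    next
      case (mult x y)
      then obtain \<xi> \<eta> where [simp]: "x = form \<xi>" "y = form \<eta>" and \<xi>: "\<xi> \<in> Om 1" and \<eta>: "\<eta> \<in> Om 1"
        by blast
      note DP = \<Omega>10_D[OF P_in[OF \<xi>]] \<Omega>10_D[OF P_in[OF \<eta>]] and DQ = \<Omega>01_D[OF Q_in[OF \<xi>]] \<Omega>01_D[OF Q_in[OF \<eta>]]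
      have "\<xi> * \<eta> = (P \<xi> + Q \<xi>) * (P \<eta> + Q \<eta>)"
        using \<xi> \<eta> by (simp add: P_plus_Q)
      also have "\<dots> = Q \<xi> * Q \<eta> + (P \<xi> * Q \<eta> + Q \<xi> * P \<eta>) + P \<xi> * P \<eta>"
        by (simp add: algebra_simps)
      finally have "\<xi> * \<eta> = Q \<xi> * Q \<eta> + (P \<xi> * Q \<eta> + Q \<xi> * P \<eta>) + P \<xi> * P \<eta>" .
      moreover have "P \<xi> * P \<eta> \<in> Ompq J 2 0" "Q \<xi> * Q \<eta> \<in> Ompq J 0 2"
        using DP DQ by (simp_all add: Ompq_20 Ompq_02 Om_2_form J2_form cscale_mult_left cscale_mult_right
            cscale_add_left[symmetric] mult.commute[of 2 \<i>])
      ultimately show ?case using \<xi> \<eta>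
        by (simp add: wedge_form wedge_op_form bimod_P bimod_Q)
    qed
    then show "wedge_op P P t \<in> Ompq J 2 0" "wedge_op Q Q t \<in> Ompq J 0 2"
      "wedge_op (\<lambda>x. x) (\<lambda>x. x) t = wedge_op Q Q t + (wedge_op P Q t + wedge_op Q P t) + wedge_op P P t" by auto
  qed
  show ?thesis
    unfolding sum by (rule proj_11_eqI[OF 0 \<Omega>11_add[OF wedge_op_PQ_in[OF t] wedge_op_QP_in[OF t]] 2])
qed

end

section \<open>The holomorphic calculus\<close>

locale holomorphic_conn = almost_cpx J + bimod_conn sq sinv
  for J :: "'w::star_dga \<Rightarrow> 'w" and sq :: "'w \<Rightarrow> 'w tens" and sinv :: "'w tens \<Rightarrow> 'w tens" +
  assumes a: "bij_betw wedge (form ` Ompq J 1 0 \<otimes>\<^sub>A form ` Ompq J 0 1) (Ompq J 1 1)"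
    and b: "\<forall>\<xi>\<in>Om 1. map_fst J (sq \<xi>) = sq (J \<xi>)"
    and c: "\<forall>\<xi>\<in>Om 1. proj J 1 1 (exd \<xi> + wedge (sq \<xi>)) = 0"
    and d: "\<forall>t\<in>form ` Om 1 \<otimes>\<^sub>A form ` Om 1. proj J 1 1 (wedge (sinv t)) =
      - wedge2 (proj J 0 1) (proj J 1 0) t - wedge2 (proj J 1 0) (proj J 0 1) t"
begin

abbreviation "F10 \<equiv> form ` \<Omega>10"
abbreviation "F01 \<equiv> form ` \<Omega>01"

lemma F10_F01_FF: "t \<in> F10 \<otimes>\<^sub>A F01 \<Longrightarrow> t \<in> FF"
  using tens_prod_mono[of F10 Fm F01 Fm] \<Omega>10_D \<Omega>01_D by blast

lemma F01_Fm: "F01 \<subseteq> Fm" using \<Omega>01_D by blast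

lemma F01_closed: "0 \<in> F01" "x \<in> F01 \<Longrightarrow> y \<in> F01 \<Longrightarrow> x + y \<in> F01" "x \<in> F01 \<Longrightarrow> e \<in> Om 0 \<Longrightarrow> scal e * x \<in> F01"
proof -
  show "0 \<in> F01" using \<Omega>01_zero form_zero by (metis image_eqI)
  show "x \<in> F01 \<Longrightarrow> y \<in> F01 \<Longrightarrow> x + y \<in> F01"
    using \<Omega>01_D \<Omega>01_closed(1) by (auto simp: form_add[symmetric])
  show "x \<in> F01 \<Longrightarrow> e \<in> Om 0 \<Longrightarrow> scal e * x \<in> F01"
    using \<Omega>01_D \<Omega>01_closed(2) by (auto simp: scal_form)
qed

subsection \<open>Compatibility of the covariant derivative with the complex structure\<close>

lemma scal_unit: "\<xi> \<in> Om 1 \<Longrightarrow> form (e *\<^sub>C \<xi>) = form \<xi> * scal (e *\<^sub>C 1)"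
  by (simp add: form_scal Om_intros mult_cscale_1)

lemma sq_cscale: "\<xi> \<in> Om 1 \<Longrightarrow> sq (e *\<^sub>C \<xi>) = sq \<xi> * scal (e *\<^sub>C 1)"
  using sq_mult[of \<xi> "e *\<^sub>C 1"] by (simp add: Om_intros mult_cscale_1 exd_cscale)

lemma eigen_zero: "\<i> *\<^sub>C x = (- \<i>) *\<^sub>C x \<Longrightarrow> x = (0 :: 'w)"
proof -
  assume "\<i> *\<^sub>C x = (- \<i>) *\<^sub>C x"
  then have "\<i> *\<^sub>C x + \<i> *\<^sub>C x = 0"
    unfolding cscale_minus_left eq_neg_iff_add_eq_0 .
  then have "(\<i> + \<i>) *\<^sub>C x = 0" unfolding cscale_add_left .
  then show ?thesis unfolding cscale_eq_0_iff by simp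
qed

lemma fmap_J_sq: "\<xi> \<in> Om 1 \<Longrightarrow> fmap J (sq \<xi>) = sq (J \<xi>)"
  using b map_fst_eq[OF bimod_J FF_FT[OF sq_in]] by simp

lemma P_J: "\<xi> \<in> Om 1 \<Longrightarrow> P (J \<xi>) = \<i> *\<^sub>C P \<xi>" and Q_J: "\<xi> \<in> Om 1 \<Longrightarrow> Q (J \<xi>) = (- \<i>) *\<^sub>C Q \<xi>"
  by (simp_all add: proj_1_eq J_simps J_J cscale_diff_right cscale_add_right cscale_cscale
      cscale_minus_left cscale_minus_right cscale_one add.commute)

lemma wedge_op_fmap_J: "t \<in> FF \<Longrightarrow> wedge_op P Q (fmap J t) = \<i> *\<^sub>C wedge_op P Q t" "t \<in> FF \<Longrightarrow> wedge_op Q P (fmap J t) = (- \<i>) *\<^sub>C wedge_op Q P t"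
  by (induction rule: tens_prod_induct)
      (auto simp: fmap_zero[OF bimod_J] fmap_add[OF bimod_J]
        wedge_op_zero wedge_op_add bimod_P bimod_Q cscale_add_right fmap_form[OF bimod_J] wedge_op_form J_simps P_J Q_J cscale_mult_left)

text \<open>By (b), applying J to the left factor of \<box>\<xi> multiplies it by -i, the eigenvalue
  of \<xi>; after projecting that factor to type (1,0) it multiplies it by i. Hence the mixed
  component vanishes.\<close>

lemma wedge_op_PQ_sq: "\<xi> \<in> \<Omega>01 \<Longrightarrow> wedge_op P Q (sq \<xi>) = 0"
  using wedge_op_fmap_J(1)[OF sq_in, of \<xi>] \<Omega>01_D[of \<xi>]
  by (intro eigen_zero) (simp add: fmap_J_sq sq_cscale wedge_op_scal_right bimod_P bimod_Q sq_in Om_intros mult_cscale_1)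

lemma wedge_op_QP_sq: "\<xi> \<in> \<Omega>10 \<Longrightarrow> wedge_op Q P (sq \<xi>) = 0"
  using wedge_op_fmap_J(2)[OF sq_in, of \<xi>] \<Omega>10_D[of \<xi>]
  by (intro eigen_zero) (simp add: fmap_J_sq sq_cscale wedge_op_scal_right bimod_P bimod_Q sq_in Om_intros mult_cscale_1)

text \<open>Carries statements about the type of \<box>\<xi> over to \<sigma>^-1, as the type of
  \<xi> is preserved by multiplication with \<open>e\<close>.\<close>

lemma sinv_exd: "e \<in> Om 0 \<Longrightarrow> \<xi> \<in> Om 1 \<Longrightarrow> sinv (form (exd e) * form \<xi>) = sq (e * \<xi>) - scal e * sq \<xi>"
  by (simp add: sq_lmult)

lemma wedge_op_PQ_sinv: "e \<in> Om 0 \<Longrightarrow> \<xi> \<in> \<Omega>01 \<Longrightarrow> wedge_op P Q (sinv (form (exd e) * form \<xi>)) = 0"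
  using \<Omega>01_D[of \<xi>]
  by (simp add: sinv_exd wedge_op_diff bimod_P bimod_Q wedge_op_scal sq_in wedge_op_PQ_sq \<Omega>01_closed)

lemma wedge_op_QP_sinv: "e \<in> Om 0 \<Longrightarrow> \<xi> \<in> \<Omega>10 \<Longrightarrow> wedge_op Q P (sinv (form (exd e) * form \<xi>)) = 0"
  using \<Omega>10_D[of \<xi>]
  by (simp add: sinv_exd wedge_op_diff bimod_P bimod_Q wedge_op_scal sq_in wedge_op_QP_sq \<Omega>10_closed)

lemma wedge_op_sinv: "t \<in> FF \<Longrightarrow> wedge_op P Q (sinv t) + wedge_op Q P (sinv t) = - wedge_op Q P t - wedge_op P Q t"
  using d by (simp add: wedge_eq wedge2_eq bimod_P bimod_Q sinv_in proj_11_wedge)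

text \<open>Condition (c) at an exact form: the summand d vanishes since d^2 = 0, and the (1,1)-part
  of the wedge splits by \<open>proj_11_wedge\<close>.\<close>

lemma wedge_op_sq_exd: "e \<in> Om 0 \<Longrightarrow> wedge_op P Q (sq (exd e)) + wedge_op Q P (sq (exd e)) = 0"
  using bspec[OF c Om_exd0[of e]] by (simp add: wedge_eq sq_in proj_11_wedge Om_intros exd_exd)

subsection \<open>Holomorphic vector fields\<close>

definition vproj :: "('w \<Rightarrow> 'w) \<Rightarrow> 'w \<Rightarrow> 'w" where
  "vproj v = (\<lambda>\<xi>. if \<xi> \<in> Om 1 then v (P \<xi>) else 0)"

lemma vproj_apply: "\<xi> \<in> Om 1 \<Longrightarrow> vproj v \<xi> = v (P \<xi>)"
  by (simp add: vproj_def)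

lemma Vec10_D: "v \<in> Vec10 J \<Longrightarrow> v \<in> Vec"
  by (simp add: Vec10_def)

lemma PQ_Om: "\<xi> \<in> Om 1 \<Longrightarrow> P \<xi> \<in> Om 1" "\<xi> \<in> Om 1 \<Longrightarrow> Q \<xi> \<in> Om 1"
  using P_in Q_in \<Omega>10_D \<Omega>01_D by blast+

lemma Vec10_Q:
  assumes v: "v \<in> Vec10 J" and \<xi>: "\<xi> \<in> Om 1"
  shows "v (Q \<xi>) = 0"
proof -
  have "v (J (Q \<xi>)) = \<i> *\<^sub>C v (Q \<xi>)" using v PQ_Om \<xi> by (simp add: Vec10_def)
  moreover have "v (J (Q \<xi>)) = (- \<i>) *\<^sub>C v (Q \<xi>)"
    using \<Omega>01_D[OF Q_in[OF \<xi>]] Vec_cscale[OF Vec10_D[OF v]] by metis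
  ultimately show ?thesis by (intro eigen_zero) simp
qed

lemma Vec10_01: "v \<in> Vec10 J \<Longrightarrow> \<xi> \<in> \<Omega>01 \<Longrightarrow> v \<xi> = 0"
  using Vec10_Q[of v \<xi>] \<Omega>01_D[of \<xi>] by simp

lemma Vec10_P: "v \<in> Vec10 J \<Longrightarrow> \<xi> \<in> Om 1 \<Longrightarrow> v (P \<xi>) = v \<xi>"
  using Vec_add[OF Vec10_D, of v "P \<xi>" "Q \<xi>"] by (simp add: PQ_Om P_plus_Q Vec10_Q)

lemma vproj_Vec: "v \<in> Vec \<Longrightarrow> vproj v \<in> Vec"
  by (rule VecI) (auto simp: vproj_def Vec_in Vec_add Vec_mult P_simps PQ_Om Om_intros)

lemma vproj_in:
  assumes v: "v \<in> Vec"
  shows "vproj v \<in> Vec10 J"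
proof -
  have "vproj v (J \<xi>) = \<i> *\<^sub>C vproj v \<xi>" if \<xi>: "\<xi> \<in> Om 1" for \<xi>
    using v \<xi> by (simp add: vproj_apply J_simps P_J Vec_cscale PQ_Om)
  then show ?thesis using vproj_Vec[OF v] by (simp add: Vec10_def)
qed

lemma vproj_id: "v \<in> Vec10 J \<Longrightarrow> vproj v = v"
  by (rule ext) (simp add: vproj_def Vec10_P Vec_notin[OF Vec10_D])

sublocale V10: vec_proj "Vec10 J" vproj
proof
  show "vproj (\<lambda>\<xi>. u \<xi> + v \<xi>) = (\<lambda>\<xi>. vproj u \<xi> + vproj v \<xi>)" for u v
    by (auto simp: vproj_def)
  show "vproj (vec_lact e v) = vec_lact e (vproj v)" for v e
    by (auto simp: vproj_def vec_lact_def PQ_Om)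
  show "vproj (vec_ract v e) = vec_ract (vproj v) e" if "e \<in> Om 0" for v e
    using that by (auto simp: vproj_def vec_ract_def PQ_Om P_simps Om_intros)
qed (use Vec10_D vproj_in vproj_id in blast)+

text \<open>Projecting the vector factors to type (1,0) gives a tensor whose value at \<xi> is that
  of \<open>t\<close> at \<open>P \<xi>\<close>. If \<open>t\<close> kills the (0,1)-forms, the
  values agree with those of \<open>t\<close>, so \<open>rctr_ext\<close> identifies the
  two.\<close>

lemma FV10_I:
  assumes t: "t \<in> FV" and z: "\<And>\<xi>. \<xi> \<in> \<Omega>01 \<Longrightarrow> rctr \<xi> t = 0"
  shows "t \<in> Fm \<otimes>\<^sub>A vect ` Vec10 J"
proof -
  have "\<exists>s\<in>Fm \<otimes>\<^sub>A vect ` Vec10 J. \<forall>\<xi>\<in>Om 1. rctr \<xi> s = rctr (P \<xi>) t"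
    using t
  proof (induction rule: tens_prod_induct)
    case zero
    show ?case by (rule bexI[OF _ tens_prod_zero]) (simp add: rctr_simps)
  next
    case (add x y)
    then obtain s s' where "s \<in> Fm \<otimes>\<^sub>A vect ` Vec10 J" "\<forall>\<xi>\<in>Om 1. rctr \<xi> s = rctr (P \<xi>) x"
      "s' \<in> Fm \<otimes>\<^sub>A vect ` Vec10 J" "\<forall>\<xi>\<in>Om 1. rctr \<xi> s' = rctr (P \<xi>) y" by blast
    then show ?case by (intro bexI[of _ "s + s'"]) (simp_all add: rctr_simps tens_prod_add)
  next
    case (mult x y)
    then obtain \<omega> v where "x = form \<omega>" "y = vect v" "\<omega> \<in> Om 1" "v \<in> Vec" by blast
    then show ?case
      by (intro bexI[of _ "form \<omega> * vect (vproj v)"])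
        (simp_all add: rctr_simps tens_prodI vproj_in vproj_Vec PQ_Om vproj_apply)
  qed
  then obtain s where s: "s \<in> Fm \<otimes>\<^sub>A vect ` Vec10 J" "\<forall>\<xi>\<in>Om 1. rctr \<xi> s = rctr (P \<xi>) t" by blast
  have "t = s"
  proof (rule rctr_ext[OF fgp t])
    show "s \<in> FV" using s(1) tens_prod_mono[of Fm Fm "vect ` Vec10 J" VecT] Vec10_D by blast
    show "rctr \<xi> t = rctr \<xi> s" if \<xi>: "\<xi> \<in> Om 1" for \<xi>
      using rctr_add[OF t, of "P \<xi>" "Q \<xi>"] s(2) z[OF Q_in[OF \<xi>]] \<xi> by (simp add: PQ_Om P_plus_Q)
  qed
  then show ?thesis using s(1) by simp
qed

text \<open>The eigenvalue argument again: applying J to the left factor contributes i, because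
  \<open>v\<close> has type (1,0), while (b) makes it -i, because \<xi> has type (0,1).\<close>

lemma ctr_sq_01:
  assumes v: "v \<in> Vec10 J" and \<xi>: "\<xi> \<in> \<Omega>01"
  shows "ctr v (sq \<xi>) = 0"
proof -
  note vV = Vec10_D[OF v] and \<xi>' = \<Omega>01_D[OF \<xi>]
  have J: "ctr v (fmap J t) = ctr v t * scal (\<i> *\<^sub>C 1)" if "t \<in> FF" for t
    using that
  proof (induction rule: tens_prod_induct)
    case (mult x y)
    then obtain \<omega> \<eta> where [simp]: "x = form \<omega>" "y = form \<eta>" "\<omega> \<in> Om 1" "\<eta> \<in> Om 1" by blast
    have "v (J \<omega>) = \<i> *\<^sub>C v \<omega>" using v by (simp add: Vec10_def)
    then show ?case
      using vV by (simp add: fmap_form[OF bimod_J] ctr_form J_simps scal_form form_scal Vec_in Om_intros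
          cscale_mult_left mult_cscale_1)
  qed (simp_all add: vV ctr_zero ctr_add fmap_zero[OF bimod_J]
      fmap_add[OF bimod_J] distrib_right)
  obtain \<omega> where \<omega>: "ctr v (sq \<xi>) = form \<omega>" "\<omega> \<in> Om 1"
    using ctr_FF[OF vV sq_in] \<xi>' by blast
  have "form \<omega> * scal (\<i> *\<^sub>C 1) = ctr v (sq (J \<xi>))"
    using J[OF sq_in, of \<xi>] \<xi>' by (simp add: fmap_J_sq \<omega>)
  also have "\<dots> = form \<omega> * scal ((- \<i>) *\<^sub>C 1)"
    using \<xi>' vV by (simp add: sq_cscale ctr_mult FF_FT sq_in \<omega> del: cscale_minus_left)
  finally have "\<i> *\<^sub>C \<omega> = (- \<i>) *\<^sub>C \<omega>"
    using \<omega>(2) by (intro form_inj) (simp_all add: scal_unit Om_intros)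
  from eigen_zero[OF this] show ?thesis using \<omega>(1) by simp
qed

text \<open>One-forms are sums of \<open>e * exd f\<close>. On such a form \<sigma>^-1 is a
  combination of \<box>(f \<xi>) and \<box>\<xi>, both with an argument of type (0,1), and the
  scalars are absorbed into \<open>v\<close> from the right.\<close>

lemma ctr_sinv_01: "v \<in> Vec10 J \<Longrightarrow> \<xi> \<in> \<Omega>01 \<Longrightarrow> \<omega> \<in> Om 1 \<Longrightarrow> ctr v (sinv (form \<omega> * form \<xi>)) = 0"
proof -
  assume v: "v \<in> Vec10 J" and \<xi>: "\<xi> \<in> \<Omega>01" and "\<omega> \<in> Om 1"
  then obtain ps where ps: "set ps \<subseteq> Om 0 \<times> Om 0" "\<omega> = (\<Sum>(a, b)\<leftarrow>ps. a * exd b)"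
    using Om1_exact by blast
  note vV = Vec10_D[OF v] and \<xi>' = \<Omega>01_D[OF \<xi>]
  have 1: "ctr v (sinv (form (e * exd f) * form \<xi>)) = 0" if ef: "e \<in> Om 0" "f \<in> Om 0" for e f
  proof -
    have "form (e * exd f) * form \<xi> = scal e * (form (exd f) * form \<xi>)"
      using ef by (simp add: scal_mult_form Om_intros)
    then have "sinv (form (e * exd f) * form \<xi>) = scal e * (sq (f * \<xi>) - scal f * sq \<xi>)"
      using ef \<xi>' by (simp add: sinv_scal tens_prodI Om_intros sinv_exd)
    then have "ctr v (sinv (form (e * exd f) * form \<xi>)) =
        ctr (vec_ract v e) (sq (f * \<xi>)) - ctr (vec_ract (vec_ract v e) f) (sq \<xi>)"
      using ef vV by (simp add: ctr_ract[symmetric] ctr_diff vec_ract_in)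
    then show ?thesis
      using ef v \<xi> by (simp add: ctr_sq_01 V10.V_ract \<Omega>01_closed)
  qed
  have "(\<Sum>(a, b)\<leftarrow>ps. a * exd b) \<in> Om 1 \<and> ctr v (sinv (form (\<Sum>(a, b)\<leftarrow>ps. a * exd b) * form \<xi>)) = 0"
    using ps(1)
  proof (induction ps)
    case Nil
    then show ?case using vV by (simp add: Om_zero sinv_zero ctr_zero)
  next
    case (Cons q ps)
    then show ?case
      using vV \<xi>' by (auto simp: Om_intros form_add distrib_right sinv_add tens_prodI ctr_add 1)
  qed
  then show ?thesis using ps(2) by simp
qed

text \<open>By \<open>FV10_I\<close> it is enough to evaluate at (0,1)-forms, where the contractions
  with \<box> and \<sigma>^-1 vanish thanks to (b).\<close>

sublocale V10: vec_sub sq sinv "Vec10 J" vproj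
proof
  show "sq_vec sq v \<in> Fm \<otimes>\<^sub>A vect ` Vec10 J" if v: "v \<in> Vec10 J" for v
  proof (rule FV10_I[OF sq_vec_in[OF Vec10_D[OF v]]])
    show "rctr \<xi> (sq_vec sq v) = 0" if "\<xi> \<in> \<Omega>01" for \<xi>
      using v that \<Omega>01_D[OF that] by (simp add: rctr_sq_vec Vec10_D Vec10_01 ctr_sq_01)
  qed
  show "sigma_at v \<omega> \<in> Fm \<otimes>\<^sub>A vect ` Vec10 J" if v: "v \<in> Vec10 J" and \<omega>: "\<omega> \<in> Om 1" for v \<omega>
  proof (rule FV10_I[OF sigma_at_in[OF Vec10_D[OF v] \<omega>]])
    show "rctr \<xi> (sigma_at v \<omega>) = 0" if "\<xi> \<in> \<Omega>01" for \<xi>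
      using v \<omega> that \<Omega>01_D[OF that] by (simp add: rctr_sigma_at Vec10_D ctr_sinv_01)
  qed
qed

subsection \<open>The inverse of the wedge product\<close>

lemma phi_wedge:
  assumes t: "t \<in> F10 \<otimes>\<^sub>A F01"
  shows "phi J (wedge_op (\<lambda>x. x) (\<lambda>x. x) t) = t"
proof -
  have "phi J (wedge t) = t"
    unfolding phi_def by (rule inv_into_f_f[OF bij_betw_imp_inj_on[OF a] t])
  then show ?thesis by (simp add: wedge_eq F10_F01_FF[OF t])
qed

lemma \<Omega>11_E:
  assumes "z \<in> Ompq J 1 1"
  obtains t where "t \<in> F10 \<otimes>\<^sub>A F01" "wedge_op (\<lambda>x. x) (\<lambda>x. x) t = z" "phi J z = t"
proof -
  obtain t where t: "t \<in> F10 \<otimes>\<^sub>A F01" "z = wedge t"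
    using a assms unfolding bij_betw_def by blast
  then have "wedge_op (\<lambda>x. x) (\<lambda>x. x) t = z" by (simp add: wedge_eq F10_F01_FF)
  then show ?thesis using that[of t] t phi_wedge by blast
qed

definition ev_phi :: "('w \<Rightarrow> 'w) \<Rightarrow> 'w \<Rightarrow> 'w tens" where
  "ev_phi u z = ctr u (phi J z)"

lemma ev_phi_add:
  assumes u: "u \<in> Vec" and y: "y \<in> Ompq J 1 1" and z: "z \<in> Ompq J 1 1"
  shows "ev_phi u (y + z) = ev_phi u y + ev_phi u z"
proof -
  obtain s t where "s \<in> F10 \<otimes>\<^sub>A F01" "wedge_op (\<lambda>x. x) (\<lambda>x. x) s = y" "phi J y = s"
    "t \<in> F10 \<otimes>\<^sub>A F01" "wedge_op (\<lambda>x. x) (\<lambda>x. x) t = z" "phi J z = t"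
    using \<Omega>11_E[OF y] \<Omega>11_E[OF z] by metis
  then show ?thesis
    using u phi_wedge[of "s + t"] by (simp add: ev_phi_def tens_prod_add wedge_op_add bimod_map_id ctr_add)
qed

lemma ev_phi_zero: "u \<in> Vec \<Longrightarrow> ev_phi u 0 = 0"
  using ev_phi_add[OF _ \<Omega>11_zero \<Omega>11_zero] by simp

lemma \<Omega>11_uminus: "z \<in> Ompq J 1 1 \<Longrightarrow> - z \<in> Ompq J 1 1"
  using J2_cscale[of z "- 1"] by (simp add: Ompq_11 Om_uminus cscale_minus_left cscale_one)

lemma ev_phi_uminus: "u \<in> Vec \<Longrightarrow> z \<in> Ompq J 1 1 \<Longrightarrow> ev_phi u (- z) = - ev_phi u z"
  using ev_phi_add[of u z "- z"] ev_phi_zero[of u] \<Omega>11_uminus[of z] by (simp add: eq_neg_iff_add_eq_0 add.commute)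

text \<open>By (a), \<open>z\<close> is the wedge of some \<open>t\<close>, and the wedge is a
  bimodule map. So \<open>e * z\<close> is the wedge of \<open>e t\<close>, which gives the
  membership as well as the value of \<phi>.\<close>

lemma \<Omega>11_scal:
  assumes z: "z \<in> Ompq J 1 1" and e: "e \<in> Om 0"
  shows "e * z \<in> Ompq J 1 1 \<and> phi J (e * z) = scal e * phi J z"
proof -
  obtain t where t: "t \<in> F10 \<otimes>\<^sub>A F01" "wedge_op (\<lambda>x. x) (\<lambda>x. x) t = z" "phi J z = t" using \<Omega>11_E[OF z] .
  have et: "scal e * t \<in> F10 \<otimes>\<^sub>A F01"
    using t(1) by (rule tens_prod_left) (use e \<Omega>10_D \<Omega>10_closed in \<open>auto simp: scal_form\<close>)
  have "wedge_op (\<lambda>x. x) (\<lambda>x. x) (scal e * t) = e * z"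
    using t e by (simp add: wedge_op_scal bimod_map_id F10_F01_FF)
  moreover have "wedge_op (\<lambda>x. x) (\<lambda>x. x) (scal e * t) \<in> Ompq J 1 1"
    using bij_betw_apply[OF a et] by (simp add: wedge_eq F10_F01_FF[OF et])
  ultimately show ?thesis using phi_wedge[OF et] t(3) by simp
qed

lemma \<Omega>11_scal_right:
  assumes z: "z \<in> Ompq J 1 1" and e: "e \<in> Om 0"
  shows "z * e \<in> Ompq J 1 1 \<and> phi J (z * e) = phi J z * scal e"
proof -
  obtain t where t: "t \<in> F10 \<otimes>\<^sub>A F01" "wedge_op (\<lambda>x. x) (\<lambda>x. x) t = z" "phi J z = t" using \<Omega>11_E[OF z] .
  have et: "t * scal e \<in> F10 \<otimes>\<^sub>A F01"
    using t(1) by (rule tens_prod_right) (use e \<Omega>01_D \<Omega>01_closed in \<open>auto simp: form_scal\<close>)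
  have "wedge_op (\<lambda>x. x) (\<lambda>x. x) (t * scal e) = z * e"
    using t e by (simp add: wedge_op_scal_right bimod_map_id F10_F01_FF)
  moreover have "wedge_op (\<lambda>x. x) (\<lambda>x. x) (t * scal e) \<in> Ompq J 1 1"
    using bij_betw_apply[OF a et] by (simp add: wedge_eq F10_F01_FF[OF et])
  ultimately show ?thesis using phi_wedge[OF et] t(3) by simp
qed

lemma phi_FT: "z \<in> Ompq J 1 1 \<Longrightarrow> phi J z \<in> FT"
  using \<Omega>11_E F10_F01_FF FF_FT by metis

lemma ev_phi_in:
  assumes u: "u \<in> Vec" and z: "z \<in> Ompq J 1 1"
  shows "ev_phi u z \<in> F01"
proof -
  have "ctr u t \<in> F01" if "t \<in> F10 \<otimes>\<^sub>A F01" for t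
    using that
  proof (induction rule: tens_prod_induct)
    case (mult x y)
    then obtain \<xi> where "x = form \<xi>" "\<xi> \<in> \<Omega>10" by blast
    then show ?case using u mult \<Omega>10_D F01_closed by (simp add: ctr_form Vec_in)
  qed (use u F01_closed in \<open>simp_all add: ctr_zero ctr_add\<close>)
  then show ?thesis using \<Omega>11_E[OF z] unfolding ev_phi_def by metis
qed

lemma ev_phi_plus: "u \<in> Vec \<Longrightarrow> v \<in> Vec \<Longrightarrow> ev_phi (\<lambda>\<xi>. u \<xi> + v \<xi>) z = ev_phi u z + ev_phi v z"
  by (simp add: ev_phi_def ctr_plus)

lemma ev_phi_lact: "u \<in> Vec \<Longrightarrow> e \<in> Om 0 \<Longrightarrow> ev_phi (vec_lact e u) z = scal e * ev_phi u z"
  by (simp add: ev_phi_def ctr_lact)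

lemma ev_phi_ract: "u \<in> Vec \<Longrightarrow> e \<in> Om 0 \<Longrightarrow> z \<in> Ompq J 1 1 \<Longrightarrow> ev_phi (vec_ract u e) z = ev_phi u (e * z)"
  by (simp add: ev_phi_def ctr_ract \<Omega>11_scal)

lemma ev_phi_mult: "u \<in> Vec \<Longrightarrow> e \<in> Om 0 \<Longrightarrow> z \<in> Ompq J 1 1 \<Longrightarrow> ev_phi u (z * e) = ev_phi u z * scal e"
  by (simp add: ev_phi_def \<Omega>11_scal_right ctr_mult phi_FT)

lemma ev_phi_form: "u \<in> Vec \<Longrightarrow> \<xi> \<in> \<Omega>10 \<Longrightarrow> \<eta> \<in> \<Omega>01 \<Longrightarrow> ev_phi u (\<xi> * \<eta>) = scal (u \<xi>) * form \<eta>"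
  using phi_wedge[of "form \<xi> * form \<eta>"] \<Omega>10_D[of \<xi>] \<Omega>01_D[of \<eta>]
  by (simp add: ev_phi_def tens_prodI wedge_form ctr_form)

text \<open>Since \<open>u\<close> is of type \<open>(1,0)\<close>, only the \<open>(1,0) \<otimes> (0,1)\<close> part survives on the left.\<close>

lemma fmap_Q_ctr:
  assumes u: "u \<in> Vec10 J" and "t \<in> FF"
  shows "fmap Q (ctr u t) = ev_phi u (wedge_op P Q t)"
proof -
  note uV = Vec10_D[OF u]
  have "t \<in> FF \<and> fmap Q (ctr u t) = ev_phi u (wedge_op P Q t)"
    using \<open>t \<in> FF\<close>
  proof (induction rule: tens_prod_induct)
    case zero
    then show ?case using uV
      by (simp add: ctr_zero wedge_op_zero bimod_P bimod_Q ev_phi_zero fmap_zero[OF bimod_Q] tens_prod_zero)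
  next
    case (add x y)
    then show ?case using uV
      by (simp add: ctr_add wedge_op_add bimod_P bimod_Q ev_phi_add fmap_add[OF bimod_Q] wedge_op_PQ_in tens_prod_add)
  next
    case (mult x y)
    then obtain \<xi> \<eta> where [simp]: "x = form \<xi>" "y = form \<eta>" "\<xi> \<in> Om 1" "\<eta> \<in> Om 1" by blast
    show ?case using uV u
      by (simp add: ctr_form wedge_op_form bimod_P bimod_Q ev_phi_form P_in Q_in scal_form Vec_in fmap_form1 Om_intros
          Q_simps PQ_Om Vec10_P tens_prodI)
  qed
  then show ?thesis ..
qed

subsection \<open>The key identities\<close>

text \<open>For \<xi> of type (0,1), (b) removes the \<open>P Q\<close> component on the left of
  (d), and \<open>P \<xi> = 0\<close> removes one term on the right. What remains is
  -\<open>P (exd e) * \<xi>\<close>, on which \<phi> is explicit.\<close>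

lemma ev_phi_sinv_01:
  assumes u: "u \<in> Vec10 J" and e: "e \<in> Om 0" and \<xi>: "\<xi> \<in> \<Omega>01"
  shows "ev_phi u (wedge_op Q P (sinv (form (exd e) * form \<xi>))) = - (scal (u (exd e)) * form \<xi>)"
proof -
  note \<xi>' = \<Omega>01_D[OF \<xi>]
  have "form (exd e) * form \<xi> \<in> FF" using e \<xi>' by (simp add: tens_prodI Om_intros)
  from wedge_op_sinv[OF this] have "wedge_op Q P (sinv (form (exd e) * form \<xi>)) = - (P (exd e) * \<xi>)"
    using e \<xi> \<xi>' by (simp add: wedge_op_PQ_sinv wedge_op_form bimod_P bimod_Q Om_intros)
  then show ?thesis
    using u e \<xi> by (simp add: ev_phi_uminus Vec10_D \<Omega>11_mult P_in Om_intros ev_phi_form Vec10_P)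
qed

text \<open>By (b), replacing \<open>exd e\<close> by its (0,1)-part does not change the
  \<open>Q P\<close> component of its derivative. Then (c) says that the two mixed components
  cancel.\<close>

lemma fmap_Q_ctr_sq_exd:
  assumes u: "u \<in> Vec10 J" and e: "e \<in> Om 0"
  shows "fmap Q (ctr u (sq (exd e))) + ev_phi u (wedge_op Q P (sq (Q (exd e)))) = 0"
proof -
  note de = Om_exd0[OF e]
  have "sq (exd e) = sq (P (exd e)) + sq (Q (exd e))"
    using sq_add[of "P (exd e)" "Q (exd e)"] de by (simp add: PQ_Om P_plus_Q)
  then have 1: "wedge_op Q P (sq (Q (exd e))) = wedge_op Q P (sq (exd e))"
    using de by (simp add: wedge_op_add bimod_P bimod_Q wedge_op_QP_sq P_in)
  have "wedge_op P Q (sq (exd e)) + wedge_op Q P (sq (Q (exd e))) = 0"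
    unfolding 1 by (rule wedge_op_sq_exd[OF e])
  then show ?thesis
    using u de ev_phi_add[of u "wedge_op P Q (sq (exd e))" "wedge_op Q P (sq (Q (exd e)))"]
    by (simp add: fmap_Q_ctr sq_in Vec10_D wedge_op_PQ_in wedge_op_QP_in PQ_Om ev_phi_zero)
qed

text \<open>The counterpart of \<open>ev_phi_sinv_01\<close> for the other type: now (b) removes the
  \<open>Q P\<close> component, and (d) determines the \<open>P Q\<close> component, which is the
  one that the contraction sees.\<close>

lemma fmap_Q_ctr_sinv_10:
  assumes u: "u \<in> Vec10 J" and e: "e \<in> Om 0" and \<eta>: "\<eta> \<in> \<Omega>10"
  shows "fmap Q (ctr u (sinv (form (exd e) * form \<eta>))) = - ev_phi u (Q (exd e) * \<eta>)"
proof -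
  note \<eta>' = \<Omega>10_D[OF \<eta>]
  have ff: "form (exd e) * form \<eta> \<in> FF" using e \<eta>' by (simp add: tens_prodI Om_intros)
  from wedge_op_sinv[OF this] have "wedge_op P Q (sinv (form (exd e) * form \<eta>)) = - (Q (exd e) * \<eta>)"
    using e \<eta> \<eta>' by (simp add: wedge_op_QP_sinv wedge_op_form bimod_P bimod_Q Om_intros)
  then show ?thesis
    using u e \<eta> ff by (simp add: fmap_Q_ctr sinv_in ev_phi_uminus Vec10_D \<Omega>11_mult Q_in Om_intros)
qed


subsection \<open>The module structure behind the recursion\<close>

abbreviation "W10 \<equiv> vect ` Vec10 J"

lemma Vecle_TVec: "x \<in> Vecle0 J n \<Longrightarrow> x \<in> TVec"
  by (rule V10.pow_le_TVec)

definition fbullet :: "'w tens \<Rightarrow> 'w tens \<Rightarrow> 'w tens" where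
  "fbullet x t = bcase (\<lambda>\<xi> y. form \<xi> * bullet sq sinv y x) t"

lemma VecT_TVec: "VecT \<subseteq> (TVec :: 'w tens set)"
proof
  fix x :: "'w tens" assume "x \<in> VecT"
  then obtain v where "x = vect v" "v \<in> Vec" by blast
  then show "x \<in> TVec" using full.pow_in_le[OF full.pow_vect order_refl] TVecI by blast
qed

lemma FV_FTV: "t \<in> FV \<Longrightarrow> (t :: 'w tens) \<in> Fm \<otimes>\<^sub>A TVec"
  using tens_prod_mono[OF order_refl VecT_TVec] by blast

lemma fbullet_form: "x \<in> TVec \<Longrightarrow> \<xi> \<in> Om 1 \<Longrightarrow> v \<in> Vec \<Longrightarrow> fbullet x (form \<xi> * vect v) = form \<xi> * vbullet v x"
  using VecT_TVec by (simp add: fbullet_def bcase_form[OF fbullet_bal] bullet_props subset_iff)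

lemma fbullet_zero: "x \<in> TVec \<Longrightarrow> fbullet x 0 = 0"
  by (simp add: fbullet_def bcase_zero[OF fbullet_bal])

lemma fbullet_add: "x \<in> TVec \<Longrightarrow> s \<in> FV \<Longrightarrow> t \<in> FV \<Longrightarrow> fbullet x (s + t) = fbullet x s + fbullet x t"
  by (simp add: fbullet_def bcase_add[OF fbullet_bal] FV_FTV)

lemma FV_induct [consumes 1, case_names zero add mult]:
  assumes "t \<in> FV" "S 0" "\<And>x y. x \<in> FV \<Longrightarrow> y \<in> FV \<Longrightarrow> S x \<Longrightarrow> S y \<Longrightarrow> S (x + y)"
    "\<And>\<xi> v. \<xi> \<in> Om 1 \<Longrightarrow> v \<in> Vec \<Longrightarrow> S (form \<xi> * vect v)"
  shows "S t"
proof -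
  have "t \<in> FV \<and> S t"
    using assms(1) by (induction rule: tens_prod_induct) (use assms in \<open>auto simp: tens_prod_zero intro: tens_prod_add tens_prodI\<close>)
  then show ?thesis ..
qed

lemma fbullet_scal: "t \<in> FV \<Longrightarrow> x \<in> TVec \<Longrightarrow> e \<in> Om 0 \<Longrightarrow> fbullet x (scal e * t) = scal e * fbullet x t"
  by (induction rule: FV_induct)
    (simp_all add: fbullet_zero fbullet_add FV_scal distrib_left scal_mult_form fbullet_form Om_intros)

lemma fbullet_add_left: "t \<in> FV \<Longrightarrow> x \<in> TVec \<Longrightarrow> y \<in> TVec \<Longrightarrow> fbullet (x + y) t = fbullet x t + fbullet y t"
  by (induction rule: FV_induct)
    (simp_all add: fbullet_zero fbullet_add TVec_add fbullet_form vbullet_add distrib_left)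

text \<open>Moving \<open>e\<close> to the left through \<open>v \<bullet> (e x)\<close> leaves
  \<open>v(de) x\<close>; summed over \<open>t\<close>, these terms form the value of
  \<open>t\<close> at \<open>exd e\<close>.\<close>

lemma fbullet_scal_left: "t \<in> FV \<Longrightarrow> x \<in> TVec \<Longrightarrow> e \<in> Om 0 \<Longrightarrow>
    fbullet (scal e * x) t = fbullet x (t * scal e) + rctr (exd e) t * x"
proof (induction rule: FV_induct)
  case (mult \<xi> v)
  then show ?case
    by (simp add: fbullet_form TVec_scal vbullet_scal mult.assoc vect_scal vec_ract_in rctr_form_vect Om_intros
        distrib_left form_mult_scal Vec_in)
qed (simp_all add: fbullet_zero fbullet_add TVec_scal FV_scal_right distrib_right rctr_simps)

lemma fbullet_in:
  assumes "t \<in> F01 \<otimes>\<^sub>A W10" and x: "x \<in> Vecle0 J n"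
  shows "fbullet x t \<in> F01 \<otimes>\<^sub>A Vecle0 J (Suc n)"
proof -
  have "F01 \<otimes>\<^sub>A W10 \<subseteq> FV"
    using F01_Fm Vec10_D by (intro tens_prod_mono) auto
  have "t \<in> FV \<and> fbullet x t \<in> F01 \<otimes>\<^sub>A Vecle0 J (Suc n)"
    using \<open>t \<in> F01 \<otimes>\<^sub>A W10\<close>
  proof (induction rule: tens_prod_induct)
    case (mult y z)
    then obtain \<xi> v where [simp]: "y = form \<xi>" "z = vect v" and "\<xi> \<in> \<Omega>01" "v \<in> Vec10 J" by blast
    then show ?case using x V10.vbullet_in[of v x n] \<Omega>01_D[of \<xi>]
      by (simp add: fbullet_form Vecle_TVec Vec10_D tens_prodI)
  qed (use x in \<open>auto simp: fbullet_zero fbullet_add Vecle_TVec tens_prod_zero intro: tens_prod_add\<close>)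
  then show ?thesis ..
qed

lemma rctr_fmap: "t \<in> FV \<Longrightarrow> \<xi> \<in> Om 1 \<Longrightarrow> rctr \<xi> (fmap Q t) = fmap Q (rctr \<xi> t)"
  by (induction rule: FV_induct)
    (simp_all add: rctr_simps fmap_zero[OF bimod_Q] fmap_add[OF bimod_Q]
      fmap_form[OF bimod_Q] fmap_form1[OF bimod_Q] PQ_Om Q_simps Vec_in Om_intros)

lemma fmap_Q_FV: "t \<in> FV \<Longrightarrow> fmap Q t \<in> FV"
  by (rule fmap_in[OF bimod_Q PQ_Om(2)])

section \<open>Dual bases of the (1,0)-forms\<close>

definition hbasis :: "('w \<times> ('w \<Rightarrow> 'w)) list" where
  "hbasis = (SOME bs. dual_basis \<Omega>10 (Vec10 J) bs)"

lemma hbasis: "dual_basis \<Omega>10 (Vec10 J) hbasis"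
proof -
  obtain bs :: "('w \<times> ('w \<Rightarrow> 'w)) list" where bs: "dual_basis (Om 1) Vec bs"
    using dual_basis_exists[OF fgp] by blast
  have mem: "fst q \<in> Om 1" "snd q \<in> Vec" if "q \<in> set bs" for q
    using bs that by (auto simp: dual_basis_def)
  \<comment> \<open>Both members of a dual basis of all one-forms are projected to type (1,0); on a
    (1,0)-form the projections do not change the expansion.\<close>
  let ?cs = "map (\<lambda>q. (P (fst q), vproj (snd q))) bs"
  have "\<omega> = (\<Sum>(\<xi>, u)\<leftarrow>?cs. \<xi> * u \<omega>)" if \<omega>: "\<omega> \<in> \<Omega>10" for \<omega>
  proof -
    note \<omega>' = \<Omega>10_D[OF \<omega>]
    have P_sum: "(\<Sum>q\<leftarrow>qs. h q) \<in> Om 1 \<and> P (\<Sum>q\<leftarrow>qs. h q) = (\<Sum>q\<leftarrow>qs. P (h q))"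
      if "\<And>q. q \<in> set qs \<Longrightarrow> h q \<in> Om 1" for h and qs :: "('w \<times> ('w \<Rightarrow> 'w)) list"
      using that by (induction qs) (auto simp: Om_intros P_simps bimod_map_zero[OF bimod_P])
    have "\<omega> = P (\<Sum>q\<leftarrow>bs. fst q * snd q \<omega>)"
      using bs \<omega>' by (simp add: dual_basis_def split_def)
    also have "\<dots> = (\<Sum>q\<leftarrow>bs. P (fst q * snd q \<omega>))"
      using P_sum[of bs "\<lambda>q. fst q * snd q \<omega>"] mem by (simp add: Om_intros Vec_in)
    also have "\<dots> = (\<Sum>q\<leftarrow>bs. P (fst q) * vproj (snd q) \<omega>)"
      by (rule sum_list_cong) (use mem \<omega>' in \<open>simp add: P_simps Vec_in vproj_apply\<close>)
    finally show ?thesis by (simp add: o_def split_def)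
  qed
  then have "dual_basis \<Omega>10 (Vec10 J) ?cs"
    using mem by (auto simp: dual_basis_def P_in vproj_in)
  then show ?thesis unfolding hbasis_def by (rule someI)
qed

lemma hbasis_mem: "q \<in> set hbasis \<Longrightarrow> fst q \<in> \<Omega>10 \<and> fst q \<in> Om 1 \<and> snd q \<in> Vec10 J \<and> snd q \<in> Vec"
  using hbasis \<Omega>10_D Vec10_D by (auto simp: dual_basis_def)

lemma hbasis_expand:
  assumes \<xi>: "\<xi> \<in> Om 1"
  shows "(\<Sum>q\<leftarrow>hbasis. fst q * snd q \<xi>) = P \<xi>"
proof -
  have "P \<xi> = (\<Sum>q\<leftarrow>hbasis. fst q * snd q (P \<xi>))"
    using hbasis P_in[OF \<xi>] by (simp add: dual_basis_def split_def)
  also have "\<dots> = (\<Sum>q\<leftarrow>hbasis. fst q * snd q \<xi>)"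
    by (rule sum_list_cong) (use hbasis_mem \<xi> in \<open>simp add: Vec10_P\<close>)
  finally show ?thesis by simp
qed

text \<open>The tensor of a dual basis is the same for all bases and commutes with scalars, since
  its value at \<xi> is always \<open>P \<xi>\<close>. A balanced map of it inherits both. The case
  \<open>e = 1\<close> gives independence of the basis in the recursion; \<open>bs = hbasis\<close>
  moves a scalar across.\<close>

lemma hbasis_sum_transpose:
  assumes u: "u \<in> Vec" and \<zeta>: "\<zeta> \<in> \<Omega>01" and w: "w \<in> TVec" and bs: "dual_basis \<Omega>10 (Vec10 J) bs"
    and e: "e \<in> Om 0"
  shows "(\<Sum>(\<eta>, \<eta>')\<leftarrow>bs. ev_phi u (\<zeta> * (e * \<eta>)) * vbullet \<eta>' w) =
    (\<Sum>(\<eta>, \<eta>')\<leftarrow>hbasis. ev_phi u (\<zeta> * \<eta>) * vbullet (vec_ract \<eta>' e) w)"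
proof -
  \<comment> \<open>\<open>P\<close> is inserted so that the map makes sense for all one-forms, as
    \<open>bcase\<close> requires; on the members of a dual basis it is the identity.\<close>
  let ?f = "\<lambda>\<eta> y. ev_phi u (\<zeta> * P \<eta>) * bullet sq sinv y w"
  let ?c = "\<lambda>bs. \<Sum>(\<eta>, \<eta>')\<leftarrow>bs. form \<eta> * vect \<eta>'"
  have "0 \<in> (VecT :: 'w tens set)"
    using zero_in_Vec vect_zero by (metis image_eqI)
  then have bal: "bbal VecT ?f"
    using u \<zeta> w VecT_TVec full.W_add full.W_scal
    by (simp add: bbal_def distrib_left distrib_right ev_phi_add \<Omega>11_mult P_in P_simps bullet_props subset_iff
        ev_phi_mult mult.assoc[symmetric])
  have c: "?c bs \<in> FV" "\<xi> \<in> Om 1 \<Longrightarrow> rctr \<xi> (?c bs) = form (P \<xi>)" if "dual_basis \<Omega>10 (Vec10 J) bs" for bs \<xi>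
  proof -
    have sub: "\<Omega>10 \<subseteq> Om 1" "Vec10 J \<subseteq> Vec" using \<Omega>10_D Vec10_D by blast+
    show "?c bs \<in> FV" by (rule dual_basis_rctr(1)[OF that sub])
    show "rctr \<xi> (?c bs) = form (P \<xi>)" if \<xi>: "\<xi> \<in> Om 1"
      by (rule dual_basis_rctr(2)[OF \<open>dual_basis \<Omega>10 (Vec10 J) bs\<close> sub \<xi> P_in[OF \<xi>]])
        (simp add: Vec10_P \<xi>)
  qed
  have mem: "fst q \<in> \<Omega>10 \<and> fst q \<in> Om 1 \<and> snd q \<in> Vec" if "q \<in> set bs" for q
    using bs that \<Omega>10_D Vec10_D by (auto simp: dual_basis_def)
  have "scal e * ?c bs = ?c hbasis * scal e"
    by (rule rctr_ext[OF fgp])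
      (use c[OF bs] c[OF hbasis] e in \<open>simp_all add: FV_scal FV_scal_right rctr_scal rctr_scal_right Om_intros
        P_simps scal_form PQ_Om\<close>)
  moreover have "scal e * ?c bs = (\<Sum>(\<eta>, y)\<leftarrow>map (\<lambda>(\<eta>, \<eta>'). (e * \<eta>, vect \<eta>')) bs. form \<eta> * y)"
    unfolding sum_list_const_mult[symmetric] map_map
    by (rule sum_list_cong) (use mem e in \<open>auto simp: scal_mult_form\<close>)
  moreover have "?c hbasis * scal e = (\<Sum>(\<eta>, y)\<leftarrow>map (\<lambda>(\<eta>, \<eta>'). (\<eta>, vect (vec_ract \<eta>' e))) hbasis. form \<eta> * y)"
    unfolding sum_list_mult_const[symmetric] map_map
    by (rule sum_list_cong) (use hbasis_mem e in \<open>force simp: vect_scal mult.assoc\<close>)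
  ultimately have "(\<Sum>(\<eta>, y)\<leftarrow>map (\<lambda>(\<eta>, \<eta>'). (e * \<eta>, vect \<eta>')) bs. ?f \<eta> y) =
      (\<Sum>(\<eta>, y)\<leftarrow>map (\<lambda>(\<eta>, \<eta>'). (\<eta>, vect (vec_ract \<eta>' e))) hbasis. ?f \<eta> y)"
    using bcase_sum_list[OF bal, of "map (\<lambda>(\<eta>, \<eta>'). (e * \<eta>, vect \<eta>')) bs"]
      bcase_sum_list[OF bal, of "map (\<lambda>(\<eta>, \<eta>'). (\<eta>, vect (vec_ract \<eta>' e))) hbasis"] mem hbasis_mem e
    by (force simp: Om_intros vec_ract_in)
  moreover have "(\<Sum>(\<eta>, y)\<leftarrow>map (\<lambda>(\<eta>, \<eta>'). (e * \<eta>, vect \<eta>')) bs. ?f \<eta> y) =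
      (\<Sum>(\<eta>, \<eta>')\<leftarrow>bs. ev_phi u (\<zeta> * (e * \<eta>)) * vbullet \<eta>' w)"
    unfolding map_map
    by (rule sum_list_cong) (use mem e w \<Omega>10_D in \<open>force simp: P_simps bullet_props\<close>)
  moreover have "(\<Sum>(\<eta>, y)\<leftarrow>map (\<lambda>(\<eta>, \<eta>'). (\<eta>, vect (vec_ract \<eta>' e))) hbasis. ?f \<eta> y) =
      (\<Sum>(\<eta>, \<eta>')\<leftarrow>hbasis. ev_phi u (\<zeta> * \<eta>) * vbullet (vec_ract \<eta>' e) w)"
    unfolding map_map
    by (rule sum_list_cong) (use hbasis_mem e w \<Omega>10_D in \<open>force simp: vec_ract_in bullet_props\<close>)
  ultimately show ?thesis by simp
qed

text \<open>The contribution of one summand \<xi> \<otimes> w to the last two terms of the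
  recursion. \<open>Q\<close> extends it from (0,1)-forms to all one-forms, over which
  \<open>bcase\<close> takes its dual basis.\<close>

definition rec_term :: "('w \<Rightarrow> 'w) \<Rightarrow> 'w \<Rightarrow> 'w tens \<Rightarrow> 'w tens" where
  "rec_term u \<xi> w = - (ev_phi u (wedge_op Q P (sq (Q \<xi>))) * w) - (\<Sum>(\<eta>, \<eta>')\<leftarrow>hbasis. ev_phi u (Q \<xi> * \<eta>) * vbullet \<eta>' w)"

lemma rec_term_add:
  assumes *: "u \<in> Vec" "\<xi> \<in> Om 1" "x \<in> TVec" "y \<in> TVec"
  shows "rec_term u \<xi> (x + y) = rec_term u \<xi> x + rec_term u \<xi> y"
proof -
  have "(\<Sum>q\<leftarrow>hbasis. ev_phi u (Q \<xi> * fst q) * vbullet (snd q) (x + y)) =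
      (\<Sum>q\<leftarrow>hbasis. ev_phi u (Q \<xi> * fst q) * vbullet (snd q) x + ev_phi u (Q \<xi> * fst q) * vbullet (snd q) y)"
    by (rule sum_list_cong) (use * hbasis_mem in \<open>simp add: vbullet_add distrib_left\<close>)
  then show ?thesis by (simp add: rec_term_def split_def sum_list_addf distrib_left)
qed

lemma rec_term_plus:
  assumes *: "u \<in> Vec" "\<xi> \<in> Om 1" "\<zeta> \<in> Om 1"
  shows "rec_term u (\<xi> + \<zeta>) x = rec_term u \<xi> x + rec_term u \<zeta> x"
proof -
  have "(\<Sum>q\<leftarrow>hbasis. ev_phi u (Q (\<xi> + \<zeta>) * fst q) * vbullet (snd q) x) =
      (\<Sum>q\<leftarrow>hbasis. ev_phi u (Q \<xi> * fst q) * vbullet (snd q) x + ev_phi u (Q \<zeta> * fst q) * vbullet (snd q) x)"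
    by (rule sum_list_cong) (use * hbasis_mem in \<open>simp add: Q_simps distrib_right ev_phi_add \<Omega>11_mult Q_in\<close>)
  then show ?thesis using *
    by (simp add: rec_term_def split_def sum_list_addf distrib_right Q_simps PQ_Om sq_add wedge_op_add bimod_P bimod_Q
        ev_phi_add wedge_op_QP_in sq_in)
qed

lemma ev_phi_sum_list:
  "u \<in> Vec \<Longrightarrow> (\<And>q. q \<in> set qs \<Longrightarrow> h q \<in> Ompq J 1 1) \<Longrightarrow>
    (\<Sum>q\<leftarrow>qs. h q) \<in> Ompq J 1 1 \<and> ev_phi u (\<Sum>q\<leftarrow>qs. h q) = (\<Sum>q\<leftarrow>qs. ev_phi u (h q))"
  by (induction qs) (simp_all add: \<Omega>11_zero ev_phi_zero \<Omega>11_add ev_phi_add)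

lemma ev_phi_hbasis:
  assumes u: "u \<in> Vec" and \<zeta>: "\<zeta> \<in> \<Omega>01" and \<xi>: "\<xi> \<in> Om 1"
  shows "(\<Sum>q\<leftarrow>hbasis. ev_phi u (\<zeta> * fst q) * scal (snd q \<xi>)) = ev_phi u (\<zeta> * P \<xi>)"
proof -
  have "(\<Sum>q\<leftarrow>hbasis. ev_phi u (\<zeta> * fst q) * scal (snd q \<xi>)) = (\<Sum>q\<leftarrow>hbasis. ev_phi u (\<zeta> * (fst q * snd q \<xi>)))"
    by (rule sum_list_cong)
      (use u \<zeta> hbasis_mem in \<open>simp add: ev_phi_mult[symmetric] \<Omega>11_mult Vec_in mult.assoc\<close>)
  also have "\<dots> = ev_phi u (\<Sum>q\<leftarrow>hbasis. \<zeta> * (fst q * snd q \<xi>))"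
    using ev_phi_sum_list[OF u, of hbasis "\<lambda>q. \<zeta> * (fst q * snd q \<xi>)"] \<zeta> hbasis_mem
    by (simp add: \<Omega>11_mult \<Omega>10_closed Vec_in)
  finally show ?thesis
    by (simp add: sum_list_const_mult hbasis_expand[OF \<xi>])
qed

text \<open>The two sums of the recursion are balanced only together: the first one contributes
  \<open>\<xi> \<and> \<partial>a\<close>, by the Leibniz rule of \<open>\<box>\<close>, and the second one cancels it, by \<open>\<eta> \<bullet> a = \<eta> a + \<eta>(da)\<close>.\<close>

lemma rec_term_mult:
  assumes u: "u \<in> Vec" and \<xi>: "\<xi> \<in> Om 1" and e: "e \<in> Om 0" and x: "x \<in> TVec"
  shows "rec_term u (\<xi> * e) x = rec_term u \<xi> (scal e * x)"
proof -
  define \<zeta> where "\<zeta> = Q \<xi>"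
  have \<zeta>: "\<zeta> \<in> \<Omega>01" "\<zeta> \<in> Om 1" "Q \<zeta> = \<zeta>" "Q (\<xi> * e) = \<zeta> * e"
    using \<xi> e Q_in \<Omega>01_D[OF Q_in[OF \<xi>]] by (simp_all add: \<zeta>_def Q_simps)
  have "ev_phi u (wedge_op Q P (sq (\<zeta> * e))) = ev_phi u (wedge_op Q P (sq \<zeta>)) * scal e + ev_phi u (\<zeta> * P (exd e))"
    using u \<zeta> e
    by (simp add: sq_mult wedge_op_add bimod_P bimod_Q wedge_op_scal_right sq_in wedge_op_form Om_intros ev_phi_add
        wedge_op_QP_in ev_phi_mult \<Omega>11_mult P_in \<Omega>11_scal_right)
  moreover have "(\<Sum>q\<leftarrow>hbasis. ev_phi u (\<zeta> * fst q) * vbullet (snd q) (scal e * x)) =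
      (\<Sum>q\<leftarrow>hbasis. ev_phi u (\<zeta> * e * fst q) * vbullet (snd q) x) + ev_phi u (\<zeta> * P (exd e)) * x"
  proof -
    have "(\<Sum>q\<leftarrow>hbasis. ev_phi u (\<zeta> * fst q) * vbullet (snd q) (scal e * x)) =
        (\<Sum>q\<leftarrow>hbasis. ev_phi u (\<zeta> * fst q) * vbullet (vec_ract (snd q) e) x +
          ev_phi u (\<zeta> * fst q) * scal (snd q (exd e)) * x)"
      by (rule sum_list_cong) (use hbasis_mem e x in \<open>simp add: vbullet_scal distrib_left mult.assoc\<close>)
    also have "\<dots> = (\<Sum>q\<leftarrow>hbasis. ev_phi u (\<zeta> * fst q) * vbullet (vec_ract (snd q) e) x) +
        (\<Sum>q\<leftarrow>hbasis. ev_phi u (\<zeta> * fst q) * scal (snd q (exd e))) * x"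
      by (simp add: sum_list_addf sum_list_mult_const)
    finally show ?thesis
      using hbasis_sum_transpose[OF u \<zeta>(1) x hbasis e] u \<zeta> e
      by (simp add: ev_phi_hbasis Om_intros split_def mult.assoc)
  qed
  ultimately show ?thesis
    using \<zeta> by (simp add: rec_term_def \<zeta>_def[symmetric] split_def distrib_right mult.assoc algebra_simps)
qed

lemma rec_term_bal: "u \<in> Vec \<Longrightarrow> bbal (Vecle0 J n) (rec_term u)"
  by (auto simp: bbal_def rec_term_plus rec_term_mult V10.pow_le_zero V10.pow_le_add V10.pow_le_scal
      intro: rec_term_add Vecle_TVec rec_term_mult)

section \<open>Values of the operator: (0,1)-forms with coefficients in the tensor powers\<close>

abbreviation "FL n \<equiv> F01 \<otimes>\<^sub>A Vecle0 J n"

lemma FL_sub: "FL n \<subseteq> Fm \<otimes>\<^sub>A Vecle0 J n"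
  by (rule tens_prod_mono[OF F01_Fm order_refl])

lemma FL_mono: "m \<le> n \<Longrightarrow> FL m \<subseteq> FL n"
  by (rule tens_prod_mono[OF order_refl V10.pow_le_mono])

lemma FL_scal: "s \<in> FL n \<Longrightarrow> e \<in> Om 0 \<Longrightarrow> scal e * s \<in> FL n"
  by (rule tens_prod_left) (auto intro: F01_closed)

lemma FL_uminus: "s \<in> FL n \<Longrightarrow> - s \<in> FL n"
  using FL_scal[of s n "- 1"] by (simp add: Om_intros scal_uminus)

lemma FL_induct [consumes 1, case_names zero add mult]:
  assumes "t \<in> FL n" "S 0" "\<And>x y. x \<in> FL n \<Longrightarrow> y \<in> FL n \<Longrightarrow> S x \<Longrightarrow> S y \<Longrightarrow> S (x + y)"
    "\<And>\<xi> x. \<xi> \<in> \<Omega>01 \<Longrightarrow> \<xi> \<in> Om 1 \<Longrightarrow> x \<in> Vecle0 J n \<Longrightarrow> S (form \<xi> * x)"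
  shows "S t"
proof -
  have "t \<in> FL n \<and> S t"
    using assms(1)
  proof (induction rule: tens_prod_induct)
    case (mult x y)
    then obtain \<xi> where "x = form \<xi>" "\<xi> \<in> \<Omega>01" "\<xi> \<in> Om 1" using \<Omega>01_D by blast
    then show ?case using assms(4) mult by (simp add: tens_prodI)
  qed (use assms in \<open>auto simp: tens_prod_zero intro: tens_prod_add\<close>)
  then show ?thesis ..
qed

definition rec_map :: "('w \<Rightarrow> 'w) \<Rightarrow> 'w tens \<Rightarrow> 'w tens" where
  "rec_map u = bcase (rec_term u)"

lemma rec_map_form: "u \<in> Vec \<Longrightarrow> \<xi> \<in> Om 1 \<Longrightarrow> x \<in> Vecle0 J n \<Longrightarrow> rec_map u (form \<xi> * x) = rec_term u \<xi> x"
  unfolding rec_map_def by (rule bcase_form[OF rec_term_bal])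

lemma rec_map_zero: "u \<in> Vec \<Longrightarrow> rec_map u 0 = 0"
  unfolding rec_map_def by (rule bcase_zero[OF rec_term_bal[of _ 0]])

lemma rec_map_add: "u \<in> Vec \<Longrightarrow> s \<in> FL n \<Longrightarrow> t \<in> FL n \<Longrightarrow> rec_map u (s + t) = rec_map u s + rec_map u t"
  unfolding rec_map_def using bcase_add[OF rec_term_bal] FL_sub by blast

lemma rec_term_in:
  assumes u: "u \<in> Vec" and \<xi>: "\<xi> \<in> Om 1" and x: "x \<in> Vecle0 J n"
  shows "rec_term u \<xi> x \<in> FL (Suc n)"
proof -
  have 1: "ev_phi u (wedge_op Q P (sq (Q \<xi>))) * x \<in> FL (Suc n)"
    using u \<xi> x V10.pow_le_mono[of n "Suc n"] by (intro tens_prodI ev_phi_in wedge_op_QP_in sq_in PQ_Om) auto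
  have 2: "(\<Sum>q\<leftarrow>hbasis. ev_phi u (Q \<xi> * fst q) * vbullet (snd q) x) \<in> FL (Suc n)"
    by (rule tens_prod_sum_list)
      (use u \<xi> x hbasis_mem in \<open>simp add: tens_prodI ev_phi_in \<Omega>11_mult Q_in V10.vbullet_in\<close>)
  show ?thesis
    using tens_prod_add[OF FL_uminus[OF 1] FL_uminus[OF 2]] by (simp add: rec_term_def split_def)
qed

lemma rec_map_in: "s \<in> FL n \<Longrightarrow> u \<in> Vec \<Longrightarrow> rec_map u s \<in> FL (Suc n)"
  by (induction rule: FL_induct) (auto simp: rec_map_zero rec_map_add rec_map_form rec_term_in tens_prod_zero intro: tens_prod_add)

lemma rec_term_plus_left: "u \<in> Vec \<Longrightarrow> v \<in> Vec \<Longrightarrow> rec_term (\<lambda>\<xi>. u \<xi> + v \<xi>) \<xi> x = rec_term u \<xi> x + rec_term v \<xi> x"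
  by (simp add: rec_term_def ev_phi_plus distrib_right split_def sum_list_addf)

lemma rec_term_lact: "u \<in> Vec \<Longrightarrow> e \<in> Om 0 \<Longrightarrow> rec_term (vec_lact e u) \<xi> x = scal e * rec_term u \<xi> x"
  by (simp add: rec_term_def ev_phi_lact split_def sum_list_const_mult[symmetric] right_diff_distrib mult.assoc)

lemma rec_map_plus: "s \<in> FL n \<Longrightarrow> u \<in> Vec \<Longrightarrow> v \<in> Vec \<Longrightarrow> rec_map (\<lambda>\<xi>. u \<xi> + v \<xi>) s = rec_map u s + rec_map v s"
  by (induction rule: FL_induct) (simp_all add: vec_add_in rec_map_zero rec_map_add rec_map_form rec_term_plus_left)

lemma rec_map_lact: "s \<in> FL n \<Longrightarrow> u \<in> Vec \<Longrightarrow> e \<in> Om 0 \<Longrightarrow> rec_map (vec_lact e u) s = scal e * rec_map u s"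
  by (induction rule: FL_induct) (simp_all add: vec_lact_in rec_map_zero rec_map_add rec_map_form rec_term_lact distrib_left)

text \<open>The sum over the dual basis passes \<open>e\<close> to \<open>u\<close>, because \<phi>
  is left linear. The term with \<box> produces in addition \<sigma>^-1(de \<otimes> \<xi>), whose
  contribution is \<open>u(de)\<close> times \<xi> by \<open>ev_phi_sinv_01\<close>. So this part
  rests on (b) and (d).\<close>

lemma rec_map_scal: "s \<in> FL n \<Longrightarrow> u \<in> Vec10 J \<Longrightarrow> e \<in> Om 0 \<Longrightarrow>
    rec_map u (scal e * s) = rec_map (vec_ract u e) s + scal (u (exd e)) * s"
proof (induction rule: FL_induct)
  case zero
  then show ?case by (simp add: rec_map_zero Vec10_D vec_ract_in)
next
  case (add x y)
  then show ?case by (simp add: distrib_left rec_map_add[of _ _ n] FL_scal Vec10_D vec_ract_in)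
next
  case (mult \<xi> x)
  then have uV: "u \<in> Vec" and \<xi>': "Q \<xi> = \<xi>" "Q (e * \<xi>) = e * \<xi>"
    using Vec10_D \<Omega>01_D[of \<xi>] by (simp_all add: Q_simps)
  have 1: "ev_phi u (wedge_op Q P (sq (e * \<xi>))) = ev_phi (vec_ract u e) (wedge_op Q P (sq \<xi>)) - scal (u (exd e)) * form \<xi>"
    using mult uV ev_phi_sinv_01[of u e \<xi>]
    by (simp add: sq_lmult wedge_op_add bimod_P bimod_Q wedge_op_scal sq_in ev_phi_add \<Omega>11_scal wedge_op_QP_in sinv_in
        tens_prodI Om_intros ev_phi_ract)
  have 2: "(\<Sum>q\<leftarrow>hbasis. ev_phi u (e * \<xi> * fst q) * vbullet (snd q) x) = (\<Sum>q\<leftarrow>hbasis. ev_phi (vec_ract u e) (\<xi> * fst q) * vbullet (snd q) x)"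
    by (rule sum_list_cong) (use mult uV hbasis_mem in \<open>simp add: ev_phi_ract \<Omega>11_mult mult.assoc\<close>)
  have "rec_term u (e * \<xi>) x = rec_term (vec_ract u e) \<xi> x + scal (u (exd e)) * form \<xi> * x"
    unfolding rec_term_def \<xi>' split_def 1 2 by (simp add: left_diff_distrib)
  then show ?case
    using mult uV by (simp add: scal_mult_form rec_map_form[of _ _ _ n] Om_intros vec_ract_in mult.assoc)
qed

text \<open>Evaluated at \<xi>, the (0,1)-part of \<xi> contributes nothing and the (1,0)-part is
  given by \<open>fmap_Q_ctr_sinv_10\<close>. The result is exactly the vector-valued form occurring
  in the last sum of the recursion, which explains the shape of that sum.\<close>

lemma fmap_Q_sigma_at:
  assumes u: "u \<in> Vec10 J" and e: "e \<in> Om 0"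
  shows "fmap Q (sigma_at u (exd e)) = - (\<Sum>q\<leftarrow>hbasis. ev_phi u (Q (exd e) * fst q) * vect (snd q))"
proof -
  note uV = Vec10_D[OF u] and de = Om_exd0[OF e]
  have ev_phi_Fm: "ev_phi u (Q (exd e) * fst q) \<in> Fm" if "q \<in> set hbasis" for q
    using ev_phi_in[OF uV \<Omega>11_mult(2)] Q_in[OF de] hbasis_mem[OF that] F01_Fm by blast
  have sum_in: "(\<Sum>q\<leftarrow>hbasis. ev_phi u (Q (exd e) * fst q) * vect (snd q)) \<in> FV"
    by (rule tens_prod_sum_list) (use ev_phi_Fm hbasis_mem in \<open>simp add: tens_prodI\<close>)
  show ?thesis
  proof (rule rctr_ext[OF fgp fmap_Q_FV[OF sigma_at_in[OF uV de]] FV_uminus[OF sum_in]])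
    fix \<xi> :: 'w assume \<xi>: "\<xi> \<in> Om 1"
    have "sinv (form (exd e) * form \<xi>) = sinv (form (exd e) * form (P \<xi>)) + sinv (form (exd e) * form (Q \<xi>))"
      using \<xi> de sinv_add[of "form (exd e) * form (P \<xi>)" "form (exd e) * form (Q \<xi>)"]
      by (simp add: tens_prodI PQ_Om distrib_left[symmetric] form_add[symmetric] P_plus_Q)
    then have "rctr \<xi> (fmap Q (sigma_at u (exd e))) = - ev_phi u (Q (exd e) * P \<xi>)"
      using u uV e de \<xi>
      by (simp add: rctr_fmap sigma_at_in rctr_sigma_at ctr_add ctr_sinv_01 Q_in fmap_Q_ctr_sinv_10 P_in)
    also have "ev_phi u (Q (exd e) * P \<xi>) = rctr \<xi> (\<Sum>q\<leftarrow>hbasis. ev_phi u (Q (exd e) * fst q) * vect (snd q))"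
    proof -
      have "rctr \<xi> (\<Sum>q\<leftarrow>hbasis. ev_phi u (Q (exd e) * fst q) * vect (snd q)) =
          (\<Sum>q\<leftarrow>hbasis. ev_phi u (Q (exd e) * fst q) * scal (snd q \<xi>))"
        unfolding additive_sum_list[OF additive_rctr]
        by (rule sum_list_cong) (use ev_phi_Fm hbasis_mem \<xi> in \<open>simp add: rctr_Fm_vect\<close>)
      then show ?thesis using ev_phi_hbasis[OF uV Q_in[OF de] \<xi>] by simp
    qed
    finally show "rctr \<xi> (fmap Q (sigma_at u (exd e))) = rctr \<xi> (- (\<Sum>q\<leftarrow>hbasis. ev_phi u (Q (exd e) * fst q) * vect (snd q)))"
      by (simp add: additive.minus[OF additive_rctr])
  qed
qed

lemma fbullet_fmap_Q_sigma_at: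
  assumes u: "u \<in> Vec10 J" and e: "e \<in> Om 0" and x: "x \<in> TVec"
  shows "fbullet x (fmap Q (sigma_at u (exd e))) = - (\<Sum>q\<leftarrow>hbasis. ev_phi u (Q (exd e) * fst q) * vbullet (snd q) x)"
proof -
  note uV = Vec10_D[OF u] and de = Om_exd0[OF e]
  have ev_phi_Fm: "ev_phi u (Q (exd e) * fst q) \<in> Fm" if "q \<in> set hbasis" for q
    using ev_phi_in[OF uV \<Omega>11_mult(2)] Q_in[OF de] hbasis_mem[OF that] F01_Fm by blast
  have *: "(\<Sum>q\<leftarrow>qs. ev_phi u (Q (exd e) * fst q) * vect (snd q)) \<in> FV \<and>
      fbullet x (\<Sum>q\<leftarrow>qs. ev_phi u (Q (exd e) * fst q) * vect (snd q)) = (\<Sum>q\<leftarrow>qs. ev_phi u (Q (exd e) * fst q) * vbullet (snd q) x)"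
    if "set qs \<subseteq> set hbasis" for qs
    using that
  proof (induction qs)
    case Nil
    then show ?case using x by (simp add: fbullet_zero tens_prod_zero)
  next
    case (Cons q qs)
    have q: "q \<in> set hbasis" using Cons.prems by simp
    obtain \<omega> where \<omega>: "ev_phi u (Q (exd e) * fst q) = form \<omega>" "\<omega> \<in> Om 1" using ev_phi_Fm[OF q] by blast
    then show ?case
      using Cons x hbasis_mem[OF q] by (simp add: fbullet_add fbullet_form tens_prodI tens_prod_add)
  qed
  let ?t = "\<Sum>q\<leftarrow>hbasis. ev_phi u (Q (exd e) * fst q) * vect (snd q)"
  note t = conjunct1[OF *[OF order_refl]] conjunct2[OF *[OF order_refl]]
  have "fbullet x (- ?t) + fbullet x ?t = fbullet x (- ?t + ?t)"
    by (rule fbullet_add[symmetric, OF x FV_uminus[OF t(1)] t(1)])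
  also have "\<dots> = 0" using fbullet_zero[OF x] by simp
  finally show ?thesis
    unfolding fmap_Q_sigma_at[OF u e] t(2) eq_neg_iff_add_eq_0 .
qed

section \<open>The module of pairs\<close>

definition pair_mod :: "nat \<Rightarrow> ('w tens \<times> 'w tens) set" where
  "pair_mod n = Vecle0 J n \<times> FL n"

definition pair_scal :: "'w \<Rightarrow> 'w tens \<times> 'w tens \<Rightarrow> 'w tens \<times> 'w tens" where
  "pair_scal e = (\<lambda>(x, s). (scal e * x, form (Q (exd e)) * x + scal e * s))"

definition pair_act :: "('w \<Rightarrow> 'w) \<Rightarrow> 'w tens \<times> 'w tens \<Rightarrow> 'w tens \<times> 'w tens" where
  "pair_act u = (\<lambda>(x, s). (vbullet u x, fbullet x (fmap Q (sq_vec sq u)) + rec_map u s))"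

text \<open>Besides the expected terms, fact 3 leaves the \<open>Q P\<close> component of \<box> at
  \<open>Q (exd e)\<close>, which comes from (c), and cancels the first term of fact 4; the sum over
  the dual basis in fact 4 is the one that (d) produces in fact 2.\<close>

lemma pair_act_sm_snd:
  assumes u: "u \<in> Vec10 J" and e: "e \<in> Om 0" and x: "x \<in> Vecle0 J n" and s: "s \<in> FL n"
  shows "fbullet (scal e * x) (fmap Q (sq_vec sq u)) + rec_map u (form (Q (exd e)) * x + scal e * s) =
    fbullet x (fmap Q (sq_vec sq (vec_ract u e))) + rec_map (vec_ract u e) s +
    (form (Q (exd (u (exd e)))) * x + scal (u (exd e)) * s)"
proof -
  note uV = Vec10_D[OF u] and de = Om_exd0[OF e] and xT = Vecle_TVec[OF x]
  let ?t = "fmap Q (sq_vec sq u)"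
  have t: "sq_vec sq u \<in> FV" "?t \<in> FV"
    using uV by (simp_all add: sq_vec_in fmap_Q_FV)
  have Qde: "Q (exd e) \<in> \<Omega>01" "Q (exd e) \<in> Om 1" "Q (Q (exd e)) = Q (exd e)"
    using Q_in[OF de] \<Omega>01_D[OF Q_in[OF de]] by simp_all
  have 1: "fbullet (scal e * x) ?t = fbullet x (?t * scal e) + rctr (exd e) ?t * x"
    by (rule fbullet_scal_left[OF t(2) xT e])
  have "fmap Q (sq_vec sq (vec_ract u e)) = ?t * scal e + fmap Q (sigma_at u (exd e))"
    using t uV e FT_prod[OF order_refl t(1)]
    by (simp add: sq_vec_ract fmap_add[OF bimod_Q] fmap_mult[OF bimod_Q])
  then have 2: "fbullet x (fmap Q (sq_vec sq (vec_ract u e))) =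
      fbullet x (?t * scal e) - (\<Sum>q\<leftarrow>hbasis. ev_phi u (Q (exd e) * fst q) * vbullet (snd q) x)"
    using u uV e de t xT by (simp add: fbullet_add FV_scal_right fmap_Q_FV sigma_at_in fbullet_fmap_Q_sigma_at)
  have "rctr (exd e) ?t = fmap Q (form (exd (u (exd e)))) - fmap Q (ctr u (sq (exd e)))"
    using t uV de by (simp add: rctr_fmap rctr_sq_vec additive.diff[OF additive_fmap[OF bimod_Q]])
  also have "\<dots> = form (Q (exd (u (exd e)))) + ev_phi u (wedge_op Q P (sq (Q (exd e))))"
    using fmap_Q_ctr_sq_exd[OF u e] uV by (simp add: fmap_form1[OF bimod_Q] Om_intros Vec_in eq_neg_iff_add_eq_0[symmetric])
  finally have 3: "rctr (exd e) ?t * x = form (Q (exd (u (exd e)))) * x + ev_phi u (wedge_op Q P (sq (Q (exd e)))) * x"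
    by (simp add: distrib_right)
  have 4: "rec_map u (form (Q (exd e)) * x) = - (ev_phi u (wedge_op Q P (sq (Q (exd e)))) * x) -
      (\<Sum>q\<leftarrow>hbasis. ev_phi u (Q (exd e) * fst q) * vbullet (snd q) x)"
    using uV Qde x by (simp add: rec_map_form[of _ _ _ n] rec_term_def split_def)
  have 5: "rec_map u (form (Q (exd e)) * x + scal e * s) = rec_map u (form (Q (exd e)) * x) + rec_map (vec_ract u e) s + scal (u (exd e)) * s"
    using u uV e s x Qde by (simp add: rec_map_add[of _ _ n] rec_map_scal[of _ n] FL_scal tens_prodI)
  show ?thesis
    unfolding 1 2 3 4 5 by (simp add: algebra_simps)
qed

sublocale rec: mod_rec sq sinv "Vec10 J" vproj pair_mod pair_act pair_scal "(1, 0)"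
proof
  have FLx: "form (Q (exd e)) * x \<in> FL n" if "e \<in> Om 0" "x \<in> Vecle0 J n" for e x n
    using that Q_in Om_exd0 by (intro tens_prodI) auto
  show "0 \<in> pair_mod n" for n
    by (simp add: pair_mod_def zero_prod_def V10.pow_le_zero tens_prod_zero)
  show "x + y \<in> pair_mod n" if "x \<in> pair_mod n" "y \<in> pair_mod n" for x y n
    using that by (auto simp: pair_mod_def V10.pow_le_add tens_prod_add)
  show "- x \<in> pair_mod n" if "x \<in> pair_mod n" for x n
    using that by (auto simp: pair_mod_def V10.pow_le_uminus FL_uminus)
  show "pair_mod n \<subseteq> pair_mod (Suc n)" for n
    using FL_mono[of n "Suc n"] V10.pow_le_mono[of n "Suc n"] by (auto simp: pair_mod_def)
  show "pair_scal e x \<in> pair_mod n" if "e \<in> Om 0" "x \<in> pair_mod n" for e x n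
    using that FLx by (auto simp: pair_mod_def pair_scal_def V10.pow_le_scal FL_scal intro: tens_prod_add)
  show "pair_scal e (x + y) = pair_scal e x + pair_scal e y" for e x y
    by (simp add: pair_scal_def split_def distrib_left)
  show "pair_scal (e + f) x = pair_scal e x + pair_scal f x" if "e \<in> Om 0" "f \<in> Om 0" for e f x
    using that by (simp add: pair_scal_def split_def scal_add exd_add Q_simps PQ_Om form_add Om_intros distrib_right)
  show "pair_scal (e * f) x = pair_scal e (pair_scal f x)" if "e \<in> Om 0" "f \<in> Om 0" for e f x
    using that
    by (simp add: pair_scal_def split_def scal_scal[symmetric] mult.assoc exd_mult_0 Q_simps PQ_Om form_add
        Om_intros distrib_right distrib_left form_scal[symmetric] scal_form[symmetric])
  show "pair_act u x \<in> pair_mod (Suc n)" if "u \<in> Vec10 J" "x \<in> pair_mod n" for u x n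
  proof -
    have "fmap Q (sq_vec sq u) \<in> F01 \<otimes>\<^sub>A W10"
      by (rule fmap_in[OF bimod_Q Q_in V10.sq_vec_V[OF that(1)]])
    then show ?thesis
      using that by (auto simp: pair_mod_def pair_act_def V10.vbullet_in fbullet_in rec_map_in Vec10_D intro: tens_prod_add)
  qed
  show "pair_act u (x + y) = pair_act u x + pair_act u y" if "u \<in> Vec10 J" "x \<in> pair_mod n" "y \<in> pair_mod n" for u x y n
    using that
    by (auto simp: pair_mod_def pair_act_def vbullet_add Vecle_TVec Vec10_D fbullet_add_left fmap_Q_FV sq_vec_in rec_map_add)
  show "pair_act (\<lambda>\<xi>. u \<xi> + v \<xi>) x = pair_act u x + pair_act v x" if "u \<in> Vec10 J" "v \<in> Vec10 J" "x \<in> pair_mod n" for u v x n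
    using that
    by (auto simp: pair_mod_def pair_act_def vbullet_plus Vec10_D sq_vec_plus fmap_add[OF bimod_Q] fbullet_add Vecle_TVec fmap_Q_FV sq_vec_in rec_map_plus)
  show "pair_act (vec_lact e u) x = pair_scal e (pair_act u x)" if "u \<in> Vec10 J" "e \<in> Om 0" "x \<in> pair_mod n" for u e x n
  proof -
    have uV: "u \<in> Vec" using that Vec10_D by blast
    have "fmap Q (sq_vec sq (vec_lact e u)) = form (Q (exd e)) * vect u + scal e * fmap Q (sq_vec sq u)"
      using uV that FT_prod[OF order_refl sq_vec_in[OF uV]]
      by (simp add: sq_vec_lact fmap_add[OF bimod_Q] fmap_form[OF bimod_Q] fmap_scal_mult[OF bimod_Q] Om_intros)
    then show ?thesis
      using uV that
      by (auto simp: pair_mod_def pair_act_def pair_scal_def vbullet_lact fbullet_add Vecle_TVec tens_prodI FV_scal fmap_Q_FV sq_vec_in PQ_Om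
          Om_intros fbullet_form fbullet_scal rec_map_lact distrib_left add.assoc)
  qed
  show "pair_act u (pair_scal e x) = pair_act (vec_ract u e) x + pair_scal (u (exd e)) x" if "u \<in> Vec10 J" "e \<in> Om 0" "x \<in> pair_mod n" for u e x n
    using that pair_act_sm_snd by (auto simp: pair_mod_def pair_act_def pair_scal_def vbullet_scal Vecle_TVec Vec10_D)
  show "(1, 0) \<in> pair_mod 0"
    using V10.pow_in_le[of 1 0 0] imageI[OF Om_one, of scal] by (simp add: pair_mod_def tens_prod_zero)
qed


subsection \<open>The operator and its characterization\<close>

lemma pair_scal_apply: "pair_scal e z = (scal e * fst z, form (Q (exd e)) * fst z + scal e * snd z)"
  by (simp add: pair_scal_def split_def)

lemma pair_act_apply: "pair_act u z = (vbullet u (fst z), fbullet (fst z) (fmap Q (sq_vec sq u)) + rec_map u (snd z))"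
  by (simp add: pair_act_def split_def)

text \<open>The first components form the orbit of 1 in \<open>TVec\<close>: the correction that
  \<open>vbullet\<close> adds is the one that \<open>orbit\<close> subtracts. So the second
  component is computed with \<open>x\<close> itself.\<close>

lemma fst_orbit: "x \<in> Vecpow0 J n \<Longrightarrow> fst (rec.orbit n x) = x"
proof (induction n arbitrary: x)
  case 0
  then obtain e where "x = scal e" "e \<in> Om 0" by auto
  then show ?case by (simp add: rec.orbit_0_scal pair_scal_apply[of e "(1, 0)"])
next
  case (Suc n)
  from Suc.prems show ?case
  proof (induction rule: V10.pow_induct)
    case zero
    then show ?case by (simp add: rec.orbit_zero)
  next
    case (add x y)
    then show ?case by (simp add: rec.orbit_add)
  next
    case (mult u y)
    have "sq_all y = sq_deg n y"
      using sq_all_pow V10.pow_full mult(2) by blast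
    then show ?case
      using mult Suc.IH[OF mult(2)] Suc.IH[OF rec.ctr_sq_deg_in[OF mult]]
      by (simp add: rec.orbit_Suc_vect pair_act_apply[of u "rec.orbit n y"] vbullet_def[of u y])
  qed
qed

definition dbar_HD :: "nat \<Rightarrow> 'w tens \<Rightarrow> 'w tens" where
  "dbar_HD n x = (\<Sum>m\<le>n. snd (rec.orbit m (gr vproj m x)))"

lemma additive_dbar_HD: "additive (dbar_HD n)"
  by standard (simp add: dbar_HD_def V10.gr_add rec.orbit_add sum.distrib)

lemmas dbar_HD_add = additive.add[OF additive_dbar_HD] and dbar_HD_zero = additive.zero[OF additive_dbar_HD]

lemma dbar_HD_pow:
  assumes x: "x \<in> Vecpow0 J m" and m: "m \<le> n"
  shows "dbar_HD n x = snd (rec.orbit m x)"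
proof -
  have "dbar_HD n x = (\<Sum>k\<le>n. if k = m then snd (rec.orbit m x) else 0)"
    unfolding dbar_HD_def
    by (rule sum.cong) (simp_all add: V10.gr_pow[OF x] rec.orbit_zero)
  then show ?thesis using m by simp
qed

lemma dbar_HD_in: "x \<in> Vecle0 J m \<Longrightarrow> m \<le> n \<Longrightarrow> dbar_HD n x \<in> FL m"
proof (induction rule: V10.pow_le_induct)
  case (add x y)
  then show ?case by (simp add: dbar_HD_add tens_prod_add)
next
  case (pow k x)
  then have "snd (rec.orbit k x) \<in> FL k"
    using rec.orbit_in[of x k] by (auto simp: pair_mod_def mem_Times_iff)
  then show ?case using pow FL_mono[of k m] by (auto simp: dbar_HD_pow)
qed

text \<open>The Leibniz rule is the second component of the scalar action on pairs, since orbit maps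
  are linear over \<open>A\<close> and the first component is \<open>x\<close>.\<close>

lemma dbar_HD_scal: "x \<in> Vecle0 J n \<Longrightarrow> e \<in> Om 0 \<Longrightarrow>
    dbar_HD n (scal e * x) = form (Q (exd e)) * x + scal e * dbar_HD n x"
proof (induction rule: V10.pow_le_induct)
  case (add x y)
  then show ?case by (simp add: dbar_HD_add distrib_left)
next
  case (pow m x)
  then show ?case
    by (simp add: dbar_HD_pow[OF V10.pow_scal] dbar_HD_pow rec.orbit_scal_mult pair_scal_apply[of e "rec.orbit m x"] fst_orbit)
qed

lemma dbar_eq: "dbar J 0 0 e = Q (exd e)"
  by (simp add: dbar_def One_nat_def)

lemma ev_id_phi: "u \<in> Vec \<Longrightarrow> z \<in> Ompq J 1 1 \<Longrightarrow> ev_id (vect u * phi J z) = ev_phi u z"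
  by (simp add: ev_id_vect phi_FT ev_phi_def)

text \<open>Here both choices in the recursion disappear: the decomposition because the sum over it
  is the value of the well defined \<open>rec_map\<close>, and the dual basis by
  \<open>hbasis_sum_transpose\<close> with \<open>e = 1\<close>.\<close>

lemma HD_rhs_eq:
  assumes u: "u \<in> Vec10 J" and v: "v \<in> Vecle0 J m" and ps: "set ps \<subseteq> \<Omega>01 \<times> Vecle0 J m"
    and bs: "dual_basis \<Omega>10 (Vec10 J) bs"
  shows "HD_rhs J sq sinv bs u v ps = fbullet v (fmap Q (sq_vec sq u)) + rec_map u (\<Sum>(\<xi>, w)\<leftarrow>ps. form \<xi> * w)"
proof -
  note uV = Vec10_D[OF u]
  have "form_bullet sq sinv (map_fst Q (sq_vec sq u)) v = fbullet v (fmap Q (sq_vec sq u))"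
    using uV sq_vec_in[OF uV]
    by (simp add: map_fst_eq[OF bimod_Q FT_prod[OF order_refl]] form_bullet_eq Vecle_TVec[OF v] FV_FTV fmap_Q_FV fbullet_def)
  moreover have "rec_map u (\<Sum>(\<xi>, w)\<leftarrow>ps. form \<xi> * w) = (\<Sum>(\<xi>, w)\<leftarrow>ps. rec_term u \<xi> w)"
  proof -
    have "set ps \<subseteq> Om 1 \<times> Vecle0 J m" using ps \<Omega>01_D by blast
    then show ?thesis using bcase_sum_list[OF rec_term_bal[OF uV]] by (simp add: rec_map_def)
  qed
  moreover have "(\<Sum>(\<xi>, w)\<leftarrow>ps. rec_term u \<xi> w) =
      - (\<Sum>(\<xi>, w)\<leftarrow>ps. ev_id (vect u * phi J (wedge2 Q P (sq \<xi>))) * w)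
      - (\<Sum>(\<xi>, w)\<leftarrow>ps. \<Sum>(\<eta>, \<eta>')\<leftarrow>bs. ev_id (vect u * phi J (\<xi> * \<eta>)) * bullet sq sinv (vect \<eta>') w)"
    using ps
  proof (induction ps)
    case (Cons q ps)
    obtain \<xi> w where q: "q = (\<xi>, w)" and \<xi>: "\<xi> \<in> \<Omega>01" and w: "w \<in> Vecle0 J m"
      using Cons by auto
    note \<xi>' = \<Omega>01_D[OF \<xi>]
    have mem: "fst r \<in> \<Omega>10 \<and> snd r \<in> Vec" if "r \<in> set bs" for r
      using bs that Vec10_D by (auto simp: dual_basis_def)
    have "(\<Sum>(\<eta>, \<eta>')\<leftarrow>bs. ev_id (vect u * phi J (\<xi> * \<eta>)) * bullet sq sinv (vect \<eta>') w) =
        (\<Sum>(\<eta>, \<eta>')\<leftarrow>bs. ev_phi u (\<xi> * (1 * \<eta>)) * vbullet \<eta>' w)"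
      by (rule sum_list_cong)
        (use mem \<xi> uV in \<open>auto simp: ev_id_phi \<Omega>11_mult bullet_props[OF Vecle_TVec[OF w]]\<close>)
    also have "\<dots> = (\<Sum>(\<eta>, \<eta>')\<leftarrow>hbasis. ev_phi u (\<xi> * \<eta>) * vbullet (vec_ract \<eta>' 1) w)"
      by (rule hbasis_sum_transpose[OF uV \<xi> Vecle_TVec[OF w] bs Om_one])
    also have "\<dots> = (\<Sum>(\<eta>, \<eta>')\<leftarrow>hbasis. ev_phi u (Q \<xi> * \<eta>) * vbullet \<eta>' w)"
    proof (rule sum_list_cong)
      fix r assume "r \<in> set hbasis"
      then have "vec_ract (snd r) 1 = snd r"
        using hbasis_mem[of r] by (auto simp: vec_ract_def Vec_notin fun_eq_iff)
      then show "(case r of (\<eta>, \<eta>') \<Rightarrow> ev_phi u (\<xi> * \<eta>) * vbullet (vec_ract \<eta>' 1) w) = (case r of (\<eta>, \<eta>') \<Rightarrow> ev_phi u (Q \<xi> * \<eta>) * vbullet \<eta>' w)"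
        using \<xi>' by (simp add: split_def)
    qed
    moreover have "ev_id (vect u * phi J (wedge2 Q P (sq \<xi>))) = ev_phi u (wedge_op Q P (sq (Q \<xi>)))"
      using \<xi>' uV by (simp add: wedge2_eq bimod_P bimod_Q sq_in ev_id_phi wedge_op_QP_in)
    ultimately have rec_term: "rec_term u \<xi> w = - (ev_id (vect u * phi J (wedge2 Q P (sq \<xi>))) * w)
        - (\<Sum>(\<eta>, \<eta>')\<leftarrow>bs. ev_id (vect u * phi J (\<xi> * \<eta>)) * bullet sq sinv (vect \<eta>') w)"
      by (simp add: rec_term_def)
    have ps: "set ps \<subseteq> \<Omega>01 \<times> Vecle0 J m" using Cons.prems by simp
    show ?case
      unfolding q list.map sum_list.Cons prod.case rec_term Cons.IH[OF ps] by (simp add: algebra_simps)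
  qed simp
  ultimately show ?thesis by (simp add: HD_rhs_def)
qed

lemma scal_in_Vecle: "e \<in> Om 0 \<Longrightarrow> scal e \<in> Vecle0 J n"
  by (rule V10.pow_in_le[of _ 0]) auto

lemma vect_in_Vecle: "u \<in> Vec10 J \<Longrightarrow> n \<ge> 1 \<Longrightarrow> vect u \<in> Vecle0 J n"
  by (rule V10.pow_in_le[OF V10.pow_vect])

lemma bullet_eq:
  assumes u: "u \<in> Vec10 J" and v: "v \<in> Vecpow0 J m"
  shows "bullet sq sinv (vect u) v = vect u * v + ctr u (sq_deg m v)"
proof -
  have "sq_all v = sq_deg m v" using sq_all_pow V10.pow_full v by blast
  then show ?thesis
    using u by (simp add: bullet_props[OF Vecle_TVec[OF V10.pow_in_le[OF v order_refl]]] Vec10_D vbullet_def)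
qed

lemma vect_mult_pow: "u \<in> Vec10 J \<Longrightarrow> v \<in> Vecpow0 J m \<Longrightarrow> vect u * v \<in> Vecpow0 J (Suc m)"
  by (auto intro: tens_prodI)

text \<open>The product \<bullet> differs from the tensor product by a term of degree
  \<open>m\<close>, and this term compensates the one subtracted in \<open>orbit\<close>, leaving
  the plain action of \<open>u\<close>.\<close>

lemma dbar_HD_bullet:
  assumes u: "u \<in> Vec10 J" and v: "v \<in> Vecpow0 J m" and m: "m < n"
  shows "dbar_HD n (bullet sq sinv (vect u) v) = fbullet v (fmap Q (sq_vec sq u)) + rec_map u (dbar_HD n v)"
proof -
  have "dbar_HD n (bullet sq sinv (vect u) v) = snd (rec.orbit (Suc m) (vect u * v) + rec.orbit m (ctr u (sq_deg m v)))"
    using m dbar_HD_pow[OF vect_mult_pow[OF u v]] dbar_HD_pow[OF rec.ctr_sq_deg_in[OF u v]]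
    by (simp add: bullet_eq[OF u v] dbar_HD_add)
  also have "\<dots> = snd (pair_act u (rec.orbit m v))"
    by (simp add: rec.orbit_Suc_vect[OF u v])
  also have "\<dots> = fbullet v (fmap Q (sq_vec sq u)) + rec_map u (dbar_HD n v)"
    using m by (simp add: pair_act_apply fst_orbit[OF v] dbar_HD_pow[OF v])
  finally show ?thesis .
qed

lemma dbar_HD_vect:
  assumes u: "u \<in> Vec10 J" and n: "n \<ge> 1"
  shows "dbar_HD n (vect u) = map_fst Q (sq_vec sq u)"
proof -
  have sm1: "pair_scal 1 (1, 0) = (1, 0)"
    using bimod_map_zero[OF bimod_Q] by (simp add: pair_scal_apply)
  have SQ1: "sq_all 1 = 0"
    using sq_all_pow[of 1 0] sq_deg_0_scal[OF Om_one] imageI[OF Om_one, of scal] by simp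
  note t = fmap_Q_FV[OF sq_vec_in[OF Vec10_D[OF u]]]
  have one: "1 \<in> (TVec :: 'w tens set)"
    using Vecle_TVec[OF scal_in_Vecle[OF Om_one]] by simp
  \<comment> \<open>1 is a right unit of \<bullet> because its derivative is 0.\<close>
  have FB1: "fbullet 1 s = s" if "s \<in> FV" for s
    using that by (induction rule: FV_induct) (simp_all add: fbullet_zero fbullet_add fbullet_form one vbullet_def SQ1 ctr_zero)
  have "dbar_HD n (vect u) = snd (pair_act u (1, 0))"
    using n by (simp add: dbar_HD_pow[OF V10.pow_vect[OF u]] rec.orbit_1_vect[OF u sm1])
  also have "\<dots> = fmap Q (sq_vec sq u)"
    using u by (simp add: pair_act_apply FB1[OF t] rec_map_zero Vec10_D)
  finally show ?thesis
    by (simp add: map_fst_eq[OF bimod_Q FT_prod[OF order_refl sq_vec_in[OF Vec10_D[OF u]]]])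
qed

lemma Vecle_mono: "m \<le> n \<Longrightarrow> x \<in> Vecle0 J m \<Longrightarrow> x \<in> Vecle0 J n"
  using V10.pow_le_mono by blast

lemma bullet_in: "u \<in> Vec10 J \<Longrightarrow> v \<in> Vecpow0 J m \<Longrightarrow> m < n \<Longrightarrow> bullet sq sinv (vect u) v \<in> Vecle0 J n"
  using V10.pow_le_add[OF V10.pow_in_le[OF vect_mult_pow] V10.pow_in_le[OF rec.ctr_sq_deg_in]]
  by (simp add: bullet_eq)

text \<open>Agreement on the domain is all that is assumed of \<open>D\<close>, so that both
  \<open>dbar_HD n\<close> and its restriction are covered.\<close>

lemma is_dbar_HD_dbar_HD:
  assumes D: "\<And>x. x \<in> Vecle0 J n \<Longrightarrow> D x = dbar_HD n x"
  shows "is_dbar_HD J sq sinv n D"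
  unfolding is_dbar_HD_def
proof (intro conjI allI impI ballI)
  show "D \<in> Vecle0 J m \<rightarrow> FL m" if "m \<le> n" for m
    using that D dbar_HD_in Vecle_mono by (intro Pi_I) metis
  show "additive_on (Vecle0 J n) D"
    by (simp add: additive_on_def D V10.pow_le_add dbar_HD_add)
  show "D (scal e) = form (dbar J 0 0 e)" if "e \<in> Om 0" for e
  proof -
    have "scal e \<in> Vecpow0 J 0" using that by auto
    then show ?thesis
      using that dbar_HD_pow[of "scal e" 0 n] by (simp add: D scal_in_Vecle rec.orbit_0_scal pair_scal_apply dbar_eq)
  qed
  show "D (vect u) = map_fst Q (sq_vec sq u)" if "1 \<le> n" "u \<in> Vec10 J" for u
    using that by (simp add: D vect_in_Vecle dbar_HD_vect)
  fix m u v ps bs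
  assume m: "1 \<le> m \<and> m < n" and u: "u \<in> Vec10 J" and v: "v \<in> Vecpow0 J m"
    and *: "set ps \<subseteq> \<Omega>01 \<times> Vecle0 J m \<and> D v = (\<Sum>(\<xi>, w)\<leftarrow>ps. form \<xi> * w) \<and> dual_basis \<Omega>10 (Vec10 J) bs"
  have "D v = dbar_HD n v"
    using m by (intro D V10.pow_in_le[OF v]) simp
  then show "D (bullet sq sinv (vect u) v) = HD_rhs J sq sinv bs u v ps"
    using m u v * HD_rhs_eq[OF u V10.pow_in_le[OF v order_refl], of ps bs]
    by (simp add: D bullet_in dbar_HD_bullet)
qed

text \<open>By induction on the degree: \<open>u \<otimes> v\<close> is the product
  \<open>u \<bullet> v\<close>, where the recursion determines the value, minus a term of the degree
  of \<open>v\<close>, where the maps already agree.\<close>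

lemma is_dbar_HD_unique:
  assumes D: "is_dbar_HD J sq sinv n D" and D': "is_dbar_HD J sq sinv n D'" and x: "x \<in> Vecle0 J n"
  shows "D x = D' x"
proof -
  define S where "S x \<longleftrightarrow> x \<in> Vecle0 J n \<and> D x = D' x" for x
  note D_def = D[unfolded is_dbar_HD_def] and D'_def = D'[unfolded is_dbar_HD_def]
  have D_add: "D (x + y) = D x + D y" and D'_add: "D' (x + y) = D' x + D' y"
    if "x \<in> Vecle0 J n" "y \<in> Vecle0 J n" for x y
    using that D_def D'_def unfolding additive_on_def by blast+
  have S_add: "S (x + y)" if "S x" "S y" for x y
    using that by (simp add: S_def D_add D'_add V10.pow_le_add)
  have S_zero: "S 0"
    using D_add[of 0 0] D'_add[of 0 0] V10.pow_le_zero by (simp add: S_def)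
  have S_pow: "S x" if "x \<in> Vecpow0 J m" "m \<le> n" for m x
    using that
  proof (induction m arbitrary: x)
    case 0
    then obtain e where "x = scal e" "e \<in> Om 0" by auto
    then show ?case using D_def D'_def by (simp add: S_def scal_in_Vecle)
  next
    case (Suc m)
    from Suc.prems(1) show ?case
    proof (induction rule: V10.pow_induct)
      case zero
      show ?case by (rule S_zero)
    next
      case (add x y)
      then show ?case by (rule S_add)
    next
      case (mult u v)
      show ?case
      proof (cases "m = 0")
        case True
        \<comment> \<open>The recursion starts at \<open>m = 1\<close>, so degree one is settled by
          the initial values: a vector times a scalar is again a vector of type (1,0).\<close>
        then obtain e where e: "v = scal e" "e \<in> Om 0" using mult by auto
        have u': "vec_ract u e \<in> Vec10 J" using mult e by (simp add: V10.V_ract)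
        have "vect u * v = vect (vec_ract u e)" using mult e by (simp add: vect_scal Vec10_D)
        then show ?thesis
          using u' D_def D'_def Suc.prems(2) by (simp add: S_def vect_in_Vecle)
      next
        case False
        then have m: "1 \<le> m \<and> m < n" using Suc.prems by simp
        have v: "v \<in> Vecle0 J m" "v \<in> Vecle0 J n" using m by (auto intro: V10.pow_in_le[OF mult(2)])
        have Dv: "D v = D' v" using Suc.IH[OF mult(2)] m by (simp add: S_def)
        have "D v \<in> FL m"
          using conjunct1[OF D_def] m v(1) by (auto dest!: spec[of _ m])
        \<comment> \<open>As the two maps agree at \<open>v\<close>, this decomposition can be used
          in the recursion of both.\<close>
        then obtain ps where ps: "set ps \<subseteq> \<Omega>01 \<times> Vecle0 J m" "D v = (\<Sum>(\<xi>, w)\<leftarrow>ps. form \<xi> * w)"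
          by (rule tens_prod_list)
        have rhs: "D (bullet sq sinv (vect u) v) = HD_rhs J sq sinv hbasis u v ps"
          "D' (bullet sq sinv (vect u) v) = HD_rhs J sq sinv hbasis u v ps"
          using D_def D'_def m mult ps hbasis Dv by metis+
        have c: "S (ctr u (sq_deg m v))"
          using Suc.IH[OF rec.ctr_sq_deg_in[OF mult]] m by simp
        have uv: "vect u * v \<in> Vecle0 J n"
          using V10.pow_in_le[OF vect_mult_pow[OF mult]] m by simp
        have "D (vect u * v) + D (ctr u (sq_deg m v)) = D' (vect u * v) + D' (ctr u (sq_deg m v))"
          using rhs c uv by (simp add: bullet_eq[OF mult] D_add D'_add S_def)
        then show ?thesis using c uv by (simp add: S_def)
      qed
    qed
  qed
  have "S x"
    using x by (induction rule: V10.pow_le_induct) (auto intro: S_add S_pow)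
  then show ?thesis by (simp add: S_def)
qed

text \<open>\<open>is_dbar_HD\<close> prescribes values on the domain only;
  \<open>extensional\<close> fixes them elsewhere, so that uniqueness can be stated for functions on
  the whole type.\<close>

lemma is_dbar_HD_ex1: "\<exists>!D. D \<in> extensional (Vecle0 J n) \<and> is_dbar_HD J sq sinv n D"
proof (rule ex_ex1I)
  show "\<exists>D. D \<in> extensional (Vecle0 J n) \<and> is_dbar_HD J sq sinv n D"
    by (rule exI[of _ "restrict (dbar_HD n) (Vecle0 J n)"]) (auto intro: is_dbar_HD_dbar_HD)
  show "D = D'" if "D \<in> extensional (Vecle0 J n) \<and> is_dbar_HD J sq sinv n D"
    "D' \<in> extensional (Vecle0 J n) \<and> is_dbar_HD J sq sinv n D'" for D D'
    using that is_dbar_HD_unique by (intro extensionalityI[of D "Vecle0 J n" D']) blast+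
qed

lemma is_dbar_HD_left_derivative:
  assumes D: "is_dbar_HD J sq sinv n D"
  shows "left_dbar_derivative J (Vecle0 J n) D"
proof -
  have eq: "D x = dbar_HD n x" if "x \<in> Vecle0 J n" for x
    using is_dbar_HD_unique[OF D is_dbar_HD_dbar_HD that] by blast
  have "D \<in> Vecle0 J n \<rightarrow> FL n"
    using eq dbar_HD_in[OF _ order_refl] by (intro Pi_I) simp
  moreover have "additive_on (Vecle0 J n) D"
    using D by (simp add: is_dbar_HD_def)
  ultimately show ?thesis
    by (simp add: left_dbar_derivative_def eq V10.pow_le_scal dbar_HD_scal dbar_eq)
qed

end

theorem proposition14p1:
  fixes J :: "'w::star_dga \<Rightarrow> 'w"
    and sq :: "'w \<Rightarrow> 'w tens"
    and sinv :: "'w tens \<Rightarrow> 'w tens"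
  assumes "right_fgp (Om 1 :: 'w set)"
    and "almost_complex J"
    and "right_bimod_conn sq sinv"
    and a: "bij_betw wedge (form ` Ompq J 1 0 \<otimes>\<^sub>A form ` Ompq J 0 1) (Ompq J 1 1)"
    and b: "\<forall>\<xi>\<in>Om 1. map_fst J (sq \<xi>) = sq (J \<xi>)"
    and c: "\<forall>\<xi>\<in>Om 1. proj J 1 1 (exd \<xi> + wedge (sq \<xi>)) = 0"
    and d: "\<forall>t\<in>form ` Om 1 \<otimes>\<^sub>A form ` Om 1. proj J 1 1 (wedge (sinv t)) =
      - wedge2 (proj J 0 1) (proj J 1 0) t - wedge2 (proj J 1 0) (proj J 0 1) t"
  shows "\<forall>n.
    (\<exists>!D. D \<in> extensional (Vecle0 J n) \<and> is_dbar_HD J sq sinv n D) \<and>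
    (\<forall>D. is_dbar_HD J sq sinv n D \<longrightarrow> left_dbar_derivative J (Vecle0 J n) D)"
proof -
  interpret holomorphic_conn J sq sinv
    by unfold_locales (fact assms)+
  show ?thesis
    using is_dbar_HD_ex1 is_dbar_HD_left_derivative by blast
qed

end
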